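(* Let $m\ge1$ and let $k\ge0$ be an integer. If $k$ is odd, the space of modes of wavenumber $k$ of $S^3/D_m^*$ is $\{0\}$. If $k$ is even, consider the polynomials $(\alpha^2\beta^2)^a(\alpha^{2m}+\beta^{2m})^b(\alpha\beta(\alpha^{2m}-\beta^{2m}))^c$ if $m$ is even, or $(\alpha^2\beta^2)^a(\alpha^{2m}-\beta^{2m})^b(\alpha\beta(\alpha^{2m}+\beta^{2m}))^c$ if $m$ is odd, over all integers $a\ge0$, $b\ge0$, $c\in\{0,1\}$ with $4a+2mb+(2m+2)c=k$. These polynomials together with all their siblings (restricted to $S^3$) form a basis of the space of modes of wavenumber $k$ of $S^3/D_m^*$, and this space has dimension $$\left(2\left\lfloor\frac{k/2}{2}\right\rfloor+\left\lfloor\frac{k/2}{m}\right\rfloor-\frac k2+1\right)(k+1).$$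
   Context: Identify $\mathbb R^4$ with $\mathbb C^2$ via $\alpha=x+iy$, $\beta=z+iw$, $S^3=\{|\alpha|^2+|\beta|^2=1\}$. Wirtinger derivatives $\frac{\partial}{\partial\alpha}=\frac12(\partial_x-i\partial_y)$, similarly for $\beta$ with $(z,w)$. $\mathrm{twist}_-=-\bar\beta\frac{\partial}{\partial\alpha}+\bar\alpha\frac{\partial}{\partial\beta}$. For a polynomial $f$ in $\alpha,\beta$ only, homogeneous of degree $k$, its siblings are $\mathrm{twist}_-^j f$, $j=0,\dots,k$. $\gamma\in SU(2)$ acts on $\mathbb C^2$ by $(\alpha,\beta)^T\mapsto\gamma(\alpha,\beta)^T$ and on functions by $(R_\gamma F)(x)=F(\gamma^{-1}x)$. For a finite subgroup $\Gamma\subset SU(2)$, the space of modes of wavenumber $k$ of $S^3/\Gamma$ is the complex vector space of $\Gamma$-invariant $F:S^3\to\mathbb C$ with $\Delta_{S^3}F=-k(k+2)F$. The binary dihedral group $D_m^*$ (order $4m$) is the subgroup of $SU(2)$ generated by $\begin{pmatrix}0&i\\ i&0\end{pmatrix}$ and $\mathrm{diag}(e^{i\pi/m},e^{-i\pi/m})$. *)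

theory Defs
  imports "HOL-Analysis.Analysis" "HOL-Library.Function_Algebras"
begin

text \<open>Points of R^4 = C^2 are vectors x :: complex^2 with alpha = x$1, beta = x$2.
  The norm of complex^2 is sqrt(|alpha|^2+|beta|^2), so S^3 is the unit sphere.\<close>

definition pt :: "complex \<Rightarrow> complex \<Rightarrow> complex^2" where
  "pt a b = (\<chi> i. if i = 1 then a else b)"

definition S3 :: "(complex^2) set" where
  "S3 = {x. norm x = 1}"

definition ex :: "complex^2" where "ex = pt 1 0"
definition ey :: "complex^2" where "ey = pt \<i> 0"
definition ez :: "complex^2" where "ez = pt 0 1"
definition ew :: "complex^2" where "ew = pt 0 \<i>"

definition pd :: "complex^2 \<Rightarrow> (complex^2 \<Rightarrow> complex) \<Rightarrow> complex^2 \<Rightarrow> complex" where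
  "pd v G p = vector_derivative (\<lambda>t::real. G (p + t *\<^sub>R v)) (at 0)"

definition coord_dirs :: "(complex^2) set" where
  "coord_dirs = {ex, ey, ez, ew}"

definition C2_on :: "(complex^2) set \<Rightarrow> (complex^2 \<Rightarrow> complex) \<Rightarrow> bool" where
  "C2_on U G \<longleftrightarrow>
     (\<forall>v\<in>coord_dirs. \<forall>p\<in>U. ((\<lambda>t::real. G (p + t *\<^sub>R v)) has_vector_derivative pd v G p) (at 0)) \<and>
     (\<forall>u\<in>coord_dirs. \<forall>v\<in>coord_dirs. \<forall>p\<in>U.
        ((\<lambda>t::real. pd v G (p + t *\<^sub>R u)) has_vector_derivative pd u (pd v G) p) (at 0)) \<and>
     (\<forall>u\<in>coord_dirs. \<forall>v\<in>coord_dirs. continuous_on U (pd u (pd v G)))"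

definition lap4 :: "(complex^2 \<Rightarrow> complex) \<Rightarrow> complex^2 \<Rightarrow> complex" where
  "lap4 G p = (\<Sum>v\<in>coord_dirs. pd v (pd v G) p)"

definition hext :: "(complex^2 \<Rightarrow> complex) \<Rightarrow> complex^2 \<Rightarrow> complex" where
  "hext F x = F ((1 / norm x) *\<^sub>R x)"

text \<open>Laplace-Beltrami operator of S^3: the Euclidean Laplacian of the 0-homogeneous
  extension, evaluated on S^3.\<close>
definition lapS3 :: "(complex^2 \<Rightarrow> complex) \<Rightarrow> complex^2 \<Rightarrow> complex" where
  "lapS3 F p = lap4 (hext F) p"

text \<open>Functions on S^3 are represented as functions on C^2 vanishing off S^3;
  F is smooth enough (C^2) on S^3 if its homogeneous extension is C^2 on R^4 minus 0.\<close>
definition S3_fun :: "(complex^2 \<Rightarrow> complex) \<Rightarrow> bool" where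
  "S3_fun F \<longleftrightarrow> (\<forall>p. p \<notin> S3 \<longrightarrow> F p = 0) \<and> C2_on (- {0}) (hext F)"

definition restrS3 :: "(complex^2 \<Rightarrow> complex) \<Rightarrow> complex^2 \<Rightarrow> complex" where
  "restrS3 G p = (if p \<in> S3 then G p else 0)"

definition Ract :: "complex^2^2 \<Rightarrow> (complex^2 \<Rightarrow> complex) \<Rightarrow> complex^2 \<Rightarrow> complex" where
  "Ract \<gamma> F x = F (matrix_inv \<gamma> *v x)"

definition mat2 :: "complex \<Rightarrow> complex \<Rightarrow> complex \<Rightarrow> complex \<Rightarrow> complex^2^2" where
  "mat2 a b c d = (\<chi> i. if i = 1 then pt a b else pt c d)"

text \<open>Binary dihedral group D_m^* as the subgroup of SU(2) generated by the two matrices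
  (the group is finite, so the generated subgroup is the closure under products).\<close>
inductive_set binary_dihedral :: "nat \<Rightarrow> (complex^2^2) set" for m :: nat where
  one: "mat 1 \<in> binary_dihedral m"
| gen1: "mat2 0 \<i> \<i> 0 \<in> binary_dihedral m"
| gen2: "mat2 (cis (pi / m)) 0 0 (cis (- pi / m)) \<in> binary_dihedral m"
| mult: "g \<in> binary_dihedral m \<Longrightarrow> h \<in> binary_dihedral m \<Longrightarrow> g ** h \<in> binary_dihedral m"

definition modes :: "(complex^2^2) set \<Rightarrow> nat \<Rightarrow> (complex^2 \<Rightarrow> complex) set" where
  "modes \<Gamma> k = {F. S3_fun F \<and>
      (\<forall>\<gamma>\<in>\<Gamma>. \<forall>p\<in>S3. Ract \<gamma> F p = F p) \<and>
      (\<forall>p\<in>S3. lapS3 F p = - of_nat (k * (k + 2)) * F p)}"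

definition d_alpha :: "(complex^2 \<Rightarrow> complex) \<Rightarrow> complex^2 \<Rightarrow> complex" where
  "d_alpha G p = (pd ex G p - \<i> * pd ey G p) / 2"

definition d_beta :: "(complex^2 \<Rightarrow> complex) \<Rightarrow> complex^2 \<Rightarrow> complex" where
  "d_beta G p = (pd ez G p - \<i> * pd ew G p) / 2"

definition twist_minus :: "(complex^2 \<Rightarrow> complex) \<Rightarrow> complex^2 \<Rightarrow> complex" where
  "twist_minus G p = - cnj (p$2) * d_alpha G p + cnj (p$1) * d_beta G p"

definition dihedral_poly :: "nat \<Rightarrow> nat \<Rightarrow> nat \<Rightarrow> nat \<Rightarrow> complex^2 \<Rightarrow> complex" where
  "dihedral_poly m a b c x =
     (let \<alpha> = x$1; \<beta> = x$2 in
      if even m then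
        (\<alpha>^2 * \<beta>^2)^a * (\<alpha>^(2*m) + \<beta>^(2*m))^b * (\<alpha> * \<beta> * (\<alpha>^(2*m) - \<beta>^(2*m)))^c
      else
        (\<alpha>^2 * \<beta>^2)^a * (\<alpha>^(2*m) - \<beta>^(2*m))^b * (\<alpha> * \<beta> * (\<alpha>^(2*m) + \<beta>^(2*m)))^c)"

definition fscale :: "complex \<Rightarrow> (complex^2 \<Rightarrow> complex) \<Rightarrow> complex^2 \<Rightarrow> complex" where
  "fscale c F = (\<lambda>x. c * F x)"

end

theory Submission
  imports Defs "HOL-Computational_Algebra.Polynomial"
begin

text \<open>
  Right multiplication by the unit quaternions gives three complex structures \<open>J1, J2, J3\<close> on
  \<open>\<complex>\<^sup>2\<close> that commute with \<open>SU(2)\<close>, and the Laplacian of \<open>S\<^sup>3\<close> is the sum of the squared derivatives along their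
  flows. Rotation invariance of the surface measure therefore makes it symmetric, so eigenfunctions of
  different eigenvalues are orthogonal.

  Let \<open>hp p q i\<close> be the coefficient of \<open>u\<^sup>i\<close> in \<open>(\<beta> + \<alpha> u)\<^sup>p (cnj \<alpha> - cnj \<beta> u)\<^sup>q\<close>. It is an
  eigenfunction of wavenumber \<open>p + q\<close>, \<open>twist_minus\<close> sends it to \<open>p\<close> times \<open>hp (p - 1) (q + 1) i\<close>,
  and \<open>hp k 0 i\<close> is a multiple of the monomial \<open>\<alpha>\<^sup>i \<beta>\<^sup>k\<^sup>-\<^sup>i\<close>. On \<open>S\<^sup>3\<close> the span of all \<open>hp p q i\<close> is
  closed under multiplication by coordinates, hence dense by Stone-Weierstrass; so the eigenfunctions
  of wavenumber \<open>k\<close> are exactly the combinations of the \<open>hp p q i\<close> with \<open>p + q = k\<close>.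

  The two generators of the group act on the index \<open>i\<close> only, and averaging reduces the problem to
  binary forms of degree \<open>k = 2 n\<close> spanned by \<open>\<alpha>\<^sup>i \<beta>\<^sup>k\<^sup>-\<^sup>i + (-1)\<^sup>n \<alpha>\<^sup>k\<^sup>-\<^sup>i \<beta>\<^sup>i\<close> with \<open>i\<close> congruent to
  \<open>n\<close> modulo \<open>m\<close>. Newton's recursion for power sums expresses these in the given polynomials, which
  are independent because they vanish to different orders at \<open>\<alpha> = 0\<close>.
\<close>

section \<open>The rotation-invariant measure on the sphere\<close>

text \<open>The obstacle is analytic: \<open>S3_fun\<close> grants only partial derivatives of the
  degree-0 extension, and a member of \<open>modes\<close> is not known in advance to be a
  polynomial. Defining the measure through Lebesgue measure on the ball makes rotation invariance
  the only geometric input: the integral of a function is constant along a rotation flow, and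
  integration by parts is the derivative of this fact.

  Up to constants, the \<open>hp p q i\<close> with \<open>p + q = k\<close> are the matrix
  coefficients of the irreducible representation of SU(2) on binary forms of degree
  \<open>k\<close>. The flows and \<open>twist_minus\<close> act from one side and change only
  \<open>p\<close> and \<open>q\<close>; the group acts from the other side. Hence siblings of
  invariant forms are invariant, and the dimension is \<open>k + 1\<close>, the number of values of
  \<open>q\<close>, times the number of independent invariant forms. With \<open>k = 2 * n\<close>
  the latter counts the values \<open>t = b + c\<close> with \<open>m * t \<le> n\<close>, where
  \<open>t = 0\<close> occurs only for even \<open>n\<close>; the terms
  \<open>2 * (n div 2) - n + 1\<close> are the indicator of even \<open>n\<close>.\<close>

definition iota :: "real^4 \<Rightarrow> complex^2" where
  "iota y = pt (Complex (y$1) (y$2)) (Complex (y$3) (y$4))"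

definition iota_inv :: "complex^2 \<Rightarrow> real^4" where
  "iota_inv x = (\<chi> i. if i = 1 then Re (x$1) else if i = 2 then Im (x$1)
    else if i = 3 then Re (x$2) else Im (x$2))"

lemma pt_nth [simp]: "pt a b $ 1 = a" "pt a b $ 2 = b"
  by (simp_all add: pt_def)

lemma vec2_eq_iff: "x = y \<longleftrightarrow> x$1 = y$1 \<and> x$2 = y$2" for x y :: "'a^2"
  by (simp add: vec_eq_iff forall_2)

lemma norm_vec2: "norm x ^ 2 = cmod (x$1) ^ 2 + cmod (x$2) ^ 2" for x :: "complex^2"
  by (simp add: norm_vec_def L2_set_def sum_2 )

lemma iota_inverse [simp]: "iota (iota_inv x) = x" "iota_inv (iota y) = y"
  by (simp_all add: iota_def iota_inv_def vec2_eq_iff vec_eq_iff forall_4 complex_eq_iff)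

lemma linear_iota: "linear iota"
  by (rule linearI) (simp_all add: iota_def vec2_eq_iff complex_eq_iff)

lemma linear_iota_inv: "linear iota_inv"
  by (rule linearI) (simp_all add: iota_inv_def vec_eq_iff forall_4)

lemma norm_iota [simp]: "norm (iota y) = norm y"
proof -
  have "norm (iota y) ^ 2 = norm y ^ 2"
    unfolding norm_vec2 by (simp add: iota_def norm_vec_def L2_set_def sum_4 cmod_power2 sum_nonneg)
  then show ?thesis by simp
qed

lemma norm_iota_inv [simp]: "norm (iota_inv x) = norm x"
  by (metis iota_inverse(1) norm_iota)

text \<open>Surface measure of \<open>S3\<close> up to a constant factor: Lebesgue measure of the
  ball, projected radially. Finiteness and invariance are inherited from \<open>lborel\<close>. The
  ball is taken in \<open>real^4\<close> because orthogonal maps are known to preserve Lebesgue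
  measure on \<open>real^'n\<close>.\<close>

definition sphere_measure :: "(complex^2) measure" where
  "sphere_measure = distr (restrict_space lborel (ball 0 1)) borel (\<lambda>y. sgn (iota y))"

lemma continuous_iota: "continuous_on S iota"
  by (simp add: linear_continuous_on linear_conv_bounded_linear[symmetric] linear_iota)

lemma measurable_sgn_iota [measurable]: "(\<lambda>y. sgn (iota y)) \<in> borel_measurable borel"
proof -
  have "iota \<in> borel_measurable borel" by (intro borel_measurable_continuous_onI continuous_iota)
  then show ?thesis unfolding sgn_div_norm by measurable
qed

lemma sets_sphere_measure [simp, measurable_cong]: "sets sphere_measure = sets borel"
  by (simp add: sphere_measure_def)

lemma space_sphere_measure [simp]: "space sphere_measure = UNIV"
  by (simp add: sphere_measure_def)

lemma emeasure_sphere_measure: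
  assumes "A \<in> sets borel"
  shows "emeasure sphere_measure A = emeasure lborel ((\<lambda>y. sgn (iota y)) -` A \<inter> ball 0 1)"
proof -
  have m: "(\<lambda>y. sgn (iota y)) \<in> measurable (restrict_space lborel (ball 0 1)) borel"
    by (rule measurable_restrict_space1) simp
  show ?thesis
    unfolding sphere_measure_def
    by (subst emeasure_distr[OF m assms])
       (simp add: emeasure_restrict_space space_restrict_space)
qed

lemma finite_measure_sphere: "finite_measure sphere_measure"
proof (rule finite_measureI)
  show "emeasure sphere_measure (space sphere_measure) \<noteq> \<infinity>"
    using emeasure_lborel_ball_finite[of "0::real^4" 1]
    by (simp add: emeasure_sphere_measure less_top)
qed

lemma emeasure_lborel_orthogonal_vimage:
  fixes f :: "real^'n::{finite,wellorder} \<Rightarrow> real^'n::_"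
  assumes f: "orthogonal_transformation f" and S: "S \<in> sets borel" "bounded S"
  shows "emeasure lborel (f -` S) = emeasure lborel S"
proof -
  obtain g where g: "orthogonal_transformation g" "\<And>x. g (f x) = x" "\<And>y. f (g y) = y"
    using orthogonal_transformation_inv[OF f] orthogonal_transformation_bij[OF f]
    by (metis bij_inv_eq_iff)
  have im: "f -` S = g ` S" using g(3) by (auto simp: image_iff) (metis g(2))
  have Sl: "S \<in> lmeasurable" using S by (simp add: bounded_set_imp_lmeasurable)
  have fm: "f \<in> borel_measurable borel"
    by (intro borel_measurable_continuous_onI linear_continuous_on)
       (simp add: linear_conv_bounded_linear[symmetric] orthogonal_transformation_linear f)
  have vb: "f -` S \<in> sets borel" using measurable_sets[OF fm S(1)] by simp
  have "emeasure lebesgue (f -` S) = emeasure lebesgue S"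
    unfolding im emeasure_eq_measure2[OF measurable_orthogonal_image[OF g(1) Sl]]
      emeasure_eq_measure2[OF Sl] measure_orthogonal_image[OF g(1) Sl] ..
  then show ?thesis using vb S by simp
qed

text \<open>Radial projection commutes with norm-preserving linear maps, so \<open>R\<close> can be
  pulled through \<open>sgn\<close> and acts on the ball as an orthogonal map.\<close>

lemma sphere_measure_invariant:
  assumes R: "orthogonal_transformation R"
  shows "distr sphere_measure borel R = sphere_measure"
proof -
  let ?R = "\<lambda>y. iota_inv (R (iota y))" and ?g = "\<lambda>y. sgn (iota y)"
  have lR: "linear R" by (rule orthogonal_transformation_linear[OF R])
  have Rm: "R \<in> borel_measurable borel"
    by (intro borel_measurable_continuous_onI linear_continuous_on)
       (simp add: linear_conv_bounded_linear[symmetric] lR)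
  have nR: "norm (R x) = norm x" for x using R by (simp add: orthogonal_transformation)
  have R': "orthogonal_transformation ?R"
    unfolding orthogonal_transformation
    using linear_compose[OF linear_compose[OF linear_iota lR] linear_iota_inv] nR
    by (simp add: o_def)
  have g: "?g (?R y) = R (?g y)" for y
    by (simp add: sgn_div_norm nR linear_scale[OF lR])
  show ?thesis
  proof (rule measure_eqI)
    fix A assume "A \<in> sets (distr sphere_measure borel R)"
    then have A: "A \<in> sets borel" by simp
    have RA: "R -` A \<in> sets borel" using measurable_sets[OF Rm A] by simp
    have B: "?g -` A \<inter> ball 0 1 \<in> sets borel"
      using measurable_sets[OF measurable_sgn_iota A] by auto
    have "emeasure (distr sphere_measure borel R) A = emeasure sphere_measure (R -` A)"
      using Rm A by (subst emeasure_distr) (auto simp: measurable_def)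
    also have "\<dots> = emeasure lborel (?g -` (R -` A) \<inter> ball 0 1)"
      by (rule emeasure_sphere_measure[OF RA])
    also have "?g -` (R -` A) \<inter> ball 0 1 = ?R -` (?g -` A \<inter> ball 0 1)"
      by (auto simp: g[symmetric] nR)
    also have "emeasure lborel \<dots> = emeasure lborel (?g -` A \<inter> ball 0 1)"
      by (rule emeasure_lborel_orthogonal_vimage[OF R' B]) (simp add: bounded_Int)
    also have "\<dots> = emeasure sphere_measure A" by (rule emeasure_sphere_measure[OF A, symmetric])
    finally show "emeasure (distr sphere_measure borel R) A = emeasure sphere_measure A" .
  qed simp
qed


section \<open>Integration of continuous functions over \<open>S3\<close>\<close>

lemma compact_S3: "compact S3"
proof -
  have "S3 = sphere 0 1" by (auto simp: S3_def)
  then show ?thesis by (metis compact_sphere)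
qed

lemma S3_borel [measurable]: "S3 \<in> sets borel"
  using compact_S3 by (simp add: borel_compact)

text \<open>The cut-off by \<open>restrS3\<close> makes the integral depend on the values on
  \<open>S3\<close> alone, so continuity on \<open>S3\<close> suffices for integrability.\<close>

definition sint :: "(complex^2 \<Rightarrow> complex) \<Rightarrow> complex" where
  "sint f = integral\<^sup>L sphere_measure (restrS3 f)"

lemma S3_bounded_image:
  assumes "continuous_on S3 f"
  obtains B where "B > 0" "\<And>x. x \<in> S3 \<Longrightarrow> norm (f x :: complex) \<le> B"
  using compact_imp_bounded[OF compact_continuous_image[OF assms compact_S3]]
  by (auto simp: bounded_pos)

lemma measurable_restrS3:
  assumes "continuous_on S3 f"
  shows "restrS3 f \<in> borel_measurable sphere_measure"
proof -
  have "(\<lambda>x. indicator S3 x *\<^sub>R f x) \<in> borel_measurable borel"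
    by (rule borel_measurable_continuous_on_indicator[OF S3_borel assms])
  moreover have "(\<lambda>x. indicator S3 x *\<^sub>R f x) = restrS3 f"
    by (auto simp: restrS3_def indicator_def)
  ultimately show ?thesis by (simp add: measurable_cong_sets[OF sets_sphere_measure refl])
qed

lemma integrable_restrS3:
  assumes "continuous_on S3 f"
  shows "integrable sphere_measure (restrS3 f)"
proof -
  obtain B where "B > 0" "\<And>x. x \<in> S3 \<Longrightarrow> norm (f x) \<le> B"
    using S3_bounded_image[OF assms] by blast
  then show ?thesis
    by (intro finite_measure.integrable_const_bound[OF finite_measure_sphere, of _ B]
          measurable_restrS3 assms AE_I2) (auto simp: restrS3_def)
qed

lemma sint_cong: "(\<And>x. x \<in> S3 \<Longrightarrow> f x = g x) \<Longrightarrow> sint f = sint g"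
  unfolding sint_def by (rule arg_cong[where f = "integral\<^sup>L sphere_measure"]) (auto simp: restrS3_def)

lemma sint_add:
  assumes "continuous_on S3 f" "continuous_on S3 g"
  shows "sint (\<lambda>x. f x + g x) = sint f + sint g"
proof -
  have "restrS3 (\<lambda>x. f x + g x) = (\<lambda>x. restrS3 f x + restrS3 g x)" by (auto simp: restrS3_def)
  then show ?thesis unfolding sint_def
    using Bochner_Integration.integral_add[OF integrable_restrS3[OF assms(1)] integrable_restrS3[OF assms(2)]]
    by simp
qed

lemma sint_cmult: "sint (\<lambda>x. c * f x) = c * sint f"
proof -
  have "restrS3 (\<lambda>x. c * f x) = (\<lambda>x. c * restrS3 f x)" by (auto simp: restrS3_def)
  then show ?thesis unfolding sint_def by simp
qed

lemma sint_diff: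
  assumes "continuous_on S3 f" "continuous_on S3 g"
  shows "sint (\<lambda>x. f x - g x) = sint f - sint g"
  using sint_add[OF assms(1), of "\<lambda>x. (-1) * g x"] sint_cmult[of "-1" g] assms
  by (simp add: continuous_on_minus)

lemma sint_rotation:
  assumes R: "orthogonal_transformation R" and f: "continuous_on S3 f"
  shows "sint (\<lambda>x. f (R x)) = sint f"
proof -
  have lR: "linear R" by (rule orthogonal_transformation_linear[OF R])
  have Rm: "R \<in> measurable sphere_measure borel"
    unfolding measurable_cong_sets[OF sets_sphere_measure refl]
    by (intro borel_measurable_continuous_onI linear_continuous_on)
       (simp add: linear_conv_bounded_linear[symmetric] lR)
  have nR: "norm (R x) = norm x" for x using R by (simp add: orthogonal_transformation)
  have fm: "restrS3 f \<in> borel_measurable borel"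
    using measurable_restrS3[OF f] by (simp add: measurable_cong_sets[OF sets_sphere_measure refl])
  have "sint f = integral\<^sup>L (distr sphere_measure borel R) (restrS3 f)"
    by (simp add: sint_def sphere_measure_invariant[OF R])
  also have "\<dots> = integral\<^sup>L sphere_measure (\<lambda>x. restrS3 f (R x))"
    by (rule integral_distr[OF Rm fm])
  also have "(\<lambda>x. restrS3 f (R x)) = restrS3 (\<lambda>x. f (R x))"
    by (auto simp: restrS3_def S3_def nR)
  finally show ?thesis by (simp add: sint_def)
qed

lemma norm_sint_le:
  assumes "continuous_on S3 f" "\<And>x. x \<in> S3 \<Longrightarrow> norm (f x) \<le> B" "B \<ge> 0"
  shows "norm (sint f) \<le> B * measure sphere_measure UNIV"
proof -
  interpret finite_measure sphere_measure by (rule finite_measure_sphere)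
  have "norm (sint f) \<le> (\<integral>x. norm (restrS3 f x) \<partial>sphere_measure)"
    unfolding sint_def by (rule integral_norm_bound)
  also have "\<dots> \<le> (\<integral>x. B \<partial>sphere_measure)"
    using assms by (intro integral_mono integrable_norm integrable_restrS3) (auto simp: restrS3_def)
  finally show ?thesis by (simp add: mult.commute)
qed

lemma sint_dominated_convergence:
  assumes f: "continuous_on S3 f" and s: "\<And>n. continuous_on S3 (s n)"
    and lim: "\<And>x. x \<in> S3 \<Longrightarrow> (\<lambda>n. s n x) \<longlonglongrightarrow> f x"
    and B: "\<And>n x. x \<in> S3 \<Longrightarrow> norm (s n x) \<le> B"
  shows "(\<lambda>n. sint (s n)) \<longlonglongrightarrow> sint f"
  unfolding sint_def
proof (rule integral_dominated_convergence)
  interpret finite_measure sphere_measure by (rule finite_measure_sphere)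
  show "integrable sphere_measure (\<lambda>x. max B 0)" by simp
  show "AE x in sphere_measure. (\<lambda>i. restrS3 (s i) x) \<longlonglongrightarrow> restrS3 f x"
    using lim by (intro AE_I2) (auto simp: restrS3_def)
  show "AE x in sphere_measure. norm (restrS3 (s i) x) \<le> max B 0" for i
    using B by (intro AE_I2) (auto simp: restrS3_def le_max_iff_disj)
qed (simp_all add: measurable_restrS3 f s)

lemma continuous_on_sgn_nonzero: "continuous_on (- {0}) (sgn :: complex^2 \<Rightarrow> _)"
  by (auto simp: sgn_div_norm[abs_def] intro!: continuous_intros)

text \<open>Positive definiteness of the inner product. The points of the punctured ball that
  project to points with \<open>f\<close> nonzero form an open set; it is Lebesgue null, hence
  empty.\<close>

lemma sint_norm_eq_0:
  assumes f: "continuous_on S3 f" and 0: "sint (\<lambda>x. f x * cnj (f x)) = 0" and x: "x \<in> S3"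
  shows "f x = 0"
proof (rule ccontr)
  assume nz: "f x \<noteq> 0"
  have c: "continuous_on S3 (\<lambda>x. f x * cnj (f x))" by (intro continuous_intros f)
  have eq: "restrS3 (\<lambda>x. f x * cnj (f x)) = (\<lambda>x. complex_of_real ((norm (restrS3 f x))\<^sup>2))"
    by (rule ext) (simp add: restrS3_def complex_norm_square del: of_real_power)
  have int: "integrable sphere_measure (\<lambda>x. (norm (restrS3 f x))\<^sup>2)"
    using integrable_Re[OF integrable_restrS3[OF c]] unfolding eq by simp
  have "complex_of_real (\<integral>x. (norm (restrS3 f x))\<^sup>2 \<partial>sphere_measure) = 0"
    using 0 unfolding sint_def eq by (simp only: integral_complex_of_real)
  then have "(\<integral>x. (norm (restrS3 f x))\<^sup>2 \<partial>sphere_measure) = 0" by simp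
  then have "AE x in sphere_measure. (norm (restrS3 f x))\<^sup>2 = 0"
    using integral_nonneg_eq_0_iff_AE[OF int] by simp
  then have "AE x in sphere_measure. restrS3 f x = 0" by simp
  then obtain N where N: "{x. restrS3 f x \<noteq> 0} \<subseteq> N" "N \<in> sets borel" "emeasure sphere_measure N = 0"
    by (auto elim!: AE_E)
  define g where "g = (\<lambda>y. sgn (iota y))"
  define U where "U = {y \<in> ball 0 1 - {0}. f (g y) \<noteq> 0}"
  have iz: "iota y = 0 \<longleftrightarrow> y = 0" for y by (metis norm_eq_zero norm_iota)
  have gS: "g y \<in> S3" if "y \<noteq> 0" for y using that by (simp add: g_def S3_def norm_sgn iz)
  have cg: "continuous_on (- {0}) g" unfolding g_def
    by (rule continuous_on_compose2[OF continuous_on_sgn_nonzero continuous_iota]) (auto simp: iz)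
  have cf: "continuous_on (ball 0 1 - {0}) (\<lambda>y. f (g y))"
    by (rule continuous_on_compose2[OF f continuous_on_subset[OF cg]]) (use gS in auto)
  have "open ((ball 0 1 - {0}) \<inter> (\<lambda>y. f (g y)) -` (- {0}))"
    by (rule continuous_open_preimage[OF cf]) auto
  moreover have "(ball 0 1 - {0}) \<inter> (\<lambda>y. f (g y)) -` (- {0}) = U" by (auto simp: U_def)
  ultimately have "open U" by simp
  have "emeasure lborel (g -` N \<inter> ball 0 1) = 0"
    using N(3) emeasure_sphere_measure[OF N(2)] by (simp add: g_def)
  moreover have "U \<subseteq> g -` N \<inter> ball 0 1"
    using N(1) gS by (auto simp: U_def restrS3_def subset_iff)
  moreover have "g -` N \<inter> ball 0 1 \<in> sets lborel"
    using measurable_sets[OF measurable_sgn_iota N(2)] by (auto simp: g_def)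
  ultimately have "g -` N \<inter> ball 0 1 \<in> null_sets lborel" by (simp add: null_sets_def)
  then have "negligible (g -` N \<inter> ball 0 1)"
    using negligible_iff_null_sets null_sets_completionI by blast
  then have "negligible U" using \<open>U \<subseteq> _\<close> negligible_subset by blast
  then have "U = {}" using open_not_negligible[OF \<open>open U\<close>] by blast
  \<comment> \<open>A point of the open ball on the ray through \<open>x\<close>; any radius
    strictly between 0 and 1 would do.\<close>
  define y where "y = (1/2) *\<^sub>R iota_inv x"
  have ny: "norm y = 1/2" using x by (simp add: y_def S3_def)
  have "iota y = (1/2) *\<^sub>R x" by (simp add: y_def linear_scale[OF linear_iota])
  moreover have "sgn x = x" using x by (simp add: sgn_div_norm S3_def)
  ultimately have "g y = x" by (simp add: g_def sgn_scaleR)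
  then have "y \<in> U" using ny nz by (auto simp: U_def)
  with \<open>U = {}\<close> show False by simp
qed

section \<open>Rotation flows and Green's identity\<close>

lemma has_vector_derivative_shift_0:
  fixes f :: "real \<Rightarrow> 'a::real_normed_vector"
  assumes "((\<lambda>s. f (s + t)) has_vector_derivative d) (at 0)"
  shows "(f has_vector_derivative d) (at t)"
proof -
  have 1: "((\<lambda>u. u - t) has_vector_derivative 1) (at t)"
    by (auto intro!: derivative_eq_intros)
  have "((\<lambda>s. f (s + t)) has_vector_derivative d) (at (t - t))" using assms by simp
  from vector_diff_chain_at[OF 1 this] show ?thesis by (simp add: o_def)
qed

lemma has_vector_derivative_tendsto:
  fixes f :: "real \<Rightarrow> 'a::real_normed_vector"
  assumes "(f has_vector_derivative d) (at 0)"
  shows "((\<lambda>t. (f t - f 0) /\<^sub>R t) \<longlongrightarrow> d) (at 0)"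
proof -
  have "((\<lambda>t. norm (f t - f 0 - t *\<^sub>R d) / norm t) \<longlongrightarrow> 0) (at 0)"
    using assms by (simp add: has_vector_derivative_def has_derivative_at)
  moreover have "\<forall>\<^sub>F t in at 0. norm (f t - f 0 - t *\<^sub>R d) / norm t = dist ((f t - f 0) /\<^sub>R t) d"
  proof (rule eventually_at_filter[THEN iffD2], intro always_eventually allI impI)
    fix t :: real assume t: "t \<noteq> 0"
    have "(f t - f 0) /\<^sub>R t - d = (f t - f 0 - t *\<^sub>R d) /\<^sub>R t"
      using t by (simp add: scaleR_diff_right)
    then show "norm (f t - f 0 - t *\<^sub>R d) / norm t = dist ((f t - f 0) /\<^sub>R t) d"
      by (simp add: dist_norm divide_inverse mult.commute)
  qed
  ultimately have "((\<lambda>t. dist ((f t - f 0) /\<^sub>R t) d) \<longlongrightarrow> 0) (at 0)"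
    by (rule Lim_transform_eventually)
  then show ?thesis by (rule tendsto_dist_iff[THEN iffD2])
qed

text \<open>The mean value inequality is applied to one coordinate at a time, by induction on the
  set \<open>B\<close> of coordinates already moved. This bridges the gap between
  \<open>C2_on\<close>, which speaks of partial derivatives only, and the chain rule along
  curves.\<close>

lemma has_derivative_of_partials:
  fixes f :: "'a::euclidean_space \<Rightarrow> 'b::real_normed_vector"
  assumes U: "open U" "x \<in> U"
    and der: "\<And>b y. b \<in> Basis \<Longrightarrow> y \<in> U \<Longrightarrow>
      ((\<lambda>t. f (y + t *\<^sub>R b)) has_vector_derivative g b y) (at 0)"
    and cont: "\<And>b. b \<in> Basis \<Longrightarrow> continuous_on U (g b)"
  shows "(f has_derivative (\<lambda>h. \<Sum>b\<in>Basis. (h \<bullet> b) *\<^sub>R g b x)) (at x)"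
proof -
  obtain r where r: "r > 0" "ball x r \<subseteq> U" using U by (meson open_contains_ball)
  \<comment> \<open>One \<open>norm h\<close> for each coordinate moved before, and one more for the
    current segment.\<close>
  define D where "D = real DIM('a) + 1"
  have D: "D > 0" by (simp add: D_def add_nonneg_pos)
  have claim: "\<exists>d>0. \<forall>h. norm h < d \<longrightarrow> norm (f (x + (\<Sum>b\<in>B. (h \<bullet> b) *\<^sub>R b)) - f x
      - (\<Sum>b\<in>B. (h \<bullet> b) *\<^sub>R g b x)) \<le> e * norm h"
    if "finite B" "B \<subseteq> Basis" "e > 0" for B e
    using that
  proof (induction B arbitrary: e rule: finite_induct)
    case empty
    then show ?case by (auto intro!: exI[of _ 1])
  next
    case (insert b B)
    then have b: "b \<in> Basis" "B \<subseteq> Basis" and e: "e / 2 > 0" by auto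
    obtain d1 where d1: "d1 > 0" "\<And>h. norm h < d1 \<Longrightarrow> norm (f (x + (\<Sum>b\<in>B. (h \<bullet> b) *\<^sub>R b)) - f x
      - (\<Sum>b\<in>B. (h \<bullet> b) *\<^sub>R g b x)) \<le> e / 2 * norm h"
      using insert.IH[OF b(2) e] by blast
    have "continuous (at x) (g b)"
      using cont[OF b(1)] U by (simp add: continuous_on_eq_continuous_at)
    then obtain d2 where d2: "d2 > 0" "\<And>y. dist y x < d2 \<Longrightarrow> dist (g b y) (g b x) < e / 2"
      using e unfolding continuous_at_eps_delta by blast
    define d where "d = min d1 (min r d2 / D)"
    have "d > 0" using d1 d2 r D by (simp add: d_def)
    moreover have "norm (f (x + (\<Sum>b\<in>insert b B. (h \<bullet> b) *\<^sub>R b)) - f x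
      - (\<Sum>b\<in>insert b B. (h \<bullet> b) *\<^sub>R g b x)) \<le> e * norm h" if h: "norm h < d" for h
    proof -
      define y where "y = x + (\<Sum>b\<in>B. (h \<bullet> b) *\<^sub>R b)"
      have near: "dist (y + s *\<^sub>R b) x < min r d2" if s: "s \<in> closed_segment 0 (h \<bullet> b)" for s
      proof -
        have "\<bar>s\<bar> \<le> \<bar>h \<bullet> b\<bar>" using s by (auto simp: closed_segment_eq_real_ivl split: if_splits)
        also have "\<dots> \<le> norm h" using b by (simp add: Basis_le_norm)
        finally have s': "\<bar>s\<bar> \<le> norm h" .
        have "norm (\<Sum>b\<in>B. (h \<bullet> b) *\<^sub>R b) \<le> (\<Sum>b\<in>B. norm h)"
          using b(2) by (intro sum_norm_le) (auto simp: Basis_le_norm subset_iff)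
        also have "\<dots> \<le> real DIM('a) * norm h"
          using card_mono[OF finite_Basis b(2)] by (simp add: mult_right_mono)
        finally have n: "norm (\<Sum>b\<in>B. (h \<bullet> b) *\<^sub>R b) \<le> real DIM('a) * norm h" .
        have "dist (y + s *\<^sub>R b) x = norm ((\<Sum>b\<in>B. (h \<bullet> b) *\<^sub>R b) + s *\<^sub>R b)"
          by (simp add: y_def dist_norm)
        also have "\<dots> \<le> real DIM('a) * norm h + norm h"
          using n s' b by (intro order_trans[OF norm_triangle_ineq] add_mono) auto
        also have "\<dots> = norm h * D" by (simp add: D_def algebra_simps)
        also have "\<dots> < min r d2"
          using h D by (simp add: d_def pos_less_divide_eq)
        finally show ?thesis .
      qed
      \<comment> \<open>Subtracting the linear term leaves the derivative
        \<open>g b (y + t *\<^sub>R b) - g b x\<close>, which is small by continuity of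
        \<open>g b\<close>.\<close>
      define \<phi> where "\<phi> t = f (y + t *\<^sub>R b) - t *\<^sub>R g b x" for t
      have "norm (\<phi> (h \<bullet> b) - \<phi> 0) \<le> e / 2 * norm (h \<bullet> b - 0)"
      proof (rule differentiable_bound[where S = "closed_segment 0 (h \<bullet> b)" and
            f' = "\<lambda>t s. s *\<^sub>R (g b (y + t *\<^sub>R b) - g b x)"])
        fix t assume t: "t \<in> closed_segment 0 (h \<bullet> b)"
        have "y + t *\<^sub>R b \<in> U" using near[OF t] r by (auto simp: dist_commute subset_iff)
        then have "((\<lambda>s. f (y + t *\<^sub>R b + s *\<^sub>R b)) has_vector_derivative g b (y + t *\<^sub>R b)) (at 0)"
          by (rule der[OF b(1)])
        then have "((\<lambda>s. f (y + (s + t) *\<^sub>R b)) has_vector_derivative g b (y + t *\<^sub>R b)) (at 0)"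
          by (simp add: algebra_simps)
        then have "((\<lambda>u. f (y + u *\<^sub>R b)) has_vector_derivative g b (y + t *\<^sub>R b)) (at t)"
          by (rule has_vector_derivative_shift_0)
        then have "((\<lambda>u. f (y + u *\<^sub>R b)) has_derivative (\<lambda>s. s *\<^sub>R g b (y + t *\<^sub>R b)))
            (at t within closed_segment 0 (h \<bullet> b))"
          by (simp add: has_vector_derivative_def has_derivative_at_withinI)
        moreover have "((\<lambda>u. u *\<^sub>R g b x) has_derivative (\<lambda>s. s *\<^sub>R g b x))
            (at t within closed_segment 0 (h \<bullet> b))"
          by (intro bounded_linear_imp_has_derivative bounded_linear_scaleR_left)
        ultimately show "(\<phi> has_derivative (\<lambda>s. s *\<^sub>R (g b (y + t *\<^sub>R b) - g b x)))
            (at t within closed_segment 0 (h \<bullet> b))"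
          unfolding \<phi>_def scaleR_diff_right by (rule has_derivative_diff)
        show "onorm (\<lambda>s. s *\<^sub>R (g b (y + t *\<^sub>R b) - g b x)) \<le> e / 2"
        proof (rule onorm_le)
          fix s :: real
          have "norm (g b (y + t *\<^sub>R b) - g b x) \<le> e / 2"
            using d2(2)[of "y + t *\<^sub>R b"] near[OF t] by (simp add: dist_norm)
          from mult_right_mono[OF this, of "norm s"]
          show "norm (s *\<^sub>R (g b (y + t *\<^sub>R b) - g b x)) \<le> e / 2 * norm s"
            by (simp add: mult.commute)
        qed
      qed auto
      also have "\<dots> \<le> e / 2 * norm h" using b e by (simp add: Basis_le_norm)
      finally have 1: "norm (\<phi> (h \<bullet> b) - \<phi> 0) \<le> e / 2 * norm h" .
      have 2: "norm (f y - f x - (\<Sum>b\<in>B. (h \<bullet> b) *\<^sub>R g b x)) \<le> e / 2 * norm h"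
        unfolding y_def using h by (intro d1) (simp add: d_def)
      have "f (x + (\<Sum>b\<in>insert b B. (h \<bullet> b) *\<^sub>R b)) - f x - (\<Sum>b\<in>insert b B. (h \<bullet> b) *\<^sub>R g b x)
        = (\<phi> (h \<bullet> b) - \<phi> 0) + (f y - f x - (\<Sum>b\<in>B. (h \<bullet> b) *\<^sub>R g b x))"
        using insert.hyps by (simp add: \<phi>_def y_def algebra_simps)
      also have "norm \<dots> \<le> e / 2 * norm h + e / 2 * norm h"
        by (rule order_trans[OF norm_triangle_ineq add_mono[OF 1 2]])
      finally show ?thesis by simp
    qed
    ultimately show ?case by blast
  qed
  show ?thesis
    unfolding has_derivative_at_alt
  proof (intro conjI allI impI)
    show "bounded_linear (\<lambda>h. \<Sum>b\<in>Basis. (h \<bullet> b) *\<^sub>R g b x)"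
      by (intro bounded_linear_sum bounded_linear_scaleR_const bounded_linear_inner_left)
    fix e :: real assume "e > 0"
    then obtain d where d: "d > 0" "\<And>h. norm h < d \<Longrightarrow> norm (f (x + (\<Sum>b\<in>Basis. (h \<bullet> b) *\<^sub>R b)) - f x
      - (\<Sum>b\<in>Basis. (h \<bullet> b) *\<^sub>R g b x)) \<le> e * norm h"
      using claim[OF finite_Basis subset_refl, of e] by blast
    have "norm (f y - f x - (\<Sum>b\<in>Basis. ((y - x) \<bullet> b) *\<^sub>R g b x)) \<le> e * norm (y - x)"
      if "norm (y - x) < d" for y
      using d(2)[OF that] by (simp add: euclidean_representation)
    with d(1) show "\<exists>d>0. \<forall>y. norm (y - x) < d \<longrightarrow>
        norm (f y - f x - (\<Sum>b\<in>Basis. ((y - x) \<bullet> b) *\<^sub>R g b x)) \<le> e * norm (y - x)"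
      by blast
  qed
qed

definition unit_structure :: "(complex^2 \<Rightarrow> complex^2) \<Rightarrow> bool" where
  "unit_structure J \<longleftrightarrow> linear J \<and> (\<forall>x. J (J x) = - x) \<and> (\<forall>x. norm (J x) = norm x)"

text \<open>The exponential of \<open>t\<close> times \<open>J\<close>: its series collapses to
  cosine and sine because \<open>J\<close> squares to -1. As \<open>J\<close> is an isometry too,
  \<open>x\<close> and \<open>J x\<close> are orthogonal and the flow consists of rotations.\<close>

definition flow :: "(complex^2 \<Rightarrow> complex^2) \<Rightarrow> real \<Rightarrow> complex^2 \<Rightarrow> complex^2" where
  "flow J t x = cos t *\<^sub>R x + sin t *\<^sub>R J x"

text \<open>A relation, so that a derivative obtained from \<open>pd\<close> can be compared by
  uniqueness with one obtained from an explicit formula. Time 0 is enough, since the group law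
  carries it to all times.\<close>

definition flow_deriv ::
  "(complex^2 \<Rightarrow> complex^2) \<Rightarrow> (complex^2 \<Rightarrow> complex) \<Rightarrow> (complex^2 \<Rightarrow> complex) \<Rightarrow> bool" where
  "flow_deriv J F F' \<longleftrightarrow> (\<forall>x\<in>S3. ((\<lambda>t. F (flow J t x)) has_vector_derivative F' x) (at 0))"

lemma orthogonal_flow:
  assumes J: "unit_structure J"
  shows "orthogonal_transformation (flow J t)"
proof -
  have lJ: "linear J" and JJ: "J (J x) = - x" and nJ: "norm (J x) = norm x" for x
    using J by (auto simp: unit_structure_def)
  have oJ: "orthogonal_transformation J" by (simp add: orthogonal_transformation lJ nJ)
  have 0: "x \<bullet> J x = 0" for x
  proof -
    have "x \<bullet> J x = J x \<bullet> J (J x)" using oJ by (simp add: orthogonal_transformation_def)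
    then show ?thesis by (simp add: JJ inner_commute)
  qed
  have "norm (flow J t x) ^ 2 = norm x ^ 2" for x
  proof -
    have "norm (flow J t x) ^ 2 = (cos t)\<^sup>2 * (norm x)\<^sup>2 + (sin t)\<^sup>2 * (norm (J x))\<^sup>2"
      unfolding flow_def power2_norm_eq_inner
      using 0[of x] by (simp add: inner_add inner_commute[of "J x" x] power2_eq_square)
    also have "\<dots> = ((cos t)\<^sup>2 + (sin t)\<^sup>2) * (norm x)\<^sup>2" by (simp only: nJ distrib_right)
    finally show ?thesis by simp
  qed
  then have "norm (flow J t x) = norm x" for x by (simp add: power2_eq_iff_nonneg)
  moreover have "linear (flow J t)"
    unfolding flow_def
    by (intro linear_compose_add linear_compose_scale_right lJ) (simp_all add: linear_ident linear_id)
  ultimately show ?thesis by (simp add: orthogonal_transformation)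
qed

lemma flow_S3: "unit_structure J \<Longrightarrow> flow J t x \<in> S3 \<longleftrightarrow> x \<in> S3"
  using orthogonal_flow[of J t] by (simp add: S3_def orthogonal_transformation)

lemma flow_0 [simp]: "flow J 0 x = x"
  by (simp add: flow_def)

lemma flow_add:
  assumes J: "unit_structure J"
  shows "flow J (s + t) x = flow J s (flow J t x)"
proof -
  have lJ: "linear J" and JJ: "J (J x) = - x" for x
    using J by (auto simp: unit_structure_def)
  show ?thesis
    by (simp add: flow_def linear_add[OF lJ] linear_scale[OF lJ] JJ cos_add sin_add algebra_simps)
qed

lemma continuous_flow:
  assumes "unit_structure J"
  shows "continuous_on S (flow J t)"
  using orthogonal_transformation_linear[OF orthogonal_flow[OF assms]]
  by (simp add: linear_continuous_on linear_conv_bounded_linear)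

lemma flow_derivD:
  assumes J: "unit_structure J" and F: "flow_deriv J F F'" and x: "x \<in> S3"
  shows "((\<lambda>t. F (flow J t x)) has_vector_derivative F' (flow J t x)) (at t)"
proof (rule has_vector_derivative_shift_0)
  have "((\<lambda>s. F (flow J s (flow J t x))) has_vector_derivative F' (flow J t x)) (at 0)"
    using F x by (simp add: flow_deriv_def flow_S3 J)
  then show "((\<lambda>s. F (flow J (s + t) x)) has_vector_derivative F' (flow J t x)) (at 0)"
    by (simp add: flow_add J)
qed

lemma flow_deriv_mult:
  assumes "flow_deriv J F F'" "flow_deriv J G G'"
  shows "flow_deriv J (\<lambda>x. F x * G x) (\<lambda>x. F x * G' x + F' x * G x)"
  unfolding flow_deriv_def
proof
  fix x assume "x \<in> S3"
  then have "((\<lambda>t. F (flow J t x)) has_vector_derivative F' x) (at 0)"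
    "((\<lambda>t. G (flow J t x)) has_vector_derivative G' x) (at 0)"
    using assms by (auto simp: flow_deriv_def)
  from has_vector_derivative_mult[OF this]
  show "((\<lambda>t. F (flow J t x) * G (flow J t x)) has_vector_derivative F x * G' x + F' x * G x) (at 0)"
    by simp
qed

text \<open>Differentiation under the integral sign: each difference quotient integrates to 0 by
  rotation invariance, and the mean value inequality dominates it by a bound for
  \<open>F'\<close>.\<close>

lemma sint_flow_deriv:
  assumes J: "unit_structure J" and F: "flow_deriv J F F'"
    and c: "continuous_on S3 F" "continuous_on S3 F'"
  shows "sint F' = 0"
proof -
  obtain B where B: "B > 0" "\<And>x. x \<in> S3 \<Longrightarrow> norm (F' x) \<le> B" using S3_bounded_image[OF c(2)] by blast
  define h where "h n = inverse (real (Suc n))" for n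
  define s where "s n x = complex_of_real (inverse (h n)) * (F (flow J (h n) x) - F x)" for n x
  have cfl: "continuous_on S3 (\<lambda>x. F (flow J t x))" for t
    by (rule continuous_on_compose2[OF c(1) continuous_flow[OF J]]) (auto simp: flow_S3 J)
  have "(\<lambda>n. sint (s n)) \<longlonglongrightarrow> sint F'"
  proof (rule sint_dominated_convergence)
    show "continuous_on S3 (s n)" for n
      unfolding s_def by (intro continuous_intros cfl c)
    fix x assume x: "x \<in> S3"
    have h0: "(h \<longlongrightarrow> 0) sequentially" unfolding h_def by (rule LIMSEQ_inverse_real_of_nat)
    have "((\<lambda>t. F (flow J t x)) has_vector_derivative F' x) (at 0)"
      using F x by (simp add: flow_deriv_def)
    then have lim: "((\<lambda>t. (F (flow J t x) - F x) /\<^sub>R t) \<longlongrightarrow> F' x) (at 0)"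
      using has_vector_derivative_tendsto by force
    have "(\<lambda>n. (F (flow J (h n) x) - F x) /\<^sub>R h n) \<longlonglongrightarrow> F' x"
      by (rule filterlim_compose[OF lim])
         (auto simp: filterlim_at h0, simp add: h_def)
    then show "(\<lambda>n. s n x) \<longlonglongrightarrow> F' x" by (simp add: s_def scaleR_conv_of_real)
  next
    fix n x assume x: "x \<in> S3"
    have "norm (F (flow J (h n) x) - F (flow J 0 x)) \<le> B * norm (h n - 0)"
    proof (rule differentiable_bound[where S = UNIV and f' = "\<lambda>t s. s *\<^sub>R F' (flow J t x)"])
      show "((\<lambda>t. F (flow J t x)) has_derivative (\<lambda>s. s *\<^sub>R F' (flow J t x))) (at t)" for t
        using flow_derivD[OF J F x] by (simp add: has_vector_derivative_def)
      show "onorm (\<lambda>s. s *\<^sub>R F' (flow J t x)) \<le> B" for t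
      proof (rule onorm_le)
        fix s :: real
        have "norm (F' (flow J t x)) \<le> B" using B(2)[of "flow J t x"] x by (simp add: flow_S3 J)
        from mult_right_mono[OF this, of "norm s"]
        show "norm (s *\<^sub>R F' (flow J t x)) \<le> B * norm s" by (simp add: mult.commute)
      qed
    qed auto
    moreover have "h n > 0" by (simp add: h_def)
    ultimately show "norm (s n x) \<le> B"
      by (simp add: s_def norm_mult norm_inverse norm_divide field_simps)
  qed (rule c)
  moreover have "sint (s n) = 0" for n
    unfolding s_def using sint_rotation[OF orthogonal_flow[OF J] c(1)]
    by (simp add: sint_cmult sint_diff[OF cfl c(1)])
  ultimately show ?thesis by (simp add: LIMSEQ_const_iff)
qed

text \<open>Both sides equal minus the integral of \<open>F' * G'\<close>, since the flow
  derivatives of \<open>F' * G\<close> and of \<open>F * G'\<close> integrate to 0.\<close>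

lemma sint_green:
  assumes J: "unit_structure J"
    and F: "flow_deriv J F F'" "flow_deriv J F' F''"
    and cF: "continuous_on S3 F" "continuous_on S3 F'" "continuous_on S3 F''"
    and G: "flow_deriv J G G'" "flow_deriv J G' G''"
    and cG: "continuous_on S3 G" "continuous_on S3 G'" "continuous_on S3 G''"
  shows "sint (\<lambda>x. F'' x * G x) = sint (\<lambda>x. F x * G'' x)"
proof -
  have 1: "sint (\<lambda>x. F' x * G' x + F'' x * G x) = 0"
    by (rule sint_flow_deriv[OF J flow_deriv_mult[OF F(2) G(1)]]) (intro continuous_intros cF cG)+
  have 2: "sint (\<lambda>x. F x * G'' x + F' x * G' x) = 0"
    by (rule sint_flow_deriv[OF J flow_deriv_mult[OF F(1) G(2)]]) (intro continuous_intros cF cG)+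
  have "sint (\<lambda>x. F' x * G' x + F'' x * G x) = sint (\<lambda>x. F' x * G' x) + sint (\<lambda>x. F'' x * G x)"
    by (intro sint_add continuous_intros cF cG)
  moreover have "sint (\<lambda>x. F x * G'' x + F' x * G' x) = sint (\<lambda>x. F x * G'' x) + sint (\<lambda>x. F' x * G' x)"
    by (intro sint_add continuous_intros cF cG)
  ultimately show ?thesis using 1 2 by (simp add: add_eq_0_iff)
qed

section \<open>The Laplacian of the sphere as a sum of squares\<close>

text \<open>\<open>J3\<close> is \<open>J1\<close> after \<open>J2\<close>. For \<open>x\<close> in
  \<open>S3\<close> the vectors \<open>x\<close>, \<open>J1 x\<close>, \<open>J2 x\<close>,
  \<open>J3 x\<close> form an orthonormal basis of R^4, which is what turns the Laplacian into a sum
  of squares.\<close>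

definition J1 :: "complex^2 \<Rightarrow> complex^2" where
  "J1 x = pt (\<i> * x$1) (\<i> * x$2)"
definition J2 :: "complex^2 \<Rightarrow> complex^2" where
  "J2 x = pt (- cnj (x$2)) (cnj (x$1))"
definition J3 :: "complex^2 \<Rightarrow> complex^2" where
  "J3 x = pt (- \<i> * cnj (x$2)) (\<i> * cnj (x$1))"

lemma unit_structureI:
  assumes "linear J" "\<And>x. J (J x) = - x" "\<And>x. (norm (J x))\<^sup>2 = (norm x)\<^sup>2"
  shows "unit_structure J"
  using assms by (simp add: unit_structure_def power2_eq_iff_nonneg)

lemma unit_structure_J: "unit_structure J1" "unit_structure J2" "unit_structure J3"
  by (intro unit_structureI linearI;
      simp add: J1_def J2_def J3_def vec2_eq_iff algebra_simps norm_vec2 norm_mult scaleR_conv_of_real[where 'a = complex])+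

lemma sum_Basis_complex2:
  "(\<Sum>b\<in>(Basis :: (complex^2) set). f b) = f ex + f ey + f ez + f ew"
  and coord_dirs_eq: "coord_dirs = Basis"
proof -
  have a: "axis 1 u = pt u 0" "axis 2 u = pt 0 u" for u :: complex
    by (simp_all add: vec2_eq_iff axis_def)
  show eq: "coord_dirs = Basis"
    unfolding coord_dirs_def Basis_vec_def ex_def ey_def ez_def ew_def
    by (auto simp: a UNIV_2 Basis_complex_def)
  have d: "ex \<noteq> ey" "ex \<noteq> ez" "ex \<noteq> ew" "ey \<noteq> ez" "ey \<noteq> ew" "ez \<noteq> ew"
    by (simp_all add: ex_def ey_def ez_def ew_def vec2_eq_iff complex_eq_iff)
  show "(\<Sum>b\<in>(Basis :: (complex^2) set). f b) = f ex + f ey + f ez + f ew"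
    unfolding eq[symmetric] coord_dirs_def using d by (simp add: add.assoc)
qed

lemma inner_coord: "x \<bullet> ex = Re (x$1)" "x \<bullet> ey = Im (x$1)" "x \<bullet> ez = Re (x$2)" "x \<bullet> ew = Im (x$2)"
  by (simp_all add: ex_def ey_def ez_def ew_def inner_vec_def sum_2 inner_complex_def)

lemma S3_nonzero: "x \<in> S3 \<Longrightarrow> x \<noteq> 0"
  by (auto simp: S3_def)

lemma hext_S3: "x \<in> S3 \<Longrightarrow> hext F x = F x"
  by (simp add: hext_def S3_def)

lemma hext_scaleR: "c > 0 \<Longrightarrow> hext F (c *\<^sub>R x) = hext F x"
  by (simp add: hext_def)

section \<open>Regularity of the degree-0 extension and its derivatives along curves\<close>

lemma S3_fun_partials:
  assumes "S3_fun F" "b \<in> Basis"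
  shows "x \<noteq> 0 \<Longrightarrow> ((\<lambda>t. hext F (x + t *\<^sub>R b)) has_vector_derivative pd b (hext F) x) (at 0)"
    and "x \<noteq> 0 \<Longrightarrow> u \<in> Basis \<Longrightarrow>
      ((\<lambda>t. pd b (hext F) (x + t *\<^sub>R u)) has_vector_derivative pd u (pd b (hext F)) x) (at 0)"
    and "u \<in> Basis \<Longrightarrow> continuous_on (- {0}) (pd u (pd b (hext F)))"
  using assms unfolding S3_fun_def C2_on_def coord_dirs_eq by auto

lemma S3_fun_has_derivative_pd:
  assumes F: "S3_fun F" and b: "b \<in> Basis" and x: "x \<noteq> 0"
  shows "(pd b (hext F) has_derivative (\<lambda>h. \<Sum>u\<in>Basis. (h \<bullet> u) *\<^sub>R pd u (pd b (hext F)) x)) (at x)"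
  by (rule has_derivative_of_partials[where U = "- {0}"])
     (use S3_fun_partials[OF F b] x in auto)

lemma S3_fun_continuous_pd:
  assumes "S3_fun F" "b \<in> Basis"
  shows "continuous_on (- {0}) (pd b (hext F))"
proof (rule continuous_at_imp_continuous_on, intro ballI)
  fix x :: "complex^2" assume "x \<in> - {0}"
  then show "isCont (pd b (hext F)) x"
    using S3_fun_has_derivative_pd[OF assms] has_derivative_continuous by blast
qed

lemma S3_fun_has_derivative:
  assumes F: "S3_fun F" and x: "x \<noteq> 0"
  shows "(hext F has_derivative (\<lambda>h. \<Sum>b\<in>Basis. (h \<bullet> b) *\<^sub>R pd b (hext F) x)) (at x)"
  by (rule has_derivative_of_partials[where U = "- {0}"])
     (use S3_fun_partials[OF F] S3_fun_continuous_pd[OF F] x in auto)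

lemma S3_fun_continuous:
  assumes "S3_fun F"
  shows "continuous_on S3 F"
proof -
  have "continuous_on S3 (hext F)"
  proof (rule continuous_at_imp_continuous_on, intro ballI)
    fix x assume "x \<in> S3"
    then show "isCont (hext F) x"
      using S3_fun_has_derivative[OF assms S3_nonzero] has_derivative_continuous by blast
  qed
  then show ?thesis by (rule continuous_on_eq) (simp add: hext_S3)
qed

lemma hext_curve:
  assumes F: "S3_fun F" and c: "(c has_vector_derivative c') (at t)" and 0: "c t \<noteq> 0"
  shows "((\<lambda>s. hext F (c s)) has_vector_derivative
    (\<Sum>b\<in>Basis. (c' \<bullet> b) *\<^sub>R pd b (hext F) (c t))) (at t)"
  using vector_derivative_diff_chain_within[OF c has_derivative_at_withinI[OF S3_fun_has_derivative[OF F 0]]]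
  by (simp add: o_def)

text \<open>Product rule: the first sum comes from the moving direction \<open>A (c s)\<close>, the
  second from the Hessian. With \<open>A = J\<close> it serves the second flow derivative, with the
  identity the radial one.\<close>

lemma pd_hext_curve:
  assumes F: "S3_fun F" and c: "(c has_vector_derivative c') (at t)" and 0: "c t \<noteq> 0"
    and A: "linear A"
  shows "((\<lambda>s. \<Sum>b\<in>Basis. (A (c s) \<bullet> b) *\<^sub>R pd b (hext F) (c s)) has_vector_derivative
    (\<Sum>b\<in>Basis. (A c' \<bullet> b) *\<^sub>R pd b (hext F) (c t)) +
    (\<Sum>b\<in>Basis. (A (c t) \<bullet> b) *\<^sub>R (\<Sum>u\<in>Basis. (c' \<bullet> u) *\<^sub>R pd u (pd b (hext F)) (c t)))) (at t)"
proof -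
  have 1: "((\<lambda>s. A (c s) \<bullet> b) has_real_derivative A c' \<bullet> b) (at t)" for b
  proof -
    have "bounded_linear (\<lambda>x. A x \<bullet> b)"
      using A by (intro bounded_linear_compose[OF bounded_linear_inner_left])
        (simp add: linear_conv_bounded_linear)
    from bounded_linear.has_vector_derivative[OF this c]
    show ?thesis by (simp add: has_real_derivative_iff_has_vector_derivative)
  qed
  have 2: "((\<lambda>s. pd b (hext F) (c s)) has_vector_derivative
      (\<Sum>u\<in>Basis. (c' \<bullet> u) *\<^sub>R pd u (pd b (hext F)) (c t))) (at t)" if "b \<in> Basis" for b
    using vector_derivative_diff_chain_within[OF c has_derivative_at_withinI[OF S3_fun_has_derivative_pd[OF F that 0]]]
    by (simp add: o_def)
  have "((\<lambda>s. \<Sum>b\<in>Basis. (A (c s) \<bullet> b) *\<^sub>R pd b (hext F) (c s)) has_vector_derivative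
    (\<Sum>b\<in>Basis. (A (c t) \<bullet> b) *\<^sub>R (\<Sum>u\<in>Basis. (c' \<bullet> u) *\<^sub>R pd u (pd b (hext F)) (c t)) +
       (A c' \<bullet> b) *\<^sub>R pd b (hext F) (c t))) (at t)"
    by (intro has_vector_derivative_sum has_vector_derivative_scaleR 1 2)
  then show ?thesis by (simp add: sum.distrib add.commute)
qed

text \<open>The extension is constant on open rays, so its radial derivative vanishes at every
  nonzero point. Differentiating this identity along the ray gives the second claim, because the
  first-order term is again a radial derivative.\<close>

lemma pd_hext_radial:
  assumes F: "S3_fun F" and x: "x \<noteq> 0"
  shows "(\<Sum>b\<in>Basis. (x \<bullet> b) *\<^sub>R pd b (hext F) x) = 0"
    and "(\<Sum>b\<in>Basis. (x \<bullet> b) *\<^sub>R (\<Sum>u\<in>Basis. (x \<bullet> u) *\<^sub>R pd u (pd b (hext F)) x)) = 0"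
proof -
  have ray: "((\<lambda>t. (1 + t) *\<^sub>R x) has_vector_derivative x) (at 0)" for x :: "complex^2"
    by (auto intro!: derivative_eq_intros)
  have zero: "v = 0" if "(f has_vector_derivative v) (at 0)" "\<And>t. 1 + t > 0 \<Longrightarrow> f t = f 0"
    for f :: "real \<Rightarrow> complex" and v
  proof -
    have c: "f t = f 0" if "t \<in> {-1<..}" for t
      by (rule \<open>\<And>t. 1 + t > 0 \<Longrightarrow> f t = f 0\<close>) (use that in simp)
    have "((\<lambda>t. f 0) has_vector_derivative v) (at 0)"
      by (rule has_vector_derivative_transform_within_open[where S = "{-1<..}", OF that(1) _ _ c]) simp_all
    then show ?thesis using vector_derivative_unique_at has_vector_derivative_const by blast
  qed
  have r1: "(\<Sum>b\<in>Basis. (x \<bullet> b) *\<^sub>R pd b (hext F) x) = 0" if "x \<noteq> 0" for x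
    using hext_curve[OF F ray[of x]] that
    by (intro zero[of "\<lambda>t. hext F ((1 + t) *\<^sub>R x)"]) (auto simp: hext_scaleR)
  show "(\<Sum>b\<in>Basis. (x \<bullet> b) *\<^sub>R pd b (hext F) x) = 0" by (rule r1[OF x])
  show "(\<Sum>b\<in>Basis. (x \<bullet> b) *\<^sub>R (\<Sum>u\<in>Basis. (x \<bullet> u) *\<^sub>R pd u (pd b (hext F)) x)) = 0"
  proof (rule zero)
    let ?g = "\<lambda>t. \<Sum>b\<in>Basis. (((1 + t) *\<^sub>R x) \<bullet> b) *\<^sub>R pd b (hext F) ((1 + t) *\<^sub>R x)"
    show "(?g has_vector_derivative
      (\<Sum>b\<in>Basis. (x \<bullet> b) *\<^sub>R (\<Sum>u\<in>Basis. (x \<bullet> u) *\<^sub>R pd u (pd b (hext F)) x))) (at 0)"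
      using pd_hext_curve[OF F ray[of x] _ linear_id] x r1[OF x] by simp
    show "?g t = ?g 0" if "0 < 1 + t" for t
    proof -
      have "(1 + t) *\<^sub>R x \<noteq> 0" using x that by simp
      from r1[OF this] r1[of "(1 + 0) *\<^sub>R x"] x show ?thesis by simp
    qed
  qed
qed

definition fd :: "(complex^2 \<Rightarrow> complex^2) \<Rightarrow> (complex^2 \<Rightarrow> complex) \<Rightarrow> complex^2 \<Rightarrow> complex" where
  "fd J F x = (\<Sum>b\<in>Basis. (J x \<bullet> b) *\<^sub>R pd b (hext F) x)"

text \<open>The Hessian form at \<open>J x\<close>. This is the whole second flow derivative: the
  remaining term pairs the gradient with \<open>J (J x) = - x\<close> and is a radial derivative,
  hence 0.\<close>

definition fd2 :: "(complex^2 \<Rightarrow> complex^2) \<Rightarrow> (complex^2 \<Rightarrow> complex) \<Rightarrow> complex^2 \<Rightarrow> complex" where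
  "fd2 J F x = (\<Sum>b\<in>Basis. (J x \<bullet> b) *\<^sub>R (\<Sum>u\<in>Basis. (J x \<bullet> u) *\<^sub>R pd u (pd b (hext F)) x))"

lemma S3_fun_flow_deriv:
  assumes F: "S3_fun F" and J: "unit_structure J"
  shows "flow_deriv J F (fd J F)" "flow_deriv J (fd J F) (fd2 J F)"
    "continuous_on S3 (fd J F)" "continuous_on S3 (fd2 J F)"
proof -
  have lJ: "linear J" and JJ: "J (J x) = - x" for x
    using J by (auto simp: unit_structure_def)
  have curve: "((\<lambda>t. flow J t x) has_vector_derivative J x) (at 0)" for x
    unfolding flow_def by (auto intro!: derivative_eq_intros)
  show "flow_deriv J F (fd J F)"
    unfolding flow_deriv_def
  proof
    fix x assume x: "x \<in> S3"
    have "((\<lambda>t. hext F (flow J t x)) has_vector_derivative fd J F x) (at 0)"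
      using hext_curve[OF F curve[of x]] S3_nonzero[OF x] by (simp add: fd_def)
    then show "((\<lambda>t. F (flow J t x)) has_vector_derivative fd J F x) (at 0)"
      using x by (simp add: hext_S3 flow_S3 J)
  qed
  show "flow_deriv J (fd J F) (fd2 J F)"
    unfolding flow_deriv_def
  proof
    fix x assume x: "x \<in> S3"
    show "((\<lambda>t. fd J F (flow J t x)) has_vector_derivative fd2 J F x) (at 0)"
      using pd_hext_curve[OF F curve[of x] _ lJ] S3_nonzero[OF x]
        pd_hext_radial(1)[OF F S3_nonzero[OF x]]
      by (simp add: fd_def[abs_def] fd2_def JJ sum_negf)
  qed
  have cJ: "continuous_on S3 J" using lJ by (simp add: linear_continuous_on linear_conv_bounded_linear)
  have sub: "S3 \<subseteq> - {0}" using S3_nonzero by auto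
  show "continuous_on S3 (fd J F)" unfolding fd_def[abs_def]
    by (intro continuous_intros cJ continuous_on_subset[OF S3_fun_continuous_pd[OF F] sub])
  show "continuous_on S3 (fd2 J F)" unfolding fd2_def[abs_def]
    by (intro continuous_intros cJ continuous_on_subset[OF S3_fun_partials(3)[OF F] sub])
qed

text \<open>The trace of the Hessian may be taken in the orthonormal frame \<open>x\<close>,
  \<open>J1 x\<close>, \<open>J2 x\<close>, \<open>J3 x\<close>, in which the radial entry is
  0.\<close>

lemma lapS3_eq_fd2:
  assumes F: "S3_fun F" and x: "x \<in> S3"
  shows "lapS3 F x = fd2 J1 F x + fd2 J2 F x + fd2 J3 F x"
proof -
  define H where "H u b = pd u (pd b (hext F)) x" for u b
  have n: "(Re (x$1))\<^sup>2 + (Im (x$1))\<^sup>2 + (Re (x$2))\<^sup>2 + (Im (x$2))\<^sup>2 = 1"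
    using x norm_vec2[of x] by (simp add: S3_def cmod_power2)
  have nc: "(complex_of_real (Re (x$1)))\<^sup>2 + (complex_of_real (Im (x$1)))\<^sup>2
      + (complex_of_real (Re (x$2)))\<^sup>2 + (complex_of_real (Im (x$2)))\<^sup>2 = 1"
    unfolding of_real_power[symmetric] of_real_add[symmetric] n by simp
  have "lapS3 F x = H ex ex + H ey ey + H ez ez + H ew ew"
    by (simp add: lapS3_def lap4_def coord_dirs_eq sum_Basis_complex2 H_def)
  \<comment> \<open>The inserted factor is the squared norm of \<open>x\<close>; with it the change
    of frame becomes a polynomial identity in \<open>x\<close> and \<open>H\<close>.\<close>
  also have "\<dots> = ((complex_of_real (Re (x$1)))\<^sup>2 + (complex_of_real (Im (x$1)))\<^sup>2
      + (complex_of_real (Re (x$2)))\<^sup>2 + (complex_of_real (Im (x$2)))\<^sup>2) * (H ex ex + H ey ey + H ez ez + H ew ew)"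
    by (simp add: nc)
  also have "\<dots> = (\<Sum>b\<in>Basis. (x \<bullet> b) *\<^sub>R (\<Sum>u\<in>Basis. (x \<bullet> u) *\<^sub>R H u b))
      + fd2 J1 F x + fd2 J2 F x + fd2 J3 F x"
    unfolding fd2_def H_def[symmetric]
    by (simp add: sum_Basis_complex2 inner_coord J1_def J2_def J3_def scaleR_conv_of_real) algebra
  finally show ?thesis using pd_hext_radial(2)[OF F S3_nonzero[OF x]] by (simp add: H_def)
qed

lemma flow_deriv_cnj: "flow_deriv J F F' \<Longrightarrow> flow_deriv J (\<lambda>x. cnj (F x)) (\<lambda>x. cnj (F' x))"
  by (simp add: flow_deriv_def has_vector_derivative_cnj)

text \<open>\<open>sint_green\<close> moves \<open>fd2 J\<close> to the other factor for each of the
  three structures. So the inner product of \<open>F\<close> and \<open>G\<close> is unchanged when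
  its factor \<open>l\<close> is replaced by \<open>cnj \<mu>\<close>, and must be 0.\<close>

lemma sint_eigenfunctions_orthogonal:
  assumes F: "S3_fun F" "\<And>x. x \<in> S3 \<Longrightarrow> lapS3 F x = l * F x"
    and G: "S3_fun G" "\<And>x. x \<in> S3 \<Longrightarrow> lapS3 G x = \<mu> * G x" and ne: "l \<noteq> cnj \<mu>"
  shows "sint (\<lambda>x. F x * cnj (G x)) = 0"
proof -
  note cF = S3_fun_continuous[OF F(1)] and cG = S3_fun_continuous[OF G(1)]
  note dF = S3_fun_flow_deriv[OF F(1)] and dG = S3_fun_flow_deriv[OF G(1)]
  have g: "sint (\<lambda>x. fd2 J F x * cnj (G x)) = sint (\<lambda>x. F x * cnj (fd2 J G x))"
    if "unit_structure J" for J
    by (rule sint_green[OF that dF(1,2)[OF that] cF dF(3,4)[OF that] dG(1,2)[OF that, THEN flow_deriv_cnj]])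
       (intro continuous_intros cG dG that)+
  note us = unit_structure_J
  have "l * sint (\<lambda>x. F x * cnj (G x)) = sint (\<lambda>x. lapS3 F x * cnj (G x))"
    unfolding sint_cmult[symmetric] by (rule sint_cong) (simp add: F)
  also have "\<dots> = sint (\<lambda>x. (fd2 J1 F x * cnj (G x) + fd2 J2 F x * cnj (G x)) + fd2 J3 F x * cnj (G x))"
    by (rule sint_cong) (simp add: lapS3_eq_fd2[OF F(1)] distrib_right)
  also have "\<dots> = sint (\<lambda>x. fd2 J1 F x * cnj (G x) + fd2 J2 F x * cnj (G x)) + sint (\<lambda>x. fd2 J3 F x * cnj (G x))"
    by (intro sint_add continuous_intros cG dF us)
  also have "sint (\<lambda>x. fd2 J1 F x * cnj (G x) + fd2 J2 F x * cnj (G x))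
      = sint (\<lambda>x. fd2 J1 F x * cnj (G x)) + sint (\<lambda>x. fd2 J2 F x * cnj (G x))"
    by (intro sint_add continuous_intros cG dF us)
  also have "sint (\<lambda>x. fd2 J1 F x * cnj (G x)) + sint (\<lambda>x. fd2 J2 F x * cnj (G x)) + sint (\<lambda>x. fd2 J3 F x * cnj (G x))
      = sint (\<lambda>x. F x * cnj (fd2 J1 G x)) + sint (\<lambda>x. F x * cnj (fd2 J2 G x)) + sint (\<lambda>x. F x * cnj (fd2 J3 G x))"
    by (simp add: g us)
  also have "sint (\<lambda>x. F x * cnj (fd2 J1 G x)) + sint (\<lambda>x. F x * cnj (fd2 J2 G x))
      = sint (\<lambda>x. F x * cnj (fd2 J1 G x) + F x * cnj (fd2 J2 G x))"
    by (intro sint_add[symmetric] continuous_intros cF dG us)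
  also have "\<dots> + sint (\<lambda>x. F x * cnj (fd2 J3 G x))
      = sint (\<lambda>x. (F x * cnj (fd2 J1 G x) + F x * cnj (fd2 J2 G x)) + F x * cnj (fd2 J3 G x))"
    by (intro sint_add[symmetric] continuous_intros cF dG us)
  also have "\<dots> = sint (\<lambda>x. F x * cnj (lapS3 G x))"
    by (rule sint_cong) (simp add: lapS3_eq_fd2[OF G(1)] distrib_left)
  also have "\<dots> = sint (\<lambda>x. cnj \<mu> * (F x * cnj (G x)))"
    by (rule sint_cong) (simp add: G)
  also have "\<dots> = cnj \<mu> * sint (\<lambda>x. F x * cnj (G x))" by (rule sint_cmult)
  finally show ?thesis using ne by simp
qed

section \<open>Harmonic polynomials\<close>

text \<open>The polynomial variable is the formal u. Each \<open>J\<close> scales or exchanges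
  \<open>xi\<close> and \<open>eta\<close> up to scalars without touching u, so the flows move only
  the exponents \<open>p\<close> and \<open>q\<close>.\<close>

definition xi :: "complex^2 \<Rightarrow> complex poly" where "xi x = [:x$2, x$1:]"
definition eta :: "complex^2 \<Rightarrow> complex poly" where "eta x = [:cnj (x$1), - cnj (x$2):]"

definition hp :: "nat \<Rightarrow> nat \<Rightarrow> nat \<Rightarrow> complex^2 \<Rightarrow> complex" where
  "hp p q i x = coeff (xi x ^ p * eta x ^ q) i"

lemma xi_eta_J:
  "xi (J1 x) = smult \<i> (xi x)" "eta (J1 x) = - smult \<i> (eta x)"
  "xi (J2 x) = eta x" "eta (J2 x) = - xi x"
  "xi (J3 x) = smult \<i> (eta x)" "eta (J3 x) = smult \<i> (xi x)"
  by (simp_all add: xi_def eta_def J1_def J2_def J3_def)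

lemma coeff_mult_has_derivative:
  fixes A B :: "'b::real_normed_vector \<Rightarrow> 'a::{comm_semiring_0,real_normed_field} poly"
  assumes "\<And>i. ((\<lambda>x. coeff (A x) i) has_derivative (\<lambda>v. coeff (A' v) i)) (at x)"
    and "\<And>i. ((\<lambda>x. coeff (B x) i) has_derivative (\<lambda>v. coeff (B' v) i)) (at x)"
  shows "((\<lambda>x. coeff (A x * B x) i) has_derivative (\<lambda>v. coeff (A x * B' v + A' v * B x) i)) (at x)"
  unfolding coeff_mult coeff_add sum.distrib[symmetric]
  by (intro has_derivative_sum has_derivative_mult assms)

lemma coeff_power_has_derivative:
  fixes A :: "'b::real_normed_vector \<Rightarrow> 'a::{comm_semiring_0,real_normed_field} poly"
  assumes A: "\<And>i. ((\<lambda>x. coeff (A x) i) has_derivative (\<lambda>v. coeff (A' v) i)) (at x)"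
  shows "((\<lambda>x. coeff (A x ^ n) i) has_derivative (\<lambda>v. coeff (of_nat n * A' v * A x ^ (n - 1)) i)) (at x)"
proof (induction n arbitrary: i)
  case 0
  then show ?case by simp
next
  case (Suc n)
  have "((\<lambda>x. coeff (A x * A x ^ n) i) has_derivative
    (\<lambda>v. coeff (A x * (of_nat n * A' v * A x ^ (n - 1)) + A' v * A x ^ n) i)) (at x)"
    by (rule coeff_mult_has_derivative[OF A Suc])
  moreover have "A x * (of_nat n * A' v * A x ^ (n - 1)) + A' v * A x ^ n = of_nat (Suc n) * A' v * A x ^ n" for v
    by (cases n) (simp_all add: algebra_simps)
  ultimately show ?case by (simp only: power_Suc diff_Suc_1)
qed

lemma xi_eta_has_derivative:
  "((\<lambda>x. coeff (xi x) i) has_derivative (\<lambda>v. coeff (xi v) i)) (at x)"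
  "((\<lambda>x. coeff (eta x) i) has_derivative (\<lambda>v. coeff (eta v) i)) (at x)"
proof -
  have 1: "bounded_linear (\<lambda>x::complex^2. x $ j)" for j by (rule bounded_linear_vec_nth)
  have 2: "bounded_linear (\<lambda>x::complex^2. cnj (x $ j))" for j
    by (rule bounded_linear_compose[OF bounded_linear_cnj 1])
  show "((\<lambda>x. coeff (xi x) i) has_derivative (\<lambda>v. coeff (xi v) i)) (at x)"
    by (rule bounded_linear_imp_has_derivative)
      (cases i; cases "i - 1"; simp add: xi_def coeff_pCons 1 split: nat.split)
  show "((\<lambda>x. coeff (eta x) i) has_derivative (\<lambda>v. coeff (eta v) i)) (at x)"
    by (rule bounded_linear_imp_has_derivative)
      (cases i; cases "i - 1"; simp add: eta_def coeff_pCons 2 bounded_linear_minus split: nat.split)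
qed

lemma hp_has_derivative:
  "(hp p q i has_derivative (\<lambda>v. coeff (of_nat p * xi v * xi x ^ (p - 1) * eta x ^ q
     + of_nat q * eta v * xi x ^ p * eta x ^ (q - 1)) i)) (at x)"
proof -
  have "(hp p q i has_derivative (\<lambda>v. coeff (xi x ^ p * (of_nat q * eta v * eta x ^ (q - 1))
      + of_nat p * xi v * xi x ^ (p - 1) * eta x ^ q) i)) (at x)"
    unfolding hp_def[abs_def]
    by (intro coeff_mult_has_derivative coeff_power_has_derivative xi_eta_has_derivative)
  then show ?thesis by (simp add: algebra_simps)
qed

lemma hp_has_vector_derivative:
  assumes "(c has_vector_derivative c') (at t)"
  shows "((\<lambda>s. hp p q i (c s)) has_vector_derivative
    coeff (of_nat p * xi c' * xi (c t) ^ (p - 1) * eta (c t) ^ q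
     + of_nat q * eta c' * xi (c t) ^ p * eta (c t) ^ (q - 1)) i) (at t)"
  using vector_derivative_diff_chain_within[OF assms has_derivative_at_withinI[OF hp_has_derivative]]
  by (simp add: o_def)

lemma coeff_of_nat_mult: "coeff (of_nat n * p) i = of_nat n * coeff p i"
  by (simp add: of_nat_poly)

text \<open>\<open>J1\<close> multiplies \<open>xi\<close> by i and \<open>eta\<close> by -i, which
  gives the weight \<open>p - q\<close>; \<open>J2\<close> and \<open>J3\<close> exchange the two
  and combine a lowering with a raising term. The truncated \<open>p - 1\<close> and
  \<open>q - 1\<close> are harmless, as they carry the factors \<open>p\<close> and
  \<open>q\<close>.\<close>

lemma flow_deriv_hp:
  "flow_deriv J1 (hp p q i) (\<lambda>x. \<i> * (of_nat p - of_nat q) * hp p q i x)"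
  "flow_deriv J2 (hp p q i) (\<lambda>x. of_nat p * hp (p - 1) (q + 1) i x - of_nat q * hp (p + 1) (q - 1) i x)"
  "flow_deriv J3 (hp p q i) (\<lambda>x. \<i> * of_nat p * hp (p - 1) (q + 1) i x + \<i> * of_nat q * hp (p + 1) (q - 1) i x)"
proof -
  have curve: "((\<lambda>t. flow J t x) has_vector_derivative J x) (at 0)" for J x
    unfolding flow_def by (auto intro!: derivative_eq_intros)
  have "((\<lambda>t. hp p q i (flow J t x)) has_vector_derivative
    of_nat p * coeff (xi (J x) * (xi x ^ (p - 1) * eta x ^ q)) i
     + of_nat q * coeff (eta (J x) * (xi x ^ p * eta x ^ (q - 1))) i) (at 0)" for J x
    using hp_has_vector_derivative[OF curve[of J x]] by (simp add: mult.assoc coeff_of_nat_mult)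
  note d = this
  have p: "of_nat p * coeff (xi x * (xi x ^ (p - 1) * eta x ^ q)) i = of_nat p * hp p q i x" for x
    by (cases p) (simp_all add: hp_def mult.assoc)
  have q: "of_nat q * coeff (eta x * (xi x ^ p * eta x ^ (q - 1))) i = of_nat q * hp p q i x" for x
    by (cases q) (simp_all add: hp_def mult_ac)
  have p': "coeff (eta x * (xi x ^ (p - 1) * eta x ^ q)) i = hp (p - 1) (q + 1) i x" for x
    by (simp add: hp_def mult_ac)
  have q': "coeff (xi x * (xi x ^ p * eta x ^ (q - 1))) i = hp (p + 1) (q - 1) i x" for x
    by (simp add: hp_def mult_ac)
  show "flow_deriv J1 (hp p q i) (\<lambda>x. \<i> * (of_nat p - of_nat q) * hp p q i x)"
    unfolding flow_deriv_def
  proof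
    fix x
    show "((\<lambda>t. hp p q i (flow J1 t x)) has_vector_derivative \<i> * (of_nat p - of_nat q) * hp p q i x) (at 0)"
    proof -
      have "of_nat p * coeff (xi (J1 x) * (xi x ^ (p - 1) * eta x ^ q)) i
          + of_nat q * coeff (eta (J1 x) * (xi x ^ p * eta x ^ (q - 1))) i
        = \<i> * (of_nat p * coeff (xi x * (xi x ^ (p - 1) * eta x ^ q)) i)
          - \<i> * (of_nat q * coeff (eta x * (xi x ^ p * eta x ^ (q - 1))) i)"
        by (simp add: xi_eta_J)
      also have "\<dots> = \<i> * (of_nat p - of_nat q) * hp p q i x"
        unfolding p q by (simp add: algebra_simps)
      finally show ?thesis using d[of J1 x] by (simp only:)
    qed
  qed
  show "flow_deriv J2 (hp p q i) (\<lambda>x. of_nat p * hp (p - 1) (q + 1) i x - of_nat q * hp (p + 1) (q - 1) i x)"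
    unfolding flow_deriv_def using d[of J2] p' q' by (simp add: xi_eta_J)
  show "flow_deriv J3 (hp p q i) (\<lambda>x. \<i> * of_nat p * hp (p - 1) (q + 1) i x + \<i> * of_nat q * hp (p + 1) (q - 1) i x)"
    unfolding flow_deriv_def using d[of J3] p' q' by (simp add: xi_eta_J mult.left_commute mult.assoc)
qed

lemma flow_deriv_add:
  "flow_deriv J F F' \<Longrightarrow> flow_deriv J G G' \<Longrightarrow> flow_deriv J (\<lambda>x. F x + G x) (\<lambda>x. F' x + G' x)"
  by (simp add: flow_deriv_def has_vector_derivative_add)

lemma flow_deriv_cmult: "flow_deriv J F F' \<Longrightarrow> flow_deriv J (\<lambda>x. c * F x) (\<lambda>x. c * F' x)"
  by (simp add: flow_deriv_def has_vector_derivative_mult_right)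

lemma flow_deriv_diff:
  "flow_deriv J F F' \<Longrightarrow> flow_deriv J G G' \<Longrightarrow> flow_deriv J (\<lambda>x. F x - G x) (\<lambda>x. F' x - G' x)"
  by (simp add: flow_deriv_def has_vector_derivative_diff)

lemma flow_deriv_sum:
  "(\<And>s. s \<in> A \<Longrightarrow> flow_deriv J (F s) (F' s)) \<Longrightarrow> flow_deriv J (\<lambda>x. \<Sum>s\<in>A. F s x) (\<lambda>x. \<Sum>s\<in>A. F' s x)"
  by (simp add: flow_deriv_def has_vector_derivative_sum)

lemma flow_deriv_unique:
  assumes J: "unit_structure J" and F: "flow_deriv J F F'" and G: "flow_deriv J G G'"
    and eq: "\<And>x. x \<in> S3 \<Longrightarrow> F x = G x" and x: "x \<in> S3"
  shows "F' x = G' x"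
proof -
  have "((\<lambda>t. G (flow J t x)) has_vector_derivative G' x) (at 0)"
    using G x by (simp add: flow_deriv_def)
  then have "((\<lambda>t. F (flow J t x)) has_vector_derivative G' x) (at 0)"
    using x by (simp add: eq flow_S3 J)
  moreover have "((\<lambda>t. F (flow J t x)) has_vector_derivative F' x) (at 0)"
    using F x by (simp add: flow_deriv_def)
  ultimately show ?thesis using vector_derivative_unique_at by blast
qed

text \<open>A class of functions that is closed under partial derivatives away from the origin;
  it contains the degree-0 extensions of all polynomials.\<close>

inductive rational_fun :: "(complex^2 \<Rightarrow> complex) \<Rightarrow> bool" where
  const: "rational_fun (\<lambda>x. c)"
| coord: "rational_fun (\<lambda>x. x $ j)"
| cnj_coord: "rational_fun (\<lambda>x. cnj (x $ j))"
| inv_norm: "rational_fun (\<lambda>x. of_real (inverse (norm x)))"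
| add: "rational_fun f \<Longrightarrow> rational_fun g \<Longrightarrow> rational_fun (\<lambda>x. f x + g x)"
| mult: "rational_fun f \<Longrightarrow> rational_fun g \<Longrightarrow> rational_fun (\<lambda>x. f x * g x)"

lemma rational_fun_continuous: "rational_fun f \<Longrightarrow> continuous_on (- {0}) f"
  by (induction rule: rational_fun.induct) (auto intro!: continuous_intros)

lemma inner_complex2: "complex_of_real (x \<bullet> v) =
    (1/2) * (x$1 * cnj (v$1) + cnj (x$1) * v$1 + x$2 * cnj (v$2) + cnj (x$2) * v$2)" for x v :: "complex^2"
  by (simp add: inner_vec_def sum_2 inner_complex_def complex_eq_iff)

lemma rational_fun_inner: "rational_fun (\<lambda>x. complex_of_real (x \<bullet> v))"
  unfolding inner_complex2 by (intro rational_fun.intros)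

text \<open>The only generator that is neither constant nor real-linear is the inverse norm. Its
  derivative along \<open>v\<close> is \<open>- (x \<bullet> v) / norm x ^ 3\<close>, and the inner
  product is a combination of coordinates and their conjugates.\<close>

lemma rational_fun_has_partial:
  assumes "rational_fun f"
  shows "\<exists>f'. rational_fun f' \<and> (\<forall>x. x \<noteq> 0 \<longrightarrow> ((\<lambda>t. f (x + t *\<^sub>R v)) has_vector_derivative f' x) (at 0))"
  using assms
proof (induction rule: rational_fun.induct)
  case (const c)
  then show ?case by (intro exI[of _ "\<lambda>x. 0"]) (auto intro: rational_fun.const)
next
  case (coord j)
  show ?case by (intro exI[of _ "\<lambda>x. v $ j"])
      (auto intro!: rational_fun.const derivative_eq_intros)
next
  case (cnj_coord j)
  show ?case by (intro exI[of _ "\<lambda>x. cnj (v $ j)"])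
      (auto intro!: rational_fun.const derivative_eq_intros)
next
  case inv_norm
  let ?i = "\<lambda>x::complex^2. complex_of_real (inverse (norm x))"
  have "((\<lambda>t. ?i (x + t *\<^sub>R v)) has_vector_derivative
      (-1) * (complex_of_real (x \<bullet> v) * (?i x * (?i x * ?i x)))) (at 0)" if x: "x \<noteq> 0" for x
  proof -
    have c: "((\<lambda>t. x + t *\<^sub>R v) has_vector_derivative v) (at 0)"
      by (auto intro!: derivative_eq_intros)
    have "(norm has_derivative (\<lambda>h. h \<bullet> sgn x)) (at (x + 0 *\<^sub>R v))"
      using has_derivative_norm[OF x] by simp
    from vector_derivative_diff_chain_within[OF c has_derivative_at_withinI[OF this]]
    have "((\<lambda>t. norm (x + t *\<^sub>R v)) has_real_derivative v \<bullet> sgn x) (at 0)"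
      by (simp add: o_def has_real_derivative_iff_has_vector_derivative)
    from DERIV_inverse_fun[OF this] x
    have "((\<lambda>t. inverse (norm (x + t *\<^sub>R v))) has_real_derivative
        - (x \<bullet> v * (inverse (norm x) * (inverse (norm x) * inverse (norm x))))) (at 0)"
      by (simp add: sgn_div_norm inner_commute power2_eq_square mult_ac)
    from has_vector_derivative_of_real[OF this]
    have "((\<lambda>t. ?i (x + t *\<^sub>R v)) has_vector_derivative complex_of_real
        (- (x \<bullet> v * (inverse (norm x) * (inverse (norm x) * inverse (norm x)))))) (at 0)" .
    then show ?thesis by simp
  qed
  moreover have "rational_fun (\<lambda>x. (-1) * (complex_of_real (x \<bullet> v) * (?i x * (?i x * ?i x))))"
    by (intro rational_fun.mult rational_fun.const rational_fun_inner rational_fun.inv_norm)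
  ultimately show ?case by blast
next
  case (add f g)
  then obtain f' g' where "rational_fun f'" "rational_fun g'"
    "\<forall>x. x \<noteq> 0 \<longrightarrow> ((\<lambda>t. f (x + t *\<^sub>R v)) has_vector_derivative f' x) (at 0)"
    "\<forall>x. x \<noteq> 0 \<longrightarrow> ((\<lambda>t. g (x + t *\<^sub>R v)) has_vector_derivative g' x) (at 0)" by blast
  then show ?case
    by (intro exI[of _ "\<lambda>x. f' x + g' x"])
       (auto intro!: rational_fun.add has_vector_derivative_add)
next
  case (mult f g)
  then obtain f' g' where fg: "rational_fun f'" "rational_fun g'"
    "\<forall>x. x \<noteq> 0 \<longrightarrow> ((\<lambda>t. f (x + t *\<^sub>R v)) has_vector_derivative f' x) (at 0)"
    "\<forall>x. x \<noteq> 0 \<longrightarrow> ((\<lambda>t. g (x + t *\<^sub>R v)) has_vector_derivative g' x) (at 0)" by blast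
  have "((\<lambda>t. f (x + t *\<^sub>R v) * g (x + t *\<^sub>R v)) has_vector_derivative f x * g' x + f' x * g x) (at 0)"
    if "x \<noteq> 0" for x
    using has_vector_derivative_mult[OF fg(3)[rule_format, OF that] fg(4)[rule_format, OF that]] by simp
  moreover have "rational_fun (\<lambda>x. f x * g' x + f' x * g x)"
    by (intro rational_fun.add rational_fun.mult fg mult.hyps)
  ultimately show ?case by blast
qed

text \<open>Agreement of \<open>g\<close> and \<open>f\<close> off the origin suffices, because the
  line through a nonzero point avoids the origin for small parameters. In this form the lemma can be
  iterated: \<open>pd v g\<close> is in turn identified off the origin only.\<close>

lemma rational_fun_pd:
  assumes f: "rational_fun f" and g: "\<And>x. x \<noteq> 0 \<Longrightarrow> g x = f x"
  shows "\<exists>f'. rational_fun f' \<and> (\<forall>x. x \<noteq> 0 \<longrightarrow> pd v g x = f' x)"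
    and "x \<noteq> 0 \<Longrightarrow> ((\<lambda>t. g (x + t *\<^sub>R v)) has_vector_derivative pd v g x) (at 0)"
proof -
  obtain f' where f': "rational_fun f'"
    "\<And>x. x \<noteq> 0 \<Longrightarrow> ((\<lambda>t. f (x + t *\<^sub>R v)) has_vector_derivative f' x) (at 0)"
    using rational_fun_has_partial[OF f] by blast
  have d: "((\<lambda>t. g (x + t *\<^sub>R v)) has_vector_derivative f' x) (at 0)" if x: "x \<noteq> 0" for x
  proof (rule has_vector_derivative_transform_within_open[OF f'(2)[OF x]])
    have "continuous_on UNIV (\<lambda>t. x + t *\<^sub>R v)" by (intro continuous_intros)
    from open_vimage[OF _ this, of "- {0}"]
    show "open ((\<lambda>t. x + t *\<^sub>R v) -` (- {0}))" by auto
  qed (use x g in auto)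
  then have e: "pd v g x = f' x" if "x \<noteq> 0" for x
    unfolding pd_def using that vector_derivative_at by blast
  show "\<exists>f'. rational_fun f' \<and> (\<forall>x. x \<noteq> 0 \<longrightarrow> pd v g x = f' x)" using f'(1) e by blast
  show "((\<lambda>t. g (x + t *\<^sub>R v)) has_vector_derivative pd v g x) (at 0)" if "x \<noteq> 0"
    using d[OF that] by (simp only: e[OF that])
qed

lemma rational_fun_C2_on:
  assumes f: "rational_fun f" and g: "\<And>x. x \<noteq> 0 \<Longrightarrow> g x = f x"
  shows "C2_on (- {0}) g"
  unfolding C2_on_def
proof (intro conjI ballI)
  fix v p assume "p \<in> - {0::complex^2}"
  then show "((\<lambda>t. g (p + t *\<^sub>R v)) has_vector_derivative pd v g p) (at 0)"
    using rational_fun_pd(2)[OF f g] by simp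
next
  fix u v p assume p: "p \<in> - {0::complex^2}"
  obtain f' where f': "rational_fun f'" "\<And>x. x \<noteq> 0 \<Longrightarrow> pd v g x = f' x"
    using rational_fun_pd(1)[OF f g, of v] by blast
  show "((\<lambda>t. pd v g (p + t *\<^sub>R u)) has_vector_derivative pd u (pd v g) p) (at 0)"
    using rational_fun_pd(2)[OF f'] p by simp
next
  fix u v
  obtain f' where f': "rational_fun f'" "\<And>x. x \<noteq> 0 \<Longrightarrow> pd v g x = f' x"
    using rational_fun_pd(1)[OF f g, of v] by blast
  obtain f'' where f'': "rational_fun f''" "\<And>x. x \<noteq> 0 \<Longrightarrow> pd u (pd v g) x = f'' x"
    using rational_fun_pd(1)[OF f', of u] by blast
  show "continuous_on (- {0}) (pd u (pd v g))"
    using rational_fun_continuous[OF f''(1)] by (rule continuous_on_eq) (simp add: f''(2))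
qed

lemma S3_fun_restrS3:
  assumes "rational_fun (\<lambda>x. P ((1 / norm x) *\<^sub>R x))"
  shows "S3_fun (restrS3 P)"
  unfolding S3_fun_def
proof (intro conjI allI impI)
  show "C2_on (- {0}) (hext (restrS3 P))"
    by (rule rational_fun_C2_on[OF assms]) (simp add: hext_def restrS3_def S3_def)
qed (simp add: restrS3_def)

lemma rational_fun_sum:
  "(\<And>s. s \<in> A \<Longrightarrow> rational_fun (f s)) \<Longrightarrow> rational_fun (\<lambda>x. \<Sum>s\<in>A. f s x)"
  by (induction A rule: infinite_finite_induct) (auto intro: rational_fun.intros)

lemma rational_fun_coeff_mult:
  "(\<And>i. rational_fun (\<lambda>x. coeff (A x) i)) \<Longrightarrow> (\<And>i. rational_fun (\<lambda>x. coeff (B x) i)) \<Longrightarrow>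
    rational_fun (\<lambda>x. coeff (A x * B x) i)"
  unfolding coeff_mult by (intro rational_fun_sum rational_fun.mult)

lemma rational_fun_coeff_power:
  assumes "\<And>i. rational_fun (\<lambda>x. coeff (A x) i)"
  shows "rational_fun (\<lambda>x. coeff (A x ^ n) i)"
  by (induction n arbitrary: i)
     (auto intro!: rational_fun_coeff_mult assms rational_fun.const simp: coeff_pCons split: nat.split)

lemma rational_fun_hp: "rational_fun (\<lambda>x. hp p q i ((1 / norm x) *\<^sub>R x))"
proof -
  have 1: "rational_fun (\<lambda>x. of_real (inverse (norm x)) * x $ j)" for j
    by (intro rational_fun.intros)
  have 2: "rational_fun (\<lambda>x. of_real (inverse (norm x)) * cnj (x $ j))" for j
    by (intro rational_fun.intros)
  have 3: "rational_fun (\<lambda>x. (-1) * (of_real (inverse (norm x)) * cnj (x $ j)))" for j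
    by (intro rational_fun.intros)
  have "rational_fun (\<lambda>x. coeff (xi ((1 / norm x) *\<^sub>R x)) i)" for i
    using 1 rational_fun.const[of 0]
    by (cases i; cases "i - 1")
       (auto simp: xi_def scaleR_conv_of_real[where 'a = complex] divide_inverse)
  moreover have "rational_fun (\<lambda>x. coeff (eta ((1 / norm x) *\<^sub>R x)) i)" for i
    using 2 3 rational_fun.const[of 0]
    by (cases i; cases "i - 1")
       (auto simp: eta_def scaleR_conv_of_real[where 'a = complex] divide_inverse)
  ultimately show ?thesis
    unfolding hp_def by (intro rational_fun_coeff_mult rational_fun_coeff_power)
qed

section \<open>Multiplication by coordinates\<close>

interpretation fs: vector_space fscale
  by unfold_locales (auto simp: fscale_def fun_eq_iff algebra_simps)

text \<open>Coefficients are indexed by \<open>A\<close> and not by the image, so \<open>g\<close>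
  may repeat values.\<close>

lemma span_image_sum:
  assumes A: "finite A" and f: "f \<in> fs.span (g ` A)"
  obtains c where "f = (\<Sum>a\<in>A. fscale (c a) (g a))"
proof -
  let ?S = "{\<Sum>a\<in>A. fscale (c a) (g a) | c. True}"
  have "fs.subspace ?S"
  proof (rule fs.subspaceI)
    show "0 \<in> ?S" by (auto intro!: exI[of _ "\<lambda>a. 0"])
    fix u v assume "u \<in> ?S" "v \<in> ?S"
    then obtain c d where "u = (\<Sum>a\<in>A. fscale (c a) (g a))" "v = (\<Sum>a\<in>A. fscale (d a) (g a))" by blast
    then have "u + v = (\<Sum>a\<in>A. fscale (c a + d a) (g a))"
      by (simp add: fs.scale_left_distrib sum.distrib)
    then show "u + v \<in> ?S" by (intro CollectI exI conjI TrueI)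
  next
    fix r u assume "u \<in> ?S"
    then obtain c where "u = (\<Sum>a\<in>A. fscale (c a) (g a))" by blast
    then have "fscale r u = (\<Sum>a\<in>A. fscale (r * c a) (g a))"
      by (simp add: fs.scale_sum_right)
    then show "fscale r u \<in> ?S" by (intro CollectI exI conjI TrueI)
  qed
  moreover have "g ` A \<subseteq> ?S"
  proof
    fix h assume "h \<in> g ` A"
    then obtain b where b: "b \<in> A" "h = g b" by blast
    have "(\<Sum>a\<in>A. fscale (if a = b then 1 else 0) (g a)) = (\<Sum>a\<in>A. if a = b then g a else 0)"
      by (rule sum.cong) auto
    also have "\<dots> = h" using A b by simp
    finally have "h = (\<Sum>a\<in>A. fscale (if a = b then 1 else 0) (g a))" by simp
    then show "h \<in> ?S" by (intro CollectI exI conjI TrueI)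
  qed
  ultimately have "fs.span (g ` A) \<subseteq> ?S" by (rule fs.span_minimal[rotated])
  with f that show thesis by blast
qed

lemma sum_fscale_apply: "(\<Sum>a\<in>A. fscale (c a) (g a)) x = (\<Sum>a\<in>A. c a * g a x)"
  by (induction A rule: infinite_finite_induct) (auto simp: fscale_def)

lemma restrS3_sum: "(\<Sum>a\<in>A. fscale (c a) (restrS3 (g a))) = restrS3 (\<lambda>x. \<Sum>a\<in>A. c a * g a x)"
  by (rule ext) (simp add: sum_fscale_apply restrS3_def)

text \<open>The second flow derivatives of \<open>hp p q i\<close> along \<open>J1, J2, J3\<close> add up to the Casimir
  eigenvalue of the \<open>(k + 1)\<close>-dimensional representation of \<open>su(2)\<close>, \<open>k = p + q\<close>.\<close>

lemma hp_sum_eigenfunction: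
  fixes c :: "'a \<Rightarrow> complex" and i :: "'a \<Rightarrow> nat"
  assumes "finite A" and k: "\<And>a. a \<in> A \<Longrightarrow> p a + q a = k"
  defines "F \<equiv> restrS3 (\<lambda>x. \<Sum>a\<in>A. c a * hp (p a) (q a) (i a) x)"
  shows "S3_fun F" and "x \<in> S3 \<Longrightarrow> lapS3 F x = - of_nat (k * (k + 2)) * F x"
proof -
  have "rational_fun (\<lambda>x. \<Sum>a\<in>A. c a * hp (p a) (q a) (i a) ((1 / norm x) *\<^sub>R x))"
    by (intro rational_fun_sum rational_fun.mult rational_fun.const rational_fun_hp)
  then show F: "S3_fun F" unfolding F_def by (rule S3_fun_restrS3)
  assume x: "x \<in> S3"
  let ?f = "\<lambda>x. \<Sum>a\<in>A. c a * hp (p a) (q a) (i a) x"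
  \<comment> \<open>Flow derivatives are unique on \<open>S3\<close>, so the derivatives defined
    through \<open>pd\<close> can be exchanged for the explicit ones of \<open>hp\<close>.\<close>
  have fd2_eq: "fd2 J F x = (\<Sum>a\<in>A. c a * h2 a x)"
    if J: "unit_structure J" and h1: "\<And>a. a \<in> A \<Longrightarrow> flow_deriv J (hp (p a) (q a) (i a)) (h1 a)"
      and h2: "\<And>a. a \<in> A \<Longrightarrow> flow_deriv J (h1 a) (h2 a)" for J h1 h2
  proof (rule flow_deriv_unique[OF J S3_fun_flow_deriv(2)[OF F J] _ _ x])
    show "flow_deriv J (\<lambda>x. \<Sum>a\<in>A. c a * h1 a x) (\<lambda>x. \<Sum>a\<in>A. c a * h2 a x)"
      by (intro flow_deriv_sum flow_deriv_cmult h2)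
    have "flow_deriv J ?f (\<lambda>x. \<Sum>a\<in>A. c a * h1 a x)"
      by (intro flow_deriv_sum flow_deriv_cmult h1)
    from flow_deriv_unique[OF J S3_fun_flow_deriv(1)[OF F J] this]
    show "fd J F y = (\<Sum>a\<in>A. c a * h1 a y)" if "y \<in> S3" for y
      using that by (simp add: F_def restrS3_def)
  qed
  define P Q where "P a = complex_of_nat (p a)" and "Q a = complex_of_nat (q a)" for a
  have 1: "fd2 J1 F x = (\<Sum>a\<in>A. c a * (\<i> * (P a - Q a) * (\<i> * (P a - Q a) * hp (p a) (q a) (i a) x)))"
    unfolding P_def Q_def
    by (rule fd2_eq[OF unit_structure_J(1)], rule flow_deriv_hp, intro flow_deriv_cmult flow_deriv_hp)
  have 2: "fd2 J2 F x = (\<Sum>a\<in>A. c a *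
      (P a * (of_nat (p a - 1) * hp (p a - 1 - 1) (q a + 1 + 1) (i a) x - of_nat (q a + 1) * hp (p a - 1 + 1) (q a + 1 - 1) (i a) x)
      - Q a * (of_nat (p a + 1) * hp (p a + 1 - 1) (q a - 1 + 1) (i a) x - of_nat (q a - 1) * hp (p a + 1 + 1) (q a - 1 - 1) (i a) x)))"
    unfolding P_def Q_def
    by (rule fd2_eq[OF unit_structure_J(2)], rule flow_deriv_hp, intro flow_deriv_diff flow_deriv_cmult flow_deriv_hp)
  have 3: "fd2 J3 F x = (\<Sum>a\<in>A. c a *
      (\<i> * P a * (\<i> * of_nat (p a - 1) * hp (p a - 1 - 1) (q a + 1 + 1) (i a) x + \<i> * of_nat (q a + 1) * hp (p a - 1 + 1) (q a + 1 - 1) (i a) x)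
      + \<i> * Q a * (\<i> * of_nat (p a + 1) * hp (p a + 1 - 1) (q a - 1 + 1) (i a) x + \<i> * of_nat (q a - 1) * hp (p a + 1 + 1) (q a - 1 - 1) (i a) x)))"
    unfolding P_def Q_def
    by (rule fd2_eq[OF unit_structure_J(3)], rule flow_deriv_hp, intro flow_deriv_add flow_deriv_cmult flow_deriv_hp)
  have "lapS3 F x = (\<Sum>a\<in>A. c a * (- of_nat (k * (k + 2)) * hp (p a) (q a) (i a) x))"
    unfolding lapS3_eq_fd2[OF F x] 1 2 3 sum.distrib[symmetric] distrib_left[symmetric]
  proof (intro sum.cong refl arg_cong2[where f = "(*)"])
    fix a assume "a \<in> A"
    then have kk: "of_nat (k * (k + 2)) = (P a + Q a) * (P a + Q a + 2)"
      using k[of a] by (auto simp: P_def Q_def algebra_simps)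
    \<comment> \<open>Truncated subtraction is undone here: in the exceptional case
      \<open>p a = 0\<close> the factor \<open>P a\<close> is 0.\<close>
    have p: "P a * hp (p a - 1 + 1) q' i' x = P a * hp (p a) q' i' x" for q' i'
      by (cases "p a") (simp_all add: P_def)
    have q: "Q a * hp p' (q a - 1 + 1) i' x = Q a * hp p' (q a) i' x" for p' i'
      by (cases "q a") (simp_all add: Q_def)
    \<comment> \<open>The terms with exponents shifted by two occur with opposite signs for
      \<open>J2\<close> and \<open>J3\<close> and cancel. What remains is minus
      \<open>(P - Q)^2 + 2 P (Q + 1) + 2 Q (P + 1)\<close>, which equals
      \<open>(P + Q) (P + Q + 2)\<close>.\<close>
    have "\<i> * (P a - Q a) * (\<i> * (P a - Q a) * hp (p a) (q a) (i a) x) +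
      (P a * (of_nat (p a - 1) * hp (p a - 1 - 1) (q a + 1 + 1) (i a) x - of_nat (q a + 1) * hp (p a - 1 + 1) (q a + 1 - 1) (i a) x)
      - Q a * (of_nat (p a + 1) * hp (p a + 1 - 1) (q a - 1 + 1) (i a) x - of_nat (q a - 1) * hp (p a + 1 + 1) (q a - 1 - 1) (i a) x)) +
      (\<i> * P a * (\<i> * of_nat (p a - 1) * hp (p a - 1 - 1) (q a + 1 + 1) (i a) x + \<i> * of_nat (q a + 1) * hp (p a - 1 + 1) (q a + 1 - 1) (i a) x)
      + \<i> * Q a * (\<i> * of_nat (p a + 1) * hp (p a + 1 - 1) (q a - 1 + 1) (i a) x + \<i> * of_nat (q a - 1) * hp (p a + 1 + 1) (q a - 1 - 1) (i a) x))
      = - (P a - Q a)\<^sup>2 * hp (p a) (q a) (i a) x - 2 * of_nat (q a + 1) * (P a * hp (p a - 1 + 1) (q a + 1 - 1) (i a) x)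
        - 2 * of_nat (p a + 1) * (Q a * hp (p a + 1 - 1) (q a - 1 + 1) (i a) x)"
      by (simp add: algebra_simps power2_eq_square)
    also have "\<dots> = - of_nat (k * (k + 2)) * hp (p a) (q a) (i a) x"
      unfolding p q kk by (simp add: P_def Q_def) (simp add: algebra_simps power2_eq_square)
    finally show "\<i> * (P a - Q a) * (\<i> * (P a - Q a) * hp (p a) (q a) (i a) x) +
      (P a * (of_nat (p a - 1) * hp (p a - 1 - 1) (q a + 1 + 1) (i a) x - of_nat (q a + 1) * hp (p a - 1 + 1) (q a + 1 - 1) (i a) x)
      - Q a * (of_nat (p a + 1) * hp (p a + 1 - 1) (q a - 1 + 1) (i a) x - of_nat (q a - 1) * hp (p a + 1 + 1) (q a - 1 - 1) (i a) x)) +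
      (\<i> * P a * (\<i> * of_nat (p a - 1) * hp (p a - 1 - 1) (q a + 1 + 1) (i a) x + \<i> * of_nat (q a + 1) * hp (p a - 1 + 1) (q a + 1 - 1) (i a) x)
      + \<i> * Q a * (\<i> * of_nat (p a + 1) * hp (p a + 1 - 1) (q a - 1 + 1) (i a) x + \<i> * of_nat (q a - 1) * hp (p a + 1 + 1) (q a - 1 - 1) (i a) x))
      = - of_nat (k * (k + 2)) * hp (p a) (q a) (i a) x" .
  qed
  also have "\<dots> = - of_nat (k * (k + 2)) * F x"
    using x by (simp add: F_def restrS3_def sum_distrib_left mult.left_commute sum_negf)
  finally show "lapS3 F x = - of_nat (k * (k + 2)) * F x" .
qed

text \<open>The terms linear in u cancel. On \<open>S3\<close> the value is 1, so this combination
  can be inserted into a product that has one factor too few.\<close>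

lemma smult_xi_eta:
  "smult (x$1) (eta x) + smult (cnj (x$2)) (xi x) = [:x$1 * cnj (x$1) + x$2 * cnj (x$2):]"
  by (simp add: xi_def eta_def mult.commute)

lemma S3_sum_squares:
  assumes "x \<in> S3"
  shows "x$1 * cnj (x$1) + x$2 * cnj (x$2) = 1"
proof -
  have "(cmod (x$1))\<^sup>2 + (cmod (x$2))\<^sup>2 = 1"
    using assms norm_vec2[of x] by (simp add: S3_def)
  then have "complex_of_real ((cmod (x$1))\<^sup>2 + (cmod (x$2))\<^sup>2) = 1" by (simp only: of_real_1)
  then show ?thesis by (simp only: of_real_add complex_norm_square)
qed

lemma S3_smult_xi_eta:
  assumes "x \<in> S3"
  shows "smult (x$1) (eta x) + smult (cnj (x$2)) (xi x) = 1"
  by (simp add: smult_xi_eta S3_sum_squares[OF assms] pCons_one)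

lemma pderiv_xi_eta: "pderiv (xi x) = [:x$1:]" "pderiv (eta x) = [:- cnj (x$2):]"
  by (simp_all add: xi_def eta_def pderiv_pCons)

lemma pderiv_xi_power: "pderiv (xi x ^ n) = of_nat n * smult (x$1) (xi x ^ (n - 1))"
  and pderiv_eta_power: "pderiv (eta x ^ n) = - (of_nat n * smult (cnj (x$2)) (eta x ^ (n - 1)))"
  by (simp_all add: pderiv_power pderiv_xi_eta of_nat_poly mult.commute)

lemma smult_eq_mult: "smult c P = [:c:] * P"
  by simp

lemma power_recombine:
  fixes s t A B :: "'a::comm_ring_1"
  shows "of_nat (p + 1) * (s * (A ^ p * B ^ q)) - of_nat q * (t * (A ^ (p + 1) * B ^ (q - 1)))
      + of_nat q * ((s * B + t * A) * (A ^ p * B ^ (q - 1))) = of_nat (p + q + 1) * (s * (A ^ p * B ^ q))"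
    and "of_nat p * ((s * B + t * A) * (A ^ (p - 1) * B ^ q))
      - (of_nat p * (s * (A ^ (p - 1) * B ^ (q + 1))) - of_nat (q + 1) * (t * (A ^ p * B ^ q)))
      = of_nat (p + q + 1) * (t * (A ^ p * B ^ q))"
  by (cases q; simp add: algebra_simps) (cases p; simp add: algebra_simps)

text \<open>Differentiating \<open>xi^(p+1) * eta^q\<close> in u brings out \<alpha> from
  \<open>xi\<close> and, unwanted, the conjugate of \<beta> from \<open>eta\<close>; adding
  \<open>q * xi^p * eta^(q-1)\<close>, multiplied by the unit of \<open>S3_smult_xi_eta\<close>,
  trades the latter for \<alpha>. Comparing coefficients splits the product with \<alpha> into
  wavenumbers one higher and one lower.\<close>

lemma coord1_hp:
  assumes x: "x \<in> S3"
  shows "of_nat (p + q + 1) * (x$1 * hp p q i x)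
    = of_nat (i + 1) * hp (p + 1) q (i + 1) x + of_nat q * hp p (q - 1) i x"
proof -
  let ?A = "xi x" and ?B = "eta x"
  have d: "pderiv (?A ^ (p + 1) * ?B ^ q)
      = of_nat (p + 1) * smult (x$1) (?A ^ p * ?B ^ q) - of_nat q * smult (cnj (x$2)) (?A ^ (p + 1) * ?B ^ (q - 1))"
    unfolding pderiv_mult pderiv_xi_power pderiv_eta_power by (simp add: algebra_simps)
  have "pderiv (?A ^ (p + 1) * ?B ^ q) + of_nat q * (?A ^ p * ?B ^ (q - 1))
      = of_nat (p + 1) * smult (x$1) (?A ^ p * ?B ^ q) - of_nat q * smult (cnj (x$2)) (?A ^ (p + 1) * ?B ^ (q - 1))
        + of_nat q * ((smult (x$1) ?B + smult (cnj (x$2)) ?A) * (?A ^ p * ?B ^ (q - 1)))"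
    unfolding d S3_smult_xi_eta[OF x] by simp
  also have "\<dots> = of_nat (p + q + 1) * smult (x$1) (?A ^ p * ?B ^ q)"
    unfolding smult_eq_mult by (rule power_recombine)
  finally have e: "pderiv (?A ^ (p + 1) * ?B ^ q) + of_nat q * (?A ^ p * ?B ^ (q - 1))
      = of_nat (p + q + 1) * smult (x$1) (?A ^ p * ?B ^ q)" .
  show ?thesis using arg_cong[OF e, of "\<lambda>P. coeff P i"]
    unfolding coeff_add coeff_pderiv coeff_of_nat_mult coeff_smult hp_def Suc_eq_plus1 by (rule sym)
qed

lemma cnj_coord2_hp:
  assumes x: "x \<in> S3"
  shows "of_nat (p + q + 1) * (cnj (x$2) * hp p q i x)
    = of_nat p * hp (p - 1) q i x - of_nat (i + 1) * hp p (q + 1) (i + 1) x"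
proof -
  let ?A = "xi x" and ?B = "eta x"
  have "pderiv (?A ^ p * ?B ^ (q + 1))
      = of_nat p * smult (x$1) (?A ^ (p - 1) * ?B ^ (q + 1)) - of_nat (q + 1) * smult (cnj (x$2)) (?A ^ p * ?B ^ q)"
    unfolding pderiv_mult pderiv_xi_power pderiv_eta_power by (simp add: algebra_simps)
  then have "of_nat p * (?A ^ (p - 1) * ?B ^ q) - pderiv (?A ^ p * ?B ^ (q + 1))
      = of_nat p * ((smult (x$1) ?B + smult (cnj (x$2)) ?A) * (?A ^ (p - 1) * ?B ^ q))
        - (of_nat p * smult (x$1) (?A ^ (p - 1) * ?B ^ (q + 1)) - of_nat (q + 1) * smult (cnj (x$2)) (?A ^ p * ?B ^ q))"
    by (simp add: S3_smult_xi_eta[OF x])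
  also have "\<dots> = of_nat (p + q + 1) * smult (cnj (x$2)) (?A ^ p * ?B ^ q)"
    unfolding smult_eq_mult by (rule power_recombine)
  finally have e: "of_nat p * (?A ^ (p - 1) * ?B ^ q) - pderiv (?A ^ p * ?B ^ (q + 1))
      = of_nat (p + q + 1) * smult (cnj (x$2)) (?A ^ p * ?B ^ q)" .
  show ?thesis using arg_cong[OF e, of "\<lambda>P. coeff P i"]
    unfolding coeff_diff coeff_pderiv coeff_of_nat_mult coeff_smult hp_def Suc_eq_plus1 by (rule sym)
qed

text \<open>Solved for the first term on the right, these reduce multiplication by \<beta> and by
  the conjugate of \<alpha> to the two coordinates already treated.\<close>

lemma hp_Suc:
  "hp (p + 1) q i x = x$2 * hp p q i x + (if i = 0 then 0 else x$1 * hp p q (i - 1) x)"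
  "hp p (q + 1) i x = cnj (x$1) * hp p q i x - (if i = 0 then 0 else cnj (x$2) * hp p q (i - 1) x)"
proof -
  have "xi x ^ (p + 1) * eta x ^ q = xi x * (xi x ^ p * eta x ^ q)" by (simp add: mult.assoc)
  then show "hp (p + 1) q i x = x$2 * hp p q i x + (if i = 0 then 0 else x$1 * hp p q (i - 1) x)"
    by (cases i) (simp_all add: hp_def xi_def)
  have "xi x ^ p * eta x ^ (q + 1) = eta x * (xi x ^ p * eta x ^ q)" by (simp add: mult_ac)
  then show "hp p (q + 1) i x = cnj (x$1) * hp p q i x - (if i = 0 then 0 else cnj (x$2) * hp p q (i - 1) x)"
    by (cases i) (simp_all add: hp_def eta_def)
qed

section \<open>Polynomials as multipliers of the span of the \<open>hp p q i\<close>\<close>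

definition hp_space :: "(complex^2 \<Rightarrow> complex) set" where
  "hp_space = fs.span (range (\<lambda>(p, q, i). restrS3 (hp p q i)))"

text \<open>Multipliers visibly form an algebra, so the whole polynomial algebra follows from
  \<alpha>, \<beta> and their conjugates, and products of two general \<open>hp\<close> are never
  expanded.\<close>

definition hp_multiplier :: "(complex^2 \<Rightarrow> complex) \<Rightarrow> bool" where
  "hp_multiplier g \<longleftrightarrow> (\<forall>f\<in>hp_space. (\<lambda>x. g x * f x) \<in> hp_space)"

lemma hp_in_space: "restrS3 (hp p q i) \<in> hp_space"
  unfolding hp_space_def by (rule fs.span_base) (auto intro: image_eqI[of _ _ "(p, q, i)"])

lemma hp_space_add: "f \<in> hp_space \<Longrightarrow> g \<in> hp_space \<Longrightarrow> f + g \<in> hp_space"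
  and hp_space_diff: "f \<in> hp_space \<Longrightarrow> g \<in> hp_space \<Longrightarrow> f - g \<in> hp_space"
  and hp_space_scale: "f \<in> hp_space \<Longrightarrow> fscale c f \<in> hp_space"
  and hp_space_0: "0 \<in> hp_space"
  unfolding hp_space_def by (rule fs.span_add fs.span_diff fs.span_scale fs.span_zero; assumption?)+

lemma hp_multiplierI:
  assumes "\<And>p q i. (\<lambda>x. g x * restrS3 (hp p q i) x) \<in> hp_space"
  shows "hp_multiplier g"
  unfolding hp_multiplier_def
proof
  fix f assume "f \<in> hp_space"
  then show "(\<lambda>x. g x * f x) \<in> hp_space"
    unfolding hp_space_def
  proof (induction rule: fs.span_induct_alt)
    case base
    have "(\<lambda>x. g x * 0 x) = (0 :: complex^2 \<Rightarrow> complex)" by auto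
    then show ?case using hp_space_0 by (simp add: hp_space_def)
  next
    case (step c h f)
    then obtain p q i where h: "h = restrS3 (hp p q i)" by auto
    have "(\<lambda>x. g x * (fscale c h + f) x) = fscale c (\<lambda>x. g x * h x) + (\<lambda>x. g x * f x)"
      by (auto simp: fscale_def algebra_simps)
    moreover have "(\<lambda>x. g x * h x) \<in> hp_space" unfolding h by (rule assms)
    ultimately show ?case
      using step hp_space_add[OF hp_space_scale] unfolding hp_space_def by auto
  qed
qed

lemma hp_multiplier_const: "hp_multiplier (\<lambda>x. c)"
  using hp_space_scale by (simp add: hp_multiplier_def fscale_def)

lemma hp_multiplier_add: "hp_multiplier f \<Longrightarrow> hp_multiplier g \<Longrightarrow> hp_multiplier (\<lambda>x. f x + g x)"
  using hp_space_add by (simp add: hp_multiplier_def distrib_right) (auto simp: plus_fun_def)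

lemma hp_multiplier_mult: "hp_multiplier f \<Longrightarrow> hp_multiplier g \<Longrightarrow> hp_multiplier (\<lambda>x. f x * g x)"
  by (simp add: hp_multiplier_def mult.assoc)

lemma hp_multiplier_coord:
  "hp_multiplier (\<lambda>x. x$1)" "hp_multiplier (\<lambda>x. x$2)"
  "hp_multiplier (\<lambda>x. cnj (x$1))" "hp_multiplier (\<lambda>x. cnj (x$2))"
proof -
  have nz: "complex_of_nat (p + q + 1) \<noteq> 0" for p q by (metis Suc_eq_plus1 of_nat_neq_0)
  show 1: "hp_multiplier (\<lambda>x. x$1)"
  proof (rule hp_multiplierI)
    fix p q i
    have "(\<lambda>x. x$1 * restrS3 (hp p q i) x)
      = fscale (of_nat (i + 1) / of_nat (p + q + 1)) (restrS3 (hp (p + 1) q (i + 1)))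
        + fscale (of_nat q / of_nat (p + q + 1)) (restrS3 (hp p (q - 1) i))"
      using coord1_hp[of _ p q i] nz[of p q]
      by (intro ext) (auto simp: fscale_def restrS3_def field_simps simp del: of_nat_add of_nat_Suc)
    then show "(\<lambda>x. x$1 * restrS3 (hp p q i) x) \<in> hp_space"
      by (auto intro!: hp_space_add hp_space_scale hp_in_space)
  qed
  show 4: "hp_multiplier (\<lambda>x. cnj (x$2))"
  proof (rule hp_multiplierI)
    fix p q i
    have "(\<lambda>x. cnj (x$2) * restrS3 (hp p q i) x)
      = fscale (of_nat p / of_nat (p + q + 1)) (restrS3 (hp (p - 1) q i))
        - fscale (of_nat (i + 1) / of_nat (p + q + 1)) (restrS3 (hp p (q + 1) (i + 1)))"
      using cnj_coord2_hp[of _ p q i] nz[of p q]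
      by (intro ext) (auto simp: fscale_def restrS3_def field_simps simp del: of_nat_add of_nat_Suc)
    then show "(\<lambda>x. cnj (x$2) * restrS3 (hp p q i) x) \<in> hp_space"
      by (auto intro!: hp_space_diff hp_space_scale hp_in_space)
  qed
  show "hp_multiplier (\<lambda>x. x$2)"
  proof (rule hp_multiplierI)
    fix p q i
    have "(\<lambda>x. x$2 * restrS3 (hp p q i) x) = restrS3 (hp (p + 1) q i)
      - (if i = 0 then 0 else (\<lambda>x. x$1 * restrS3 (hp p q (i - 1)) x))"
      using hp_Suc(1)[of p q i] by (intro ext) (auto simp: restrS3_def)
    moreover have "(\<lambda>x. x$1 * restrS3 (hp p q (i - 1)) x) \<in> hp_space"
      using 1 hp_in_space by (simp add: hp_multiplier_def)
    ultimately show "(\<lambda>x. x$2 * restrS3 (hp p q i) x) \<in> hp_space"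
      by (auto intro!: hp_space_diff hp_in_space hp_space_0)
  qed
  show "hp_multiplier (\<lambda>x. cnj (x$1))"
  proof (rule hp_multiplierI)
    fix p q i
    have "(\<lambda>x. cnj (x$1) * restrS3 (hp p q i) x) = restrS3 (hp p (q + 1) i)
      + (if i = 0 then 0 else (\<lambda>x. cnj (x$2) * restrS3 (hp p q (i - 1)) x))"
      using hp_Suc(2)[of p q i] by (intro ext) (auto simp: restrS3_def)
    moreover have "(\<lambda>x. cnj (x$2) * restrS3 (hp p q (i - 1)) x) \<in> hp_space"
      using 4 hp_in_space by (simp add: hp_multiplier_def)
    ultimately show "(\<lambda>x. cnj (x$1) * restrS3 (hp p q i) x) \<in> hp_space"
      by (auto intro!: hp_space_add hp_in_space hp_space_0)
  qed
qed

text \<open>Bounded linear functionals are a base case of \<open>real_polynomial_function\<close>;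
  real and imaginary parts of the coordinates are recovered from \<alpha>, \<beta> and their
  conjugates.\<close>

lemma hp_multiplier_linear:
  assumes "bounded_linear (f :: complex^2 \<Rightarrow> real)"
  shows "hp_multiplier (\<lambda>x. of_real (f x))"
proof -
  have eq: "complex_of_real (f x) =
      (of_real (f ex) / 2) * (x$1 + cnj (x$1)) + (- \<i> * of_real (f ey) / 2) * (x$1 + (-1) * cnj (x$1))
    + ((of_real (f ez) / 2) * (x$2 + cnj (x$2)) + (- \<i> * of_real (f ew) / 2) * (x$2 + (-1) * cnj (x$2)))" for x
  proof -
    have "f x = f (\<Sum>b\<in>Basis. (x \<bullet> b) *\<^sub>R b)" by (simp add: euclidean_representation)
    also have "\<dots> = Re (x$1) * f ex + Im (x$1) * f ey + Re (x$2) * f ez + Im (x$2) * f ew"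
      using bounded_linear.linear[OF assms]
      by (simp add: sum_Basis_complex2 inner_coord linear_add linear_scale)
    finally show ?thesis by (simp add: complex_eq_iff)
  qed
  show ?thesis
    by (subst eq) (intro hp_multiplier_add hp_multiplier_mult hp_multiplier_const hp_multiplier_coord)
qed

lemma hp_space_polynomial:
  assumes "real_polynomial_function g"
  shows "restrS3 (\<lambda>x. of_real (g x)) \<in> hp_space"
proof -
  have "hp_multiplier (\<lambda>x. of_real (g x))"
    using assms
    by induction (simp_all add: hp_multiplier_linear hp_multiplier_const hp_multiplier_add hp_multiplier_mult)
  \<comment> \<open>\<open>hp 0 0 0\<close> is the constant 1, so the multiplier applied to it
    returns the polynomial.\<close>
  then have "(\<lambda>x. of_real (g x) * restrS3 (hp 0 0 0) x) \<in> hp_space"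
    using hp_in_space by (simp add: hp_multiplier_def)
  moreover have "(\<lambda>x. of_real (g x) * restrS3 (hp 0 0 0) x) = restrS3 (\<lambda>x. of_real (g x))"
    by (auto simp: restrS3_def hp_def)
  ultimately show ?thesis by simp
qed

section \<open>Completeness\<close>

lemma hp_eigenfunction:
  "S3_fun (restrS3 (hp p q i))"
  "x \<in> S3 \<Longrightarrow> lapS3 (restrS3 (hp p q i)) x = - of_nat ((p + q) * (p + q + 2)) * restrS3 (hp p q i) x"
  using hp_sum_eigenfunction[where A = "{()}" and p = "\<lambda>_. p" and q = "\<lambda>_. q" and k = "p + q"
      and c = "\<lambda>_. 1" and i = "\<lambda>_. i"] by simp_all

lemma sint_orthogonal_span:
  assumes D: "continuous_on S3 D"
    and B: "\<And>g. g \<in> B \<Longrightarrow> continuous_on S3 g" "\<And>g. g \<in> B \<Longrightarrow> sint (\<lambda>x. D x * cnj (g x)) = 0"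
    and f: "f \<in> fs.span B"
  shows "continuous_on S3 f" "sint (\<lambda>x. D x * cnj (f x)) = 0"
proof -
  have "continuous_on S3 f \<and> sint (\<lambda>x. D x * cnj (f x)) = 0"
    using f
  proof (induction rule: fs.span_induct_alt)
    case base
    show ?case using sint_cmult[of 0 "\<lambda>x. 0"] by (simp add: zero_fun_def)
  next
    case (step c g f)
    have cg: "continuous_on S3 g" by (rule B(1)[OF step(1)])
    have cf: "continuous_on S3 f" using step(2) by simp
    have eq: "(\<lambda>x. D x * cnj ((fscale c g + f) x)) = (\<lambda>x. cnj c * (D x * cnj (g x)) + D x * cnj (f x))"
      by (auto simp: fscale_def algebra_simps)
    have "sint (\<lambda>x. D x * cnj ((fscale c g + f) x)) = sint (\<lambda>x. cnj c * (D x * cnj (g x))) + sint (\<lambda>x. D x * cnj (f x))"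
      unfolding eq by (intro sint_add continuous_intros D cf cg)
    also have "\<dots> = 0" using step(2) B(2)[OF step(1)] by (simp add: sint_cmult)
    finally show ?case
      using cf cg by (auto simp: fscale_def plus_fun_def intro!: continuous_intros)
  qed
  then show "continuous_on S3 f" "sint (\<lambda>x. D x * cnj (f x)) = 0" by auto
qed

lemma continuous_on_span:
  assumes "\<And>g. g \<in> B \<Longrightarrow> continuous_on S3 g" "f \<in> fs.span B"
  shows "continuous_on S3 f"
  by (rule sint_orthogonal_span(1)[of "\<lambda>x. 0", OF _ assms(1) _ assms(2)])
     (use sint_cmult[of 0 "\<lambda>x. 0"] in auto)

text \<open>Gram-Schmidt by induction on \<open>B\<close>: project \<open>F\<close> and the new
  vector \<open>b\<close> onto the span of the rest, then correct along the residue \<open>r\<close>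
  of \<open>b\<close>. If \<open>r\<close> has norm 0, it vanishes on \<open>S3\<close> and there is
  nothing to correct, so \<open>B\<close> may be dependent.\<close>

lemma sint_orthogonal_projection:
  assumes "finite B" "\<And>g. g \<in> B \<Longrightarrow> continuous_on S3 g" "continuous_on S3 F"
  shows "\<exists>f\<in>fs.span B. \<forall>g\<in>B. sint (\<lambda>x. (F x - f x) * cnj (g x)) = 0"
  using assms
proof (induction B arbitrary: F rule: finite_induct)
  case empty
  then show ?case by (auto intro: fs.span_zero)
next
  case (insert b B)
  have cB: "continuous_on S3 g" if "g \<in> B" for g using insert.prems(1) that by auto
  have cb: "continuous_on S3 b" using insert.prems(1) by auto
  obtain f0 where f0: "f0 \<in> fs.span B" "\<And>g. g \<in> B \<Longrightarrow> sint (\<lambda>x. (F x - f0 x) * cnj (g x)) = 0"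
    using insert.IH[OF cB insert.prems(2)] by blast
  obtain b0 where b0: "b0 \<in> fs.span B" "\<And>g. g \<in> B \<Longrightarrow> sint (\<lambda>x. (b x - b0 x) * cnj (g x)) = 0"
    using insert.IH[OF cB cb] by blast
  define r where "r = b - b0"
  have cf0: "continuous_on S3 f0" and cb0: "continuous_on S3 b0"
    using continuous_on_span[OF cB] f0(1) b0(1) by auto
  have r: "r x = b x - b0 x" for x by (simp add: r_def)
  have cr: "continuous_on S3 r" unfolding r[abs_def] r_def
    using cb cb0 by (simp add: fun_diff_def continuous_on_diff)
  have span_B: "fs.span B \<subseteq> fs.span (insert b B)" by (rule fs.span_mono) auto
  have rs: "r \<in> fs.span (insert b B)"
    unfolding r_def using subsetD[OF span_B b0(1)] by (intro fs.span_diff) (simp_all add: fs.span_base)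
  define c where "c = sint (\<lambda>x. (F x - f0 x) * cnj (r x)) / sint (\<lambda>x. r x * cnj (r x))"
  define f where "f = f0 + fscale c r"
  have fx: "f x = f0 x + c * r x" for x by (simp add: f_def fscale_def)
  have cf: "continuous_on S3 f"
    unfolding f_def fscale_def plus_fun_def by (intro continuous_intros cf0 cr)
  have split: "sint (\<lambda>x. (F x - f x) * cnj (g x))
      = sint (\<lambda>x. (F x - f0 x) * cnj (g x)) - c * sint (\<lambda>x. r x * cnj (g x))"
    if "continuous_on S3 g" for g
  proof -
    have "sint (\<lambda>x. (F x - f x) * cnj (g x))
        = sint (\<lambda>x. (F x - f0 x) * cnj (g x) - c * (r x * cnj (g x)))"
      by (rule sint_cong) (simp add: fx algebra_simps)
    also have "\<dots> = sint (\<lambda>x. (F x - f0 x) * cnj (g x)) - sint (\<lambda>x. c * (r x * cnj (g x)))"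
      by (intro sint_diff continuous_intros insert.prems(2) cf0 cr that)
    finally show ?thesis by (simp only: sint_cmult)
  qed
  have orB: "sint (\<lambda>x. (F x - f x) * cnj (g x)) = 0" if g: "g \<in> B" for g
    using split[OF cB[OF g]] f0(2)[OF g] b0(2)[OF g] by (simp add: r)
  have orb0: "sint (\<lambda>x. (F x - f x) * cnj (b0 x)) = 0"
    by (rule sint_orthogonal_span(2)[OF _ cB orB b0(1)])
       (intro continuous_intros insert.prems(2) cf)
  have orr: "sint (\<lambda>x. (F x - f x) * cnj (r x)) = 0"
  proof (cases "sint (\<lambda>x. r x * cnj (r x)) = 0")
    case True
    then have "r x = 0" if "x \<in> S3" for x using sint_norm_eq_0[OF cr True that] by simp
    then have "sint (\<lambda>x. (F x - f x) * cnj (r x)) = sint (\<lambda>x. 0 * 0)"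
      by (intro sint_cong) simp
    then show ?thesis using sint_cmult[of 0 "\<lambda>x. 0"] by simp
  next
    case False
    then show ?thesis using split[OF cr] by (simp add: c_def)
  qed
  have "sint (\<lambda>x. (F x - f x) * cnj (b x))
      = sint (\<lambda>x. (F x - f x) * cnj (r x) + (F x - f x) * cnj (b0 x))"
    by (rule sint_cong) (simp add: r algebra_simps)
  also have "\<dots> = sint (\<lambda>x. (F x - f x) * cnj (r x)) + sint (\<lambda>x. (F x - f x) * cnj (b0 x))"
    by (intro sint_add continuous_intros insert.prems(2) cf cr cb0)
  finally have "sint (\<lambda>x. (F x - f x) * cnj (b x)) = 0" by (simp add: orr orb0)
  moreover have "f \<in> fs.span (insert b B)"
    unfolding f_def using f0(1) span_B rs by (intro fs.span_add fs.span_scale) auto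
  ultimately show ?case using orB by blast
qed

text \<open>If \<open>g\<close> approximates \<open>D\<close> within \<open>2 * e\<close>, the
  squared norm of \<open>D\<close> equals the inner product of \<open>D\<close> with
  \<open>D - g\<close> and is of order \<open>e\<close>. Real and imaginary parts are approximated
  separately.\<close>

lemma hp_space_dense:
  assumes D: "continuous_on S3 D" and orth: "\<And>g. g \<in> hp_space \<Longrightarrow> sint (\<lambda>x. D x * cnj (g x)) = 0"
    and x: "x \<in> S3"
  shows "D x = 0"
proof -
  obtain B where B: "B > 0" "\<And>x. x \<in> S3 \<Longrightarrow> norm (D x) \<le> B" using S3_bounded_image[OF D] by blast
  define V where "V = measure sphere_measure (UNIV :: (complex^2) set)"
  have V: "V \<ge> 0" by (simp add: V_def)
  have bound: "norm (sint (\<lambda>x. D x * cnj (D x))) \<le> e * (2 * B * V)" if e: "e > 0" for e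
  proof -
    have cRe: "continuous_on S3 (\<lambda>x. Re (D x))" and cIm: "continuous_on S3 (\<lambda>x. Im (D x))"
      by (intro continuous_intros D)+
    obtain g1 where g1: "real_polynomial_function g1" "\<And>x. x \<in> S3 \<Longrightarrow> \<bar>Re (D x) - g1 x\<bar> < e"
      using Stone_Weierstrass_real_polynomial_function[OF compact_S3 cRe e] by blast
    obtain g2 where g2: "real_polynomial_function g2" "\<And>x. x \<in> S3 \<Longrightarrow> \<bar>Im (D x) - g2 x\<bar> < e"
      using Stone_Weierstrass_real_polynomial_function[OF compact_S3 cIm e] by blast
    define g where "g = restrS3 (\<lambda>x. of_real (g1 x)) + fscale \<i> (restrS3 (\<lambda>x. of_real (g2 x)))"
    have gW: "g \<in> hp_space"
      unfolding g_def by (intro hp_space_add hp_space_scale hp_space_polynomial g1 g2)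
    have gx: "g x = Complex (g1 x) (g2 x)" if "x \<in> S3" for x
      using that by (simp add: g_def fscale_def restrS3_def complex_eq_iff)
    have cg: "continuous_on S3 g"
      using gW unfolding hp_space_def
      by (rule continuous_on_span[rotated]) (auto intro: S3_fun_continuous hp_eigenfunction)
    have near: "norm (D x - g x) \<le> 2 * e" if "x \<in> S3" for x
      using cmod_le[of "D x - g x"] g1(2)[OF that] g2(2)[OF that] by (simp add: gx[OF that])
    have "sint (\<lambda>x. D x * cnj (D x)) = sint (\<lambda>x. D x * cnj (D x - g x) + D x * cnj (g x))"
      by (rule sint_cong) (simp add: algebra_simps)
    also have "\<dots> = sint (\<lambda>x. D x * cnj (D x - g x)) + sint (\<lambda>x. D x * cnj (g x))"
      by (intro sint_add continuous_intros D cg)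
    finally have "sint (\<lambda>x. D x * cnj (D x)) = sint (\<lambda>x. D x * cnj (D x - g x))"
      by (simp add: orth[OF gW])
    also have "norm \<dots> \<le> (B * (2 * e)) * V"
      unfolding V_def
    proof (rule norm_sint_le)
      show "continuous_on S3 (\<lambda>x. D x * cnj (D x - g x))" by (intro continuous_intros D cg)
      show "norm (D x * cnj (D x - g x)) \<le> B * (2 * e)" if "x \<in> S3" for x
        unfolding norm_mult complex_mod_cnj
        using B near[OF that] that e by (intro mult_mono) auto
      show "0 \<le> B * (2 * e)" using B e by simp
    qed
    finally show ?thesis by (simp add: mult_ac)
  qed
  have "norm (sint (\<lambda>x. D x * cnj (D x))) \<le> 0"
  proof (rule field_le_epsilon)
    fix e :: real assume e: "e > 0"
    \<comment> \<open>Adding 1 keeps the divisor positive without a lower bound on the total mass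
      \<open>V\<close>.\<close>
    have p: "2 * B * V + 1 > 0" using B V by (simp add: add_nonneg_pos)
    have "norm (sint (\<lambda>x. D x * cnj (D x))) \<le> e / (2 * B * V + 1) * (2 * B * V)"
      using e p by (intro bound) simp
    also have "\<dots> \<le> e" using e p B V by (simp add: field_simps)
    finally show "norm (sint (\<lambda>x. D x * cnj (D x))) \<le> 0 + e" by simp
  qed
  then show ?thesis using sint_norm_eq_0[OF D _ x] by simp
qed

definition eigen_basis :: "nat \<Rightarrow> (complex^2 \<Rightarrow> complex) set" where
  "eigen_basis k = (\<lambda>(q, i). restrS3 (hp (k - q) q i)) ` ({..k} \<times> {..k})"

lemma hp_degree_zero: "i > p + q \<Longrightarrow> hp p q i x = 0"
proof -
  assume i: "i > p + q"
  have "degree (xi x ^ p * eta x ^ q) \<le> degree (xi x ^ p) + degree (eta x ^ q)" by (rule degree_mult_le)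
  also have "\<dots> \<le> degree (xi x) * p + degree (eta x) * q" by (intro add_mono degree_power_le)
  also have "\<dots> \<le> 1 * p + 1 * q"
    by (intro add_mono mult_right_mono) (auto simp: xi_def eta_def)
  finally show ?thesis unfolding hp_def using i by (intro coeff_eq_0) simp
qed

text \<open>The difference of \<open>F\<close> and its projection \<open>f\<close> is orthogonal to
  every \<open>hp p q i\<close>: by construction when \<open>p + q = k\<close>, and by distinct
  eigenvalues otherwise. Density forces it to vanish on \<open>S3\<close>, and off \<open>S3\<close>
  both functions are 0.\<close>

lemma eigenfunction_in_span:
  assumes F: "S3_fun F" "\<And>x. x \<in> S3 \<Longrightarrow> lapS3 F x = - of_nat (k * (k + 2)) * F x"
  shows "F \<in> fs.span (eigen_basis k)"
proof -
  have fin: "finite (eigen_basis k)" by (simp add: eigen_basis_def)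
  have cb: "continuous_on S3 g" if "g \<in> eigen_basis k" for g
    using that by (auto simp: eigen_basis_def intro: S3_fun_continuous hp_eigenfunction)
  have cF: "continuous_on S3 F" by (rule S3_fun_continuous[OF F(1)])
  obtain f where f: "f \<in> fs.span (eigen_basis k)"
    "\<And>g. g \<in> eigen_basis k \<Longrightarrow> sint (\<lambda>x. (F x - f x) * cnj (g x)) = 0"
    using sint_orthogonal_projection[OF fin cb cF] by blast
  have cf: "continuous_on S3 f" by (rule continuous_on_span[OF cb f(1)])
  obtain c where c: "f = (\<Sum>a\<in>{..k} \<times> {..k}. fscale (c a) ((\<lambda>(q, i). restrS3 (hp (k - q) q i)) a))"
    using span_image_sum[OF _ f(1)[unfolded eigen_basis_def]] by blast
  have "f = restrS3 (\<lambda>x. \<Sum>a\<in>{..k} \<times> {..k}. c a * hp (k - fst a) (fst a) (snd a) x)"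
    unfolding c restrS3_sum[symmetric] by (rule sum.cong) auto
  then have fe: "S3_fun f" "\<And>x. x \<in> S3 \<Longrightarrow> lapS3 f x = - of_nat (k * (k + 2)) * f x"
    using hp_sum_eigenfunction[where A = "{..k} \<times> {..k}" and p = "\<lambda>a. k - fst a" and q = fst
      and k = k and c = c and i = snd] by auto
  have orth: "sint (\<lambda>x. (F x - f x) * cnj (restrS3 (hp p q i) x)) = 0" for p q i
  proof (cases "p + q = k")
    case True
    show ?thesis
    proof (cases "i \<le> k")
      case i: True
      have "restrS3 (hp p q i) \<in> eigen_basis k"
        unfolding eigen_basis_def using True i by (intro image_eqI[of _ _ "(q, i)"]) auto
      then show ?thesis by (rule f(2))
    next
      case False
      then have "restrS3 (hp p q i) x = 0" for x using hp_degree_zero[of p q i] True by (simp add: restrS3_def)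
      then show ?thesis using sint_cmult[of 0 "\<lambda>x. 0"] by simp
    qed
  next
    case False
    \<comment> \<open>Strict growth of \<open>n * (n + 2)\<close> makes the eigenvalues of different
      degrees distinct.\<close>
    have "strict_mono (\<lambda>n::nat. n * (n + 2))" by (intro strict_monoI mult_strict_mono) auto
    then have "(p + q) * (p + q + 2) \<noteq> k * (k + 2)" using False by (metis strict_mono_eq)
    then have "- complex_of_nat (k * (k + 2)) \<noteq> cnj (- of_nat ((p + q) * (p + q + 2)))"
      by (metis complex_cnj_minus complex_cnj_of_nat neg_equal_iff_equal of_nat_eq_iff)
    note o = sint_eigenfunctions_orthogonal[OF _ _ hp_eigenfunction[where p = p and q = q and i = i] this]
    have ch: "continuous_on S3 (restrS3 (hp p q i))" by (intro S3_fun_continuous hp_eigenfunction)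
    have "sint (\<lambda>x. F x * cnj (restrS3 (hp p q i) x)) = 0" by (rule o[OF F])
    moreover have "sint (\<lambda>x. f x * cnj (restrS3 (hp p q i) x)) = 0" by (rule o[OF fe])
    moreover have "sint (\<lambda>x. (F x - f x) * cnj (restrS3 (hp p q i) x))
      = sint (\<lambda>x. F x * cnj (restrS3 (hp p q i) x)) - sint (\<lambda>x. f x * cnj (restrS3 (hp p q i) x))"
      unfolding left_diff_distrib by (intro sint_diff continuous_intros cF cf ch)
    ultimately show ?thesis by simp
  qed
  have "F x = f x" if x: "x \<in> S3" for x
  proof -
    have "F x - f x = 0"
    proof (rule hp_space_dense[OF _ _ x])
      show cD: "continuous_on S3 (\<lambda>x. F x - f x)" by (intro continuous_intros cF cf)
      show "sint (\<lambda>x. (F x - f x) * cnj (g x)) = 0" if "g \<in> hp_space" for g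
        using that unfolding hp_space_def
        by (rule sint_orthogonal_span(2)[OF cD, rotated 2])
           (auto intro: orth S3_fun_continuous hp_eigenfunction)
    qed
    then show ?thesis by simp
  qed
  moreover have "F x = f x" if "x \<notin> S3" for x
    using F(1) fe(1) that by (simp add: S3_fun_def)
  ultimately have "F = f" by blast
  then show ?thesis using f(1) by simp
qed

section \<open>Invariance under the binary dihedral group\<close>

definition swap :: "complex^2 \<Rightarrow> complex^2" where "swap x = pt (\<i> * x$2) (\<i> * x$1)"
definition rot :: "complex \<Rightarrow> complex^2 \<Rightarrow> complex^2" where "rot w x = pt (w * x$1) (cnj w * x$2)"

lemma mat2_mult_vec: "mat2 a b c d *v x = pt (a * x$1 + b * x$2) (c * x$1 + d * x$2)"
  by (simp add: mat2_def matrix_vector_mult_def vec2_eq_iff sum_2)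

lemma mat2_mult: "mat2 a b c d ** mat2 a' b' c' d'
    = mat2 (a * a' + b * c') (a * b' + b * d') (c * a' + d * c') (c * b' + d * d')"
  by (simp add: mat2_def matrix_matrix_mult_def vec2_eq_iff sum_2)

lemma mat2_one: "mat 1 = mat2 1 0 0 1"
  by (simp add: mat2_def mat_def vec2_eq_iff)

lemma S3_iff: "x \<in> S3 \<longleftrightarrow> (cmod (x$1))\<^sup>2 + (cmod (x$2))\<^sup>2 = 1"
proof -
  have "norm x = 1 \<longleftrightarrow> (norm x)\<^sup>2 = 1" by (simp add: power2_eq_1_iff) (use norm_ge_zero[of x] in linarith)
  then show ?thesis by (simp add: S3_def norm_vec2)
qed

lemma swap_S3 [simp]: "swap x \<in> S3 \<longleftrightarrow> x \<in> S3"
  by (simp add: S3_iff swap_def norm_mult add.commute)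

lemma rot_S3 [simp]: "cmod w = 1 \<Longrightarrow> rot w x \<in> S3 \<longleftrightarrow> x \<in> S3"
  by (simp add: S3_iff rot_def norm_mult)

text \<open>Invariance under a generator and under its inverse are equivalent, which removes
  \<open>matrix_inv\<close>. The induction over the group carries an explicit two-sided inverse and
  the fact that it preserves \<open>S3\<close>, as the product case requires.\<close>

lemma modes_binary_dihedral_iff:
  fixes m :: nat
  defines "w \<equiv> cis (pi / m)"
  shows "F \<in> modes (binary_dihedral m) k \<longleftrightarrow> S3_fun F \<and>
    (\<forall>x\<in>S3. lapS3 F x = - of_nat (k * (k + 2)) * F x) \<and>
    (\<forall>x\<in>S3. F (swap x) = F x) \<and> (\<forall>x\<in>S3. F (rot w x) = F x)"
    (is "?L \<longleftrightarrow> ?R")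
proof -
  have w: "cmod w = 1" "cis (- pi / m) = cnj w" by (simp_all add: w_def cis_cnj)
  have ww: "w * cnj w = 1" by (metis complex_norm_square of_real_1 power_one w(1))
  have inv: "matrix_inv A = A'" if "A ** A' = mat 1" "A' ** A = mat 1" for A A' :: "complex^2^2"
  proof -
    have "A ** matrix_inv A = mat 1 \<and> matrix_inv A ** A = mat 1"
      unfolding matrix_inv_def by (rule someI[of _ A']) (use that in simp)
    then show ?thesis by (metis matrix_mul_assoc matrix_mul_lid matrix_mul_rid that(2))
  qed
  have i1: "mat2 0 \<i> \<i> 0 ** mat2 0 (-\<i>) (-\<i>) 0 = mat 1" "mat2 0 (-\<i>) (-\<i>) 0 ** mat2 0 \<i> \<i> 0 = mat 1"
    by (simp_all add: mat2_mult mat2_one)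
  have i2: "mat2 w 0 0 (cnj w) ** mat2 (cnj w) 0 0 w = mat 1" "mat2 (cnj w) 0 0 w ** mat2 w 0 0 (cnj w) = mat 1"
    using ww by (simp_all add: mat2_mult mat2_one mult.commute)
  show ?thesis
  proof
    assume L: ?L
    have "F (swap x) = F x" if x: "x \<in> S3" for x
    proof -
      have "Ract (mat2 0 \<i> \<i> 0) F (swap x) = F (swap x)"
        using L x by (simp add: modes_def binary_dihedral.gen1)
      moreover have "mat2 0 (-\<i>) (-\<i>) 0 *v swap x = x" by (simp add: mat2_mult_vec swap_def vec2_eq_iff)
      ultimately show ?thesis by (simp add: Ract_def inv[OF i1])
    qed
    moreover have "F (rot w x) = F x" if x: "x \<in> S3" for x
    proof -
      have "Ract (mat2 w 0 0 (cnj w)) F (rot w x) = F (rot w x)"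
        using L x w binary_dihedral.gen2[of m] by (simp add: modes_def w_def)
      moreover have "mat2 (cnj w) 0 0 w *v rot w x = x"
        using ww by (simp add: mat2_mult_vec rot_def vec2_eq_iff mult.assoc[symmetric] mult.commute[of "cnj w" w])
      ultimately show ?thesis by (simp add: Ract_def inv[OF i2])
    qed
    ultimately show ?R using L by (simp add: modes_def)
  next
    assume R: ?R
    have "\<exists>g'. g ** g' = mat 1 \<and> g' ** g = mat 1 \<and> (\<forall>x\<in>S3. g' *v x \<in> S3 \<and> F (g' *v x) = F x)"
      if "g \<in> binary_dihedral m" for g
      using that
    proof induction
      case one
      show ?case by (intro exI[of _ "mat 1"]) simp
    next
      case gen1
      have "mat2 0 (-\<i>) (-\<i>) 0 *v x \<in> S3 \<and> F (mat2 0 (-\<i>) (-\<i>) 0 *v x) = F x" if x: "x \<in> S3" for x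
      proof -
        let ?y = "mat2 0 (-\<i>) (-\<i>) 0 *v x"
        have sy: "swap ?y = x" by (simp add: mat2_mult_vec swap_def vec2_eq_iff)
        then have "?y \<in> S3" using x swap_S3[of ?y] by simp
        then show ?thesis using R sy by metis
      qed
      then show ?case using i1 by blast
    next
      case gen2
      have "mat2 (cnj w) 0 0 w *v x \<in> S3 \<and> F (mat2 (cnj w) 0 0 w *v x) = F x" if x: "x \<in> S3" for x
      proof -
        let ?y = "mat2 (cnj w) 0 0 w *v x"
        have sy: "rot w ?y = x"
          using ww by (simp add: mat2_mult_vec rot_def vec2_eq_iff mult.assoc[symmetric] mult.commute[of "cnj w" w])
        then have "?y \<in> S3" using x rot_S3[OF w(1), of ?y] by simp
        then show ?thesis using R sy by metis
      qed
      then show ?case using i2 w by (auto simp: w_def)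
    next
      case (mult g h)
      then obtain g' h' where g': "g ** g' = mat 1" "g' ** g = mat 1" "\<forall>x\<in>S3. g' *v x \<in> S3 \<and> F (g' *v x) = F x"
        and h': "h ** h' = mat 1" "h' ** h = mat 1" "\<forall>x\<in>S3. h' *v x \<in> S3 \<and> F (h' *v x) = F x" by blast
      have "(g ** h) ** (h' ** g') = mat 1" "(h' ** g') ** (g ** h) = mat 1"
        by (metis g'(1) h'(1) matrix_mul_assoc matrix_mul_rid, metis g'(2) h'(2) matrix_mul_assoc matrix_mul_rid)
      moreover have "\<forall>x\<in>S3. (h' ** g') *v x \<in> S3 \<and> F ((h' ** g') *v x) = F x"
        using g'(3) h'(3) by (simp add: matrix_vector_mul_assoc[symmetric])
      ultimately show ?case by blast
    qed
    then have "Ract g F x = F x" if "g \<in> binary_dihedral m" "x \<in> S3" for g x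
      using inv that unfolding Ract_def by metis
    then show ?L using R by (simp add: modes_def)
  qed
qed

lemma pcompose_power: "pcompose (p ^ n) q = pcompose p q ^ n" for p q :: "'a::comm_semiring_1 poly"
  by (induction n) (simp_all add: pcompose_mult pcompose_1)

text \<open>Up to the common factor \<open>cnj w\<close>, \<open>rot w\<close> replaces u by
  \<open>w^2 u\<close> in both linear polynomials.\<close>

lemma hp_rot:
  assumes "cmod w = 1"
  shows "hp p q i (rot w x) = cnj w ^ (p + q) * (w\<^sup>2) ^ i * hp p q i x"
proof -
  have ww: "cnj w * w = 1" by (metis assms complex_norm_square mult.commute of_real_1 power_one)
  then have ww2: "cnj w * w\<^sup>2 = w" by (simp add: power2_eq_square mult.assoc[symmetric])
  have 1: "xi (rot w x) = smult (cnj w) (pcompose (xi x) [:0, w\<^sup>2:])"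
    using ww2 by (simp add: xi_def rot_def pcompose_pCons mult.assoc[symmetric])
  have 2: "eta (rot w x) = smult (cnj w) (pcompose (eta x) [:0, w\<^sup>2:])"
    using ww2 by (simp add: eta_def rot_def pcompose_pCons mult.assoc[symmetric])
  have "xi (rot w x) ^ p * eta (rot w x) ^ q
      = smult (cnj w ^ (p + q)) (pcompose (xi x ^ p * eta x ^ q) [:0, w\<^sup>2:])"
    unfolding 1 2 by (simp add: smult_power pcompose_mult pcompose_power power_add mult.commute)
  then show ?thesis by (simp add: hp_def coeff_pcompose_linear)
qed

text \<open>Exchanging the two variables of a binary form of formal degree \<open>p + q\<close>
  reverses its coefficients. Working with the formal degree admits vanishing leading coefficients;
  the degree bounds settle the two end positions.\<close>

lemma coeff_linear_power_reverse:
  fixes a b c d :: "'a::comm_ring_1"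
  shows "i + j = p + q \<Longrightarrow> coeff ([:a, b:] ^ p * [:c, d:] ^ q) i = coeff ([:b, a:] ^ p * [:d, c:] ^ q) j"
proof -
  have step: "coeff ([:a, b:] * R) i = coeff ([:b, a:] * R') j"
    if R: "\<And>i j. i + j = k \<Longrightarrow> coeff R i = coeff R' j" and d: "degree R \<le> k" "degree R' \<le> k"
      and ij: "i + j = Suc k" for R R' :: "'a poly" and a b i j k
  proof (cases i)
    case 0
    then have "coeff R' j = 0" using ij d by (intro coeff_eq_0) simp
    then show ?thesis using 0 ij R[of 0 k] by simp
  next
    case i: (Suc i')
    show ?thesis
    proof (cases j)
      case 0
      then have "coeff R i = 0" using ij d by (intro coeff_eq_0) simp
      then show ?thesis using 0 i ij R[of i' 0] by simp
    next
      case (Suc j')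
      then show ?thesis using i ij R[of i' j] R[of i j'] by (simp add: add.commute)
    qed
  qed
  have deg: "degree ([:a, b:] ^ p * [:c, d:] ^ q) \<le> p + q" for a b c d :: 'a and p q
  proof -
    have "degree ([:a, b:] ^ p * [:c, d:] ^ q) \<le> degree ([:a, b:] ^ p) + degree ([:c, d:] ^ q)"
      by (rule degree_mult_le)
    also have "\<dots> \<le> degree [:a, b:] * p + degree [:c, d:] * q" by (intro add_mono degree_power_le)
    also have "\<dots> \<le> 1 * p + 1 * q" by (intro add_mono mult_right_mono) auto
    finally show ?thesis by simp
  qed
  show ?thesis if "i + j = p + q"
    using that
  proof (induction p arbitrary: i j)
    case 0
    then show ?case
    proof (induction q arbitrary: i j)
      case 0
      then show ?case by simp
    next
      case (Suc q)
      have "coeff ([:c, d:] * [:c, d:] ^ q) i = coeff ([:d, c:] * [:d, c:] ^ q) j"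
        using Suc deg[of 1 0 0 c d q] deg[of 1 0 0 d c q] by (intro step[of q]) auto
      then show ?case by simp
    qed
  next
    case (Suc p)
    have "coeff ([:a, b:] * ([:a, b:] ^ p * [:c, d:] ^ q)) i = coeff ([:b, a:] * ([:b, a:] ^ p * [:d, c:] ^ q)) j"
      using Suc deg by (intro step[of "p + q"]) auto
    then show ?case by (simp only: power_Suc mult.assoc)
  qed
qed

lemma hp_swap:
  assumes "i \<le> p + q"
  shows "hp p q i (swap x) = \<i> ^ (p + q) * hp p q (p + q - i) x"
proof -
  have 1: "xi (swap x) = smult \<i> [:x$1, x$2:]" by (simp add: xi_def swap_def)
  have 2: "eta (swap x) = smult \<i> [:- cnj (x$2), cnj (x$1):]" by (simp add: eta_def swap_def)
  have "xi (swap x) ^ p * eta (swap x) ^ q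
      = smult (\<i> ^ (p + q)) ([:x$1, x$2:] ^ p * [:- cnj (x$2), cnj (x$1):] ^ q)"
    unfolding 1 2 by (simp add: smult_power power_add mult.commute del: smult_pCons)
  then have "hp p q i (swap x) = \<i> ^ (p + q) * coeff ([:x$1, x$2:] ^ p * [:- cnj (x$2), cnj (x$1):] ^ q) i"
    by (simp add: hp_def)
  also have "coeff ([:x$1, x$2:] ^ p * [:- cnj (x$2), cnj (x$1):] ^ q) i = hp p q (p + q - i) x"
    unfolding hp_def xi_def eta_def by (rule coeff_linear_power_reverse) (use assms in simp)
  finally show ?thesis .
qed

lemma hp_uminus: "hp p q i (- x) = (-1) ^ (p + q) * hp p q i x"
proof -
  have "xi (- x) = smult (-1) (xi x)" "eta (- x) = smult (-1) (eta x)" by (simp_all add: xi_def eta_def)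
  then have "xi (- x) ^ p * eta (- x) ^ q = smult ((-1) ^ (p + q)) (xi x ^ p * eta x ^ q)"
    by (simp only: smult_power mult_smult_left mult_smult_right smult_smult power_add mult.commute)
  then show ?thesis by (simp add: hp_def)
qed

lemma eigen_basis_sum:
  assumes "f \<in> fs.span (eigen_basis k)"
  obtains c where "f = restrS3 (\<lambda>x. \<Sum>(q, i)\<in>{..k} \<times> {..k}. c q i * hp (k - q) q i x)"
proof -
  obtain c where c: "f = (\<Sum>a\<in>{..k} \<times> {..k}. fscale (c a) ((\<lambda>(q, i). restrS3 (hp (k - q) q i)) a))"
    using span_image_sum[OF _ assms[unfolded eigen_basis_def]] by blast
  have "f = restrS3 (\<lambda>x. \<Sum>a\<in>{..k} \<times> {..k}. c a * hp (k - fst a) (fst a) (snd a) x)"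
    unfolding c restrS3_sum[symmetric] by (rule sum.cong) auto
  then show thesis by (intro that[of "\<lambda>q i. c (q, i)"]) (simp add: case_prod_beta)
qed

lemma eigen_basis_span_eigenfunction:
  assumes "f \<in> fs.span (eigen_basis k)"
  shows "S3_fun f" "x \<in> S3 \<Longrightarrow> lapS3 f x = - of_nat (k * (k + 2)) * f x"
proof -
  obtain c where "f = restrS3 (\<lambda>x. \<Sum>(q, i)\<in>{..k} \<times> {..k}. c q i * hp (k - q) q i x)"
    using eigen_basis_sum[OF assms] .
  then show "S3_fun f" "x \<in> S3 \<Longrightarrow> lapS3 f x = - of_nat (k * (k + 2)) * f x"
    using hp_sum_eigenfunction[where A = "{..k} \<times> {..k}" and p = "\<lambda>a. k - fst a" and q = fst
      and k = k and c = "\<lambda>a. c (fst a) (snd a)" and i = snd] by (auto simp: case_prod_beta)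
qed

text \<open>The square of \<open>swap\<close> is -1, while every \<open>hp p q i\<close> with
  \<open>p + q\<close> odd is an odd function.\<close>

lemma modes_odd:
  assumes "odd k"
  shows "modes (binary_dihedral m) k = {\<lambda>x. 0}"
proof
  show "modes (binary_dihedral m) k \<subseteq> {\<lambda>x. 0}"
  proof
    fix F assume F: "F \<in> modes (binary_dihedral m) k"
    have "S3_fun F" "\<And>x. x \<in> S3 \<Longrightarrow> lapS3 F x = - of_nat (k * (k + 2)) * F x"
      and sw2: "\<And>x. x \<in> S3 \<Longrightarrow> F (swap x) = F x"
      using F unfolding modes_binary_dihedral_iff by auto
    then obtain c where c: "F = restrS3 (\<lambda>x. \<Sum>(q, i)\<in>{..k} \<times> {..k}. c q i * hp (k - q) q i x)"
      using eigen_basis_sum[OF eigenfunction_in_span] by blast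
    have "F x = 0" if x: "x \<in> S3" for x
    proof -
      have sw: "swap (swap x) = - x" by (simp add: swap_def vec2_eq_iff)
      have mx: "- x \<in> S3" using x by (simp add: S3_def)
      have "F (- x) = F x"
        unfolding sw[symmetric] using sw2 x by simp
      moreover have "F (- x) = - F x"
      proof -
        have "F (- x) = (\<Sum>(q, i)\<in>{..k} \<times> {..k}. c q i * hp (k - q) q i (- x))"
          using mx by (simp add: c restrS3_def)
        also have "\<dots> = (\<Sum>(q, i)\<in>{..k} \<times> {..k}. - (c q i * hp (k - q) q i x))"
          using assms by (intro sum.cong) (auto simp: hp_uminus)
        finally show ?thesis using x by (simp add: c restrS3_def sum_negf case_prod_beta)
      qed
      ultimately show ?thesis by simp
    qed
    then show "F \<in> {\<lambda>x. 0}" by (auto simp: c restrS3_def)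
  qed
  have "(0 :: complex^2 \<Rightarrow> complex) \<in> modes (binary_dihedral m) k"
    unfolding modes_binary_dihedral_iff
    using eigen_basis_span_eigenfunction[where k = k, OF fs.span_zero] by auto
  then show "{\<lambda>x. 0} \<subseteq> modes (binary_dihedral m) k" by (simp add: zero_fun_def)
qed

lemma sum_roots_of_unity:
  fixes z :: complex
  assumes "z ^ m = 1"
  shows "(\<Sum>j<m. z ^ j) = (if z = 1 then of_nat m else 0)"
  using assms by (simp add: geometric_sum)

text \<open>For \<open>q \<le> 2 * n\<close> and \<open>i \<le> 2 * n\<close> this is the sum of
  \<open>hp (2 * n - q) q i\<close> and its composition with \<open>swap\<close>; the sign is the
  factor \<open>\<i> ^ (p + q)\<close> of \<open>hp_swap\<close>.\<close>

definition invariant_pair :: "nat \<Rightarrow> nat \<Rightarrow> nat \<Rightarrow> complex^2 \<Rightarrow> complex" where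
  "invariant_pair n q i x = hp (2 * n - q) q i x + (-1) ^ n * hp (2 * n - q) q (2 * n - i) x"

text \<open>Averaging over the cyclic subgroup keeps only the exponents congruent to \<open>n\<close> modulo \<open>m\<close>;
  averaging over the swap then pairs \<open>i\<close> with \<open>k - i\<close>.\<close>

lemma modes_even_in_span:
  assumes m: "m \<ge> 1" and F: "F \<in> modes (binary_dihedral m) (2 * n)"
  shows "F \<in> fs.span {restrS3 (invariant_pair n q i) | q i. q \<le> 2 * n \<and> i \<le> 2 * n \<and> int m dvd int i - int n}"
    (is "F \<in> fs.span ?B")
proof -
  define k where "k = 2 * n"
  define w where "w = cis (pi / m)"
  \<comment> \<open>The character of \<open>rot w\<close> on \<open>hp (k - q) q i\<close>, the same
    for every \<open>q\<close>. It is an \<open>m\<close>-th root of unity although the generator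
    has order \<open>2 * m\<close>: the \<open>m\<close>-th power of the generator is -1, which acts
    trivially in even degree.\<close>
  define z where "z i = cnj w ^ k * (w\<^sup>2) ^ i" for i
  have w: "cmod w = 1" by (simp add: w_def)
  have zc: "z i = cis (2 * pi * (real i - real n) / m)" for i
  proof -
    have "z i = cis (- (pi / m)) ^ k * cis (pi / m) ^ (2 * i)"
      by (simp add: z_def w_def cis_cnj power_mult)
    also have "\<dots> = cis (2 * pi * (real i - real n) / m)"
      by (simp add: Complex.DeMoivre cis_mult k_def diff_divide_distrib algebra_simps)
    finally show ?thesis .
  qed
  have zm: "z i ^ m = 1" for i
  proof -
    have "z i ^ m = cis (2 * pi * (of_int (int i - int n)))"
      using m by (simp add: zc Complex.DeMoivre)
    also have "\<dots> = 1" by (rule cis_multiple_2pi) simp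
    finally show ?thesis .
  qed
  have dvd: "int m dvd int i - int n" if "z i = 1" for i
  proof -
    have "cos (2 * pi * (real i - real n) / m) = 1" using that unfolding zc by (metis cis.sel(1) one_complex.sel(1))
    then obtain j :: int where "2 * pi * (real i - real n) / m = of_int j * 2 * pi" using cos_one_2pi_int by blast
    then have "(2 * pi) * (real i - real n) = (2 * pi) * (of_int j * real m)" using m by (simp add: field_simps)
    then have "real i - real n = of_int j * real m" by (subst (asm) mult_left_cancel) auto
    then have "real_of_int (int i - int n) = real_of_int (int m * j)" by (simp add: mult.commute)
    then have "int i - int n = int m * j" by (simp only: of_int_eq_iff)
    then show ?thesis by simp
  qed
  have R: "S3_fun F" "\<And>x. x \<in> S3 \<Longrightarrow> lapS3 F x = - of_nat (k * (k + 2)) * F x"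
    "\<And>x. x \<in> S3 \<Longrightarrow> F (swap x) = F x" "\<And>x. x \<in> S3 \<Longrightarrow> F (rot w x) = F x"
    using F unfolding modes_binary_dihedral_iff w_def k_def by auto
  obtain c where c: "F = restrS3 (\<lambda>x. \<Sum>(q, i)\<in>{..k} \<times> {..k}. c q i * hp (k - q) q i x)"
    using eigen_basis_sum[OF eigenfunction_in_span[OF R(1,2)]] .
  have rotS: "(rot w ^^ j) x \<in> S3" if "x \<in> S3" for x j using that w by (induction j) auto
  have hprot: "hp (k - q) q i ((rot w ^^ j) x) = z i ^ j * hp (k - q) q i x" if "q \<le> k" for q i j x
    using that by (induction j) (auto simp: hp_rot[OF w] z_def)
  have Frot: "F ((rot w ^^ j) x) = F x" if "x \<in> S3" for x j
    using that rotS R(4) by (induction j) auto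
  \<comment> \<open>Averaging over \<open>m\<close> powers of \<open>rot w\<close> annihilates every
    term with a nontrivial character.\<close>
  define d where "d q i = (if z i = 1 then c q i else 0)" for q i
  have Fd: "F x = (\<Sum>(q, i)\<in>{..k} \<times> {..k}. d q i * hp (k - q) q i x)" if x: "x \<in> S3" for x
  proof -
    have "of_nat m * F x = (\<Sum>j<m. F ((rot w ^^ j) x))" using x by (simp add: Frot)
    also have "\<dots> = (\<Sum>j<m. \<Sum>(q, i)\<in>{..k} \<times> {..k}. c q i * (z i ^ j * hp (k - q) q i x))"
      using rotS[OF x] by (intro sum.cong refl) (auto simp: c restrS3_def hprot intro!: sum.cong)
    also have "\<dots> = (\<Sum>(q, i)\<in>{..k} \<times> {..k}. \<Sum>j<m. c q i * (z i ^ j * hp (k - q) q i x))"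
      by (subst sum.swap) (simp add: case_prod_beta)
    also have "\<dots> = (\<Sum>(q, i)\<in>{..k} \<times> {..k}. of_nat m * (d q i * hp (k - q) q i x))"
      by (intro sum.cong refl)
         (auto simp: sum_distrib_left[symmetric] sum_distrib_right[symmetric] sum_roots_of_unity[OF zm] d_def)
    also have "\<dots> = of_nat m * (\<Sum>(q, i)\<in>{..k} \<times> {..k}. d q i * hp (k - q) q i x)"
      by (simp add: sum_distrib_left case_prod_beta)
    finally show ?thesis using m by simp
  qed
  have ik: "\<i> ^ k = (-1) ^ n" by (simp add: k_def power_mult)
  \<comment> \<open>\<open>F\<close> is the mean of itself and its composition with
    \<open>swap\<close>, whence the factor 1/2.\<close>
  have F2: "F x = (\<Sum>(q, i)\<in>{..k} \<times> {..k}. d q i / 2 * invariant_pair n q i x)" if x: "x \<in> S3" for x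
  proof -
    have "F x = F (swap x)" using R(3)[OF x] by simp
    also have "\<dots> = (\<Sum>(q, i)\<in>{..k} \<times> {..k}. d q i * ((-1) ^ n * hp (k - q) q (k - i) x))"
      using x by (subst Fd) (auto intro!: sum.cong simp: hp_swap ik)
    finally have "F x + F x = (\<Sum>(q, i)\<in>{..k} \<times> {..k}. d q i * hp (k - q) q i x)
      + (\<Sum>(q, i)\<in>{..k} \<times> {..k}. d q i * ((-1) ^ n * hp (k - q) q (k - i) x))"
      using Fd[OF x] by simp
    also have "\<dots> = (\<Sum>(q, i)\<in>{..k} \<times> {..k}. d q i * invariant_pair n q i x)"
      unfolding sum.distrib[symmetric]
      by (intro sum.cong) (auto simp: invariant_pair_def k_def distrib_left)
    also have "\<dots> = 2 * (\<Sum>(q, i)\<in>{..k} \<times> {..k}. d q i / 2 * invariant_pair n q i x)"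
      by (simp add: sum_distrib_left case_prod_beta)
    finally show ?thesis by simp
  qed
  have "F = (\<Sum>a\<in>{..k} \<times> {..k}. fscale (d (fst a) (snd a) / 2) (restrS3 (invariant_pair n (fst a) (snd a))))"
    unfolding restrS3_sum
  proof
    fix x show "F x = restrS3 (\<lambda>x. \<Sum>a\<in>{..k} \<times> {..k}. d (fst a) (snd a) / 2 * invariant_pair n (fst a) (snd a) x) x"
      using F2[of x] by (cases "x \<in> S3") (simp_all add: restrS3_def case_prod_beta c)
  qed
  also have "\<dots> \<in> fs.span ?B"
  proof (rule fs.span_sum)
    fix a assume a: "a \<in> {..k} \<times> {..k}"
    show "fscale (d (fst a) (snd a) / 2) (restrS3 (invariant_pair n (fst a) (snd a))) \<in> fs.span ?B"
    proof (cases "z (snd a) = 1")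
      case True
      then show ?thesis
        using a dvd[OF True] by (intro fs.span_scale fs.span_base CollectI exI conjI) (auto simp: k_def)
    next
      case False
      then show ?thesis by (simp add: d_def fs.span_zero)
    qed
  qed
  finally show ?thesis .
qed

section \<open>Siblings\<close>

lemma pd_hp_sum:
  "pd v (\<lambda>x. \<Sum>i\<in>A. a i * hp p q i x) x = (\<Sum>i\<in>A. a i *
    (of_nat p * coeff (xi v * (xi x ^ (p - 1) * eta x ^ q)) i
     + of_nat q * coeff (eta v * (xi x ^ p * eta x ^ (q - 1))) i))"
proof -
  have c: "((\<lambda>t. x + t *\<^sub>R v) has_vector_derivative v) (at 0)"
    by (auto intro!: derivative_eq_intros)
  have "((\<lambda>t. hp p q i (x + t *\<^sub>R v)) has_vector_derivative
    of_nat p * coeff (xi v * (xi x ^ (p - 1) * eta x ^ q)) i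
     + of_nat q * coeff (eta v * (xi x ^ p * eta x ^ (q - 1))) i) (at 0)" for i
    using hp_has_vector_derivative[OF c, of p q i] by (simp add: mult.assoc coeff_of_nat_mult)
  then show ?thesis
    unfolding pd_def
    by (intro vector_derivative_at has_vector_derivative_sum has_vector_derivative_mult_right)
qed

text \<open>\<open>twist_minus\<close> is a derivation that kills the antiholomorphic
  \<open>eta\<close> and sends \<open>xi\<close> to \<open>eta\<close>: the derivatives of
  \<open>xi\<close> in \<alpha> and \<beta> are u and 1.\<close>

lemma twist_minus_hp_sum:
  "twist_minus (\<lambda>x. \<Sum>i\<in>A. a i * hp p q i x) = (\<lambda>x. \<Sum>i\<in>A. of_nat p * a i * hp (p - 1) (q + 1) i x)"
proof
  fix x
  let ?R = "xi x ^ (p - 1) * eta x ^ q" and ?S = "xi x ^ p * eta x ^ (q - 1)"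
  define X :: "complex poly" where "X = [:0, 1:]"
  have e: "xi ex = X" "xi ey = smult \<i> X" "xi ez = 1" "xi ew = smult \<i> 1"
    "eta ex = 1" "eta ey = - smult \<i> 1" "eta ez = - X" "eta ew = smult \<i> X"
    by (simp_all add: xi_def eta_def ex_def ey_def ez_def ew_def one_pCons X_def)
  have da: "d_alpha (\<lambda>x. \<Sum>i\<in>A. a i * hp p q i x) x = (\<Sum>i\<in>A. of_nat p * a i * coeff (X * ?R) i)"
    unfolding d_alpha_def pd_hp_sum e sum_distrib_left sum_subtractf[symmetric] sum_divide_distrib
    by (intro sum.cong refl) (simp add: algebra_simps)
  have db: "d_beta (\<lambda>x. \<Sum>i\<in>A. a i * hp p q i x) x = (\<Sum>i\<in>A. of_nat p * a i * coeff ?R i)"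
    unfolding d_beta_def pd_hp_sum e sum_distrib_left sum_subtractf[symmetric] sum_divide_distrib
    by (intro sum.cong refl) (simp add: algebra_simps)
  have h: "hp (p - 1) (q + 1) i x = - cnj (x$2) * coeff (X * ?R) i + cnj (x$1) * coeff ?R i" for i
  proof -
    have "xi x ^ (p - 1) * eta x ^ (q + 1) = eta x * ?R" by (simp add: mult_ac)
    also have "\<dots> = smult (- cnj (x$2)) (X * ?R) + smult (cnj (x$1)) ?R"
      by (simp add: eta_def X_def)
    finally show ?thesis by (simp only: hp_def coeff_add coeff_smult)
  qed
  show "twist_minus (\<lambda>x. \<Sum>i\<in>A. a i * hp p q i x) x = (\<Sum>i\<in>A. of_nat p * a i * hp (p - 1) (q + 1) i x)"
    unfolding twist_minus_def da db h sum_distrib_left sum.distrib[symmetric]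
    by (intro sum.cong refl) (simp only: distrib_left mult_ac)
qed

text \<open>The falling factorial, accumulated over \<open>j\<close> applications of
  \<open>twist_minus\<close>. It is nonzero exactly for \<open>j \<le> k\<close>, which is why the
  siblings end at \<open>j = k\<close>.\<close>

definition ff :: "nat \<Rightarrow> nat \<Rightarrow> complex" where
  "ff k j = (\<Prod>l<j. of_nat (k - l))"

lemma ff_nonzero: "j \<le> k \<Longrightarrow> ff k j \<noteq> 0"
  by (simp add: ff_def)

lemma twist_minus_power_hp_sum:
  assumes "j \<le> k"
  shows "(twist_minus ^^ j) (\<lambda>x. \<Sum>i\<in>A. a i * hp k 0 i x) = (\<lambda>x. \<Sum>i\<in>A. ff k j * a i * hp (k - j) j i x)"
  using assms
proof (induction j)
  case 0
  then show ?case by (simp add: ff_def)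
next
  case (Suc j)
  then have "(twist_minus ^^ Suc j) (\<lambda>x. \<Sum>i\<in>A. a i * hp k 0 i x)
      = twist_minus (\<lambda>x. \<Sum>i\<in>A. ff k j * a i * hp (k - j) j i x)" by simp
  also have "\<dots> = (\<lambda>x. \<Sum>i\<in>A. of_nat (k - j) * (ff k j * a i) * hp (k - j - 1) (j + 1) i x)"
    by (rule twist_minus_hp_sum)
  also have "\<dots> = (\<lambda>x. \<Sum>i\<in>A. ff k (Suc j) * a i * hp (k - Suc j) (Suc j) i x)"
    by (simp add: ff_def mult_ac)
  finally show ?case .
qed

section \<open>Binary forms in \<alpha>, \<beta> and powers of \<open>twist_minus\<close> on
  them\<close>

definition hol :: "nat \<Rightarrow> (complex^2 \<Rightarrow> complex) set" where
  "hol k = fs.span ((\<lambda>i x. x$1 ^ i * x$2 ^ (k - i)) ` {..k})"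

lemma hp_hol: "i \<le> k \<Longrightarrow> hp k 0 i x = of_nat (k choose i) * (x$1 ^ i * x$2 ^ (k - i))"
  by (simp add: hp_def xi_def coeff_linear_poly_power mult.assoc)

lemma hol_sum:
  assumes "f \<in> hol k"
  obtains a where "f = (\<lambda>x. \<Sum>i\<le>k. a i * hp k 0 i x)"
proof -
  obtain c where c: "f = (\<Sum>i\<le>k. fscale (c i) (\<lambda>x. x$1 ^ i * x$2 ^ (k - i)))"
    using span_image_sum[OF _ assms[unfolded hol_def]] by blast
  have "f = (\<lambda>x. \<Sum>i\<le>k. c i / of_nat (k choose i) * hp k 0 i x)"
    unfolding c by (rule ext) (auto simp: sum_fscale_apply hp_hol intro!: sum.cong)
  then show thesis by (rule that)
qed

lemma hol_mono: "(\<lambda>x. x$1 ^ p * x$2 ^ q) \<in> hol (p + q)"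
  unfolding hol_def by (rule fs.span_base) (auto intro!: image_eqI[of _ _ p])

lemma hol_scale: "f \<in> hol k \<Longrightarrow> (\<lambda>x. c * f x) \<in> hol k"
  using fs.span_scale[of f _ c] by (simp add: hol_def fscale_def)

lemma hol_add: "f \<in> hol k \<Longrightarrow> g \<in> hol k \<Longrightarrow> (\<lambda>x. f x + g x) \<in> hol k"
  using fs.span_add[of f _ g] by (simp add: hol_def plus_fun_def)

lemma hol_0: "(\<lambda>x. 0) \<in> hol k"
  using fs.span_zero by (simp add: hol_def zero_fun_def)

lemma hol_sum_closed: "(\<And>s. s \<in> A \<Longrightarrow> f s \<in> hol k) \<Longrightarrow> (\<lambda>x. \<Sum>s\<in>A. f s x) \<in> hol k"
  by (induction A rule: infinite_finite_induct) (auto simp: hol_0 hol_add)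

lemma hol_mult:
  assumes f: "f \<in> hol k" and g: "g \<in> hol l"
  shows "(\<lambda>x. f x * g x) \<in> hol (k + l)"
proof -
  obtain a b where a: "f = (\<lambda>x. \<Sum>i\<le>k. a i * hp k 0 i x)" and b: "g = (\<lambda>x. \<Sum>i\<le>l. b i * hp l 0 i x)"
    using hol_sum[OF f] hol_sum[OF g] by metis
  have "(\<lambda>x. f x * g x) = (\<lambda>x. \<Sum>i\<le>k. \<Sum>j\<le>l.
      (a i * of_nat (k choose i) * b j * of_nat (l choose j)) * (x$1 ^ (i + j) * x$2 ^ ((k - i) + (l - j))))"
    unfolding a b sum_product
    unfolding power_add by (intro ext sum.cong refl) (simp add: hp_hol mult_ac)
  also have "\<dots> \<in> hol (k + l)"
  proof (intro hol_sum_closed hol_scale)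
    fix i j assume "i \<in> {..k}" "j \<in> {..l}"
    then have "i + j + (k - i + (l - j)) = k + l" by simp
    then show "(\<lambda>x. x$1 ^ (i + j) * x$2 ^ ((k - i) + (l - j))) \<in> hol (k + l)"
      using hol_mono[of "i + j" "k - i + (l - j)"] by simp
  qed
  finally show ?thesis .
qed

lemma hol_power: "f \<in> hol k \<Longrightarrow> (\<lambda>x. f x ^ n) \<in> hol (n * k)"
proof (induction n)
  case 0
  then show ?case using hol_mono[of 0 0] by simp
next
  case (Suc n)
  then show ?case using hol_mult[of f k "\<lambda>x. f x ^ n" "n * k"] by simp
qed

text \<open>Linearity of \<open>twist_minus\<close> depends on differentiability at every stage;
  expanding each form in the \<open>hp k 0 i\<close>, whose images are known explicitly, supplies
  it.\<close>

lemma twist_minus_power_sum: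
  assumes f: "\<And>s. s \<in> A \<Longrightarrow> f s \<in> hol k" and j: "j \<le> k"
  shows "(twist_minus ^^ j) (\<lambda>x. \<Sum>s\<in>A. c s * f s x) = (\<lambda>x. \<Sum>s\<in>A. c s * (twist_minus ^^ j) (f s) x)"
proof -
  have "\<forall>s\<in>A. \<exists>a. f s = (\<lambda>x. \<Sum>i\<le>k. a i * hp k 0 i x)" using hol_sum[OF f] by metis
  then obtain a where a: "\<And>s. s \<in> A \<Longrightarrow> f s = (\<lambda>x. \<Sum>i\<le>k. a s i * hp k 0 i x)" by metis
  have "(\<lambda>x. \<Sum>s\<in>A. c s * f s x) = (\<lambda>x. \<Sum>s\<in>A. \<Sum>i\<le>k. c s * a s i * hp k 0 i x)"
    by (intro ext sum.cong refl) (simp add: a sum_distrib_left mult.assoc)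
  also have "\<dots> = (\<lambda>x. \<Sum>i\<le>k. (\<Sum>s\<in>A. c s * a s i) * hp k 0 i x)"
    by (subst sum.swap) (simp add: sum_distrib_right)
  finally have "(twist_minus ^^ j) (\<lambda>x. \<Sum>s\<in>A. c s * f s x)
      = (\<lambda>x. \<Sum>i\<le>k. ff k j * (\<Sum>s\<in>A. c s * a s i) * hp (k - j) j i x)"
    by (simp add: twist_minus_power_hp_sum[OF j])
  also have "\<dots> = (\<lambda>x. \<Sum>s\<in>A. \<Sum>i\<le>k. c s * (ff k j * a s i * hp (k - j) j i x))"
    by (subst sum.swap) (simp add: sum_distrib_left sum_distrib_right mult_ac)
  also have "\<dots> = (\<lambda>x. \<Sum>s\<in>A. c s * (twist_minus ^^ j) (f s) x)"
    by (intro ext sum.cong refl) (simp add: a twist_minus_power_hp_sum[OF j] sum_distrib_left)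
  finally show ?thesis .
qed

section \<open>The dihedral polynomials and their invariance\<close>

definition dsign :: "nat \<Rightarrow> complex" where "dsign m = (-1) ^ m"

text \<open>One formula for both parities of \<open>m\<close>: \<open>dsign m\<close> is
  \<open>\<i> ^ (2 * m)\<close>, the factor that \<open>swap\<close> puts on \<open>2 * m\<close>-th
  powers.\<close>

lemma dihedral_poly_eq: "dihedral_poly m a b c x =
    (x$1 * x$2) ^ (2 * a) * (x$1 ^ (2*m) + dsign m * x$2 ^ (2*m)) ^ b
    * (x$1 * x$2 * (x$1 ^ (2*m) - dsign m * x$2 ^ (2*m))) ^ c"
  by (simp add: dihedral_poly_def Let_def dsign_def power_mult power_mult_distrib)

lemma dsign_square: "dsign m * dsign m = 1"
  by (simp add: dsign_def flip: power_mult_distrib)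

definition dihedral_index :: "nat \<Rightarrow> nat \<Rightarrow> (nat \<times> nat \<times> nat) set" where
  "dihedral_index m n = {(a, b, c). 2 * a + m * b + (m + 1) * c = n \<and> c \<le> 1}"

lemma dihedral_poly_hol:
  assumes "(a, b, c) \<in> dihedral_index m n"
  shows "dihedral_poly m a b c \<in> hol (2 * n)"
proof -
  have m1: "(\<lambda>x::complex^2. x$1 ^ (2*m)) \<in> hol (2*m)" using hol_mono[of "2*m" 0] by simp
  have m2: "(\<lambda>x::complex^2. d * x$2 ^ (2*m)) \<in> hol (2*m)" for d using hol_scale[OF hol_mono[of 0 "2*m"]] by simp
  have m3: "(\<lambda>x::complex^2. x$1 * x$2) \<in> hol 2" using hol_mono[of 1 1] by (simp add: numeral_2_eq_2)
  have A: "(\<lambda>x::complex^2. (x$1 * x$2) ^ (2 * a)) \<in> hol (2 * a * 2)" by (rule hol_power[OF m3])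
  have B: "(\<lambda>x::complex^2. (x$1 ^ (2*m) + dsign m * x$2 ^ (2*m)) ^ b) \<in> hol (b * (2 * m))"
    by (intro hol_power hol_add m1 m2)
  have "(\<lambda>x::complex^2. x$1 ^ (2*m) - dsign m * x$2 ^ (2*m)) \<in> hol (2 * m)"
    using hol_add[OF m1 m2[of "- dsign m"]] by simp
  then have C: "(\<lambda>x::complex^2. (x$1 * x$2 * (x$1 ^ (2*m) - dsign m * x$2 ^ (2*m))) ^ c) \<in> hol (c * (2 + 2 * m))"
    by (intro hol_power hol_mult m3)
  have "dihedral_poly m a b c \<in> hol (2 * a * 2 + b * (2 * m) + c * (2 + 2 * m))"
    using hol_mult[OF hol_mult[OF A B] C] by (simp add: dihedral_poly_eq[abs_def])
  moreover have "2 * a * 2 + b * (2 * m) + c * (2 + 2 * m) = 2 * n"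
    using assms by (auto simp: dihedral_index_def algebra_simps)
  ultimately show ?thesis by simp
qed

text \<open>\<open>swap\<close> interchanges \<alpha>^(2m) and \<open>dsign m\<close> times
  \<beta>^(2m). Their sum is fixed; their difference and \<alpha>\<beta> both change sign, so the
  two signs cancel in the last factor.\<close>

lemma dihedral_poly_swap: "dihedral_poly m a b c (swap x) = dihedral_poly m a b c x"
proof -
  have i: "\<i> ^ (2 * m) = dsign m" by (simp add: dsign_def power_mult)
  have "(\<i> * y) ^ (2 * m) = dsign m * y ^ (2 * m)" for y by (simp only: power_mult_distrib i)
  then have X: "(\<i> * x$2) ^ (2 * m) = dsign m * x$2 ^ (2 * m)" "dsign m * (\<i> * x$1) ^ (2 * m) = x$1 ^ (2 * m)"
    by (simp_all add: mult.assoc[symmetric] dsign_square)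
  have s: "swap x $ 1 = \<i> * x$2" "swap x $ 2 = \<i> * x$1" by (simp_all add: swap_def)
  have p: "\<i> * x$2 * (\<i> * x$1) = - (x$1 * x$2)" by (simp add: mult_ac)
  have n: "- (x$1 * x$2) * (dsign m * x$2 ^ (2*m) - x$1 ^ (2*m)) = x$1 * x$2 * (x$1 ^ (2*m) - dsign m * x$2 ^ (2*m))"
    by (simp add: algebra_simps)
  show ?thesis unfolding dihedral_poly_eq s X p n by (simp add: add.commute)
qed

lemma dihedral_poly_rot:
  assumes "m \<ge> 1"
  shows "dihedral_poly m a b c (rot (cis (pi / m)) x) = dihedral_poly m a b c x"
proof -
  let ?w = "cis (pi / m)"
  have w: "?w ^ (2 * m) = 1" "cnj ?w ^ (2 * m) = 1"
    using assms by (simp_all add: cis_cnj Complex.DeMoivre complex_eq_iff)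
  have ww: "?w * y * (cnj ?w * z) = y * z" for y z
    using complex_norm_square[of ?w] by (simp add: mult_ac)
  have s: "rot ?w x $ 1 = ?w * x$1" "rot ?w x $ 2 = cnj ?w * x$2" by (simp_all add: rot_def)
  show ?thesis unfolding dihedral_poly_eq s ww power_mult_distrib[of ?w] power_mult_distrib[of "cnj ?w"] w by simp
qed

text \<open>\<open>f\<close> and its composition with a generator are one function with two
  expansions in the \<open>hp k 0 i\<close>. \<open>twist_minus ^^ j\<close> turns each into an
  expansion in the \<open>hp (k - j) j i\<close>, with coefficients multiplied by
  \<open>ff k j\<close>, on which the generator acts by the same formula in
  \<open>i\<close>.\<close>

lemma twist_power_in_modes:
  assumes m: "m \<ge> 1" and S: "(a, b, c) \<in> dihedral_index m n" and j: "j \<le> 2 * n"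
  shows "restrS3 ((twist_minus ^^ j) (dihedral_poly m a b c)) \<in> modes (binary_dihedral m) (2 * n)"
proof -
  define k where "k = 2 * n"
  have j: "j \<le> k" using j by (simp add: k_def)
  define w where "w = cis (pi / m)"
  have w: "cmod w = 1" by (simp add: w_def)
  define f where "f = dihedral_poly m a b c"
  obtain d where d: "f = (\<lambda>x. \<Sum>i\<le>k. d i * hp k 0 i x)"
    using hol_sum[OF dihedral_poly_hol[OF S]] unfolding f_def k_def by blast
  have T: "(twist_minus ^^ j) f = (\<lambda>x. \<Sum>i\<le>k. ff k j * d i * hp (k - j) j i x)"
    unfolding d by (rule twist_minus_power_hp_sum[OF j])
  define z where "z i = cnj w ^ k * (w\<^sup>2) ^ i" for i
  have rot: "(twist_minus ^^ j) f (rot w x) = (twist_minus ^^ j) f x" for x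
  proof -
    have "f = (\<lambda>x. f (rot w x))" using m by (simp add: f_def w_def dihedral_poly_rot)
    also have "\<dots> = (\<lambda>x. \<Sum>i\<le>k. (d i * z i) * hp k 0 i x)"
      by (simp add: d hp_rot[OF w] z_def mult_ac)
    finally have "f = (\<lambda>x. \<Sum>i\<le>k. (d i * z i) * hp k 0 i x)" .
    from trans[OF arg_cong[OF this, of "twist_minus ^^ j"] twist_minus_power_hp_sum[OF j]]
    have "(twist_minus ^^ j) f x = (\<Sum>i\<le>k. ff k j * (d i * z i) * hp (k - j) j i x)"
      by (rule fun_cong)
    also have "\<dots> = (twist_minus ^^ j) f (rot w x)"
      using j by (simp add: T hp_rot[OF w] z_def mult_ac)
    finally show ?thesis by simp
  qed
  have swap: "(twist_minus ^^ j) f (swap x) = (twist_minus ^^ j) f x" for x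
  proof -
    have "f = (\<lambda>x. f (swap x))" by (simp add: f_def dihedral_poly_swap)
    also have "\<dots> = (\<lambda>x. \<Sum>i\<le>k. (\<i> ^ k * d i) * hp k 0 (k - i) x)"
      unfolding d by (intro ext sum.cong refl) (simp add: hp_swap)
    also have "\<dots> = (\<lambda>x. \<Sum>i\<le>k. (\<i> ^ k * d (k - i)) * hp k 0 i x)"
      by (rule ext, rule sum.reindex_bij_witness[of _ "\<lambda>i. k - i" "\<lambda>i. k - i"]) auto
    finally have "f = (\<lambda>x. \<Sum>i\<le>k. (\<i> ^ k * d (k - i)) * hp k 0 i x)" .
    from trans[OF arg_cong[OF this, of "twist_minus ^^ j"] twist_minus_power_hp_sum[OF j]]
    have "(twist_minus ^^ j) f x = (\<Sum>i\<le>k. ff k j * (\<i> ^ k * d (k - i)) * hp (k - j) j i x)"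
      by (rule fun_cong)
    also have "\<dots> = (\<Sum>i\<le>k. ff k j * (\<i> ^ k * d i) * hp (k - j) j (k - i) x)"
      by (rule sum.reindex_bij_witness[of _ "\<lambda>i. k - i" "\<lambda>i. k - i"]) auto
    also have "\<dots> = (twist_minus ^^ j) f (swap x)"
      unfolding T using j by (intro sum.cong refl) (simp add: hp_swap)
    finally show ?thesis by simp
  qed
  have "restrS3 ((twist_minus ^^ j) f) = (\<Sum>i\<le>k. fscale (ff k j * d i) (restrS3 (hp (k - j) j i)))"
    unfolding T restrS3_sum ..
  also have "\<dots> \<in> fs.span (eigen_basis k)"
    using j by (intro fs.span_sum fs.span_scale fs.span_base) (auto simp: eigen_basis_def)
  finally have sp: "restrS3 ((twist_minus ^^ j) f) \<in> fs.span (eigen_basis k)" .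
  show ?thesis
    unfolding modes_binary_dihedral_iff w_def[symmetric] f_def[symmetric]
    using eigen_basis_span_eigenfunction[OF sp] swap rot w by (auto simp: restrS3_def k_def)
qed

section \<open>Invariant binary forms\<close>

definition dihedral_span :: "nat \<Rightarrow> nat \<Rightarrow> (complex^2 \<Rightarrow> complex) set" where
  "dihedral_span m n = fs.span ((\<lambda>(a, b, c). dihedral_poly m a b c) ` dihedral_index m n)"

lemma dihedral_poly_in_span:
  "2 * a + m * b + (m + 1) * c = n \<Longrightarrow> c \<le> 1 \<Longrightarrow> dihedral_poly m a b c \<in> dihedral_span m n"
  unfolding dihedral_span_def
  by (rule fs.span_base) (auto simp: dihedral_index_def intro!: image_eqI[of _ _ "(a, b, c)"])

lemma dihedral_span_mult:
  assumes "f \<in> dihedral_span m n"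
  shows "(\<lambda>x. (x$1 ^ (2*m) + dsign m * x$2 ^ (2*m)) * f x) \<in> dihedral_span m (n + m)"
  using assms unfolding dihedral_span_def[of m n]
proof (induction rule: fs.span_induct_alt)
  case base
  show ?case using fs.span_zero by (simp add: dihedral_span_def zero_fun_def)
next
  case (step r h f)
  then obtain a b c where h: "h = dihedral_poly m a b c" and abc: "2 * a + m * b + (m + 1) * c = n" "c \<le> 1"
    by (auto simp: dihedral_index_def)
  have "(\<lambda>x. (x$1 ^ (2*m) + dsign m * x$2 ^ (2*m)) * h x) = dihedral_poly m a (b + 1) c"
    unfolding h dihedral_poly_eq[abs_def] by (rule ext) (simp add: mult_ac)
  moreover have "dihedral_poly m a (b + 1) c \<in> dihedral_span m (n + m)"
    using abc by (intro dihedral_poly_in_span) auto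
  moreover have "(\<lambda>x. (x$1 ^ (2*m) + dsign m * x$2 ^ (2*m)) * (fscale r h + f) x)
      = fscale r (\<lambda>x. (x$1 ^ (2*m) + dsign m * x$2 ^ (2*m)) * h x)
        + (\<lambda>x. (x$1 ^ (2*m) + dsign m * x$2 ^ (2*m)) * f x)"
    by (rule ext) (simp add: fscale_def algebra_simps)
  ultimately show ?case
    using step(2) unfolding dihedral_span_def by (simp add: fs.span_add fs.span_scale)
qed

text \<open>Newton's recursion \<open>p\<^sub>t\<^sub>+\<^sub>2 = (X + Y) p\<^sub>t\<^sub>+\<^sub>1 - X Y p\<^sub>t\<close> for \<open>p\<^sub>t = X\<^sup>t \<plusminus> Y\<^sup>t\<close> with
  \<open>X = \<alpha>\<^sup>2\<^sup>m\<close>, \<open>Y = \<plusminus>\<beta>\<^sup>2\<^sup>m\<close>, where \<open>X Y = \<plusminus>(\<alpha>\<beta>)\<^sup>2\<^sup>m\<close>.\<close>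

lemma power_sum_in_dihedral_span:
  "(\<lambda>x. (x$1 * x$2) ^ r * ((x$1 ^ (2*m)) ^ t + (-1) ^ r * (dsign m * x$2 ^ (2*m)) ^ t))
    \<in> dihedral_span m (r + m * t)"
proof (induction t arbitrary: r rule: induct_nat_012)
  case 0
  show ?case
  proof (cases "even r")
    case True
    have "(\<lambda>x::complex^2. (x$1 * x$2) ^ r * ((x$1 ^ (2*m)) ^ 0 + (-1) ^ r * (dsign m * x$2 ^ (2*m)) ^ 0))
        = fscale 2 (dihedral_poly m (r div 2) 0 0)"
      using True by (intro ext) (simp add: dihedral_poly_eq fscale_def)
    moreover have "dihedral_poly m (r div 2) 0 0 \<in> dihedral_span m (r + m * 0)"
      using True by (intro dihedral_poly_in_span) auto
    ultimately show ?thesis unfolding dihedral_span_def by (simp only: fs.span_scale)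
  next
    case False
    then have "(\<lambda>x::complex^2. (x$1 * x$2) ^ r * ((x$1 ^ (2*m)) ^ 0 + (-1) ^ r * (dsign m * x$2 ^ (2*m)) ^ 0)) = 0"
      by (intro ext) simp
    then show ?thesis unfolding dihedral_span_def by (simp only: fs.span_zero)
  qed
next
  case 1
  show ?case
  proof (cases "even r")
    case True
    have "(\<lambda>x::complex^2. (x$1 * x$2) ^ r * ((x$1 ^ (2*m)) ^ Suc 0 + (-1) ^ r * (dsign m * x$2 ^ (2*m)) ^ Suc 0))
        = dihedral_poly m (r div 2) 1 0"
      using True by (intro ext) (simp add: dihedral_poly_eq)
    moreover have "dihedral_poly m (r div 2) 1 0 \<in> dihedral_span m (r + m * Suc 0)"
      using True by (intro dihedral_poly_in_span) auto
    ultimately show ?thesis by (simp only:)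
  next
    case False
    \<comment> \<open>An odd power of \<alpha>\<beta> leaves over one factor, which belongs to the
      polynomial with \<open>c = 1\<close>.\<close>
    then obtain l where l: "r = 2 * l + 1" by (elim oddE)
    have "(\<lambda>x::complex^2. (x$1 * x$2) ^ r * ((x$1 ^ (2*m)) ^ Suc 0 + (-1) ^ r * (dsign m * x$2 ^ (2*m)) ^ Suc 0))
        = dihedral_poly m l 0 1"
      by (intro ext) (simp add: dihedral_poly_eq l mult_ac)
    moreover have "dihedral_poly m l 0 1 \<in> dihedral_span m (r + m * Suc 0)"
      using l by (intro dihedral_poly_in_span) auto
    ultimately show ?thesis by (simp only:)
  qed
next
  case (ge2 t)
  let ?E = "\<lambda>r t x. (x$1 * x$2 :: complex) ^ r * ((x$1 ^ (2*m)) ^ t + (-1) ^ r * (dsign m * x$2 ^ (2*m)) ^ t)"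
  \<comment> \<open>The product of the two power-sum variables is absorbed by raising
    \<open>r\<close> to \<open>r + 2 * m\<close>. This keeps the parity of \<open>r\<close>, hence
    the sign, and explains why the induction is over arbitrary \<open>r\<close>.\<close>
  have "?E r (Suc (Suc t)) = (\<lambda>x. (x$1 ^ (2*m) + dsign m * x$2 ^ (2*m)) * ?E r (Suc t) x)
      - fscale (dsign m) (?E (r + 2 * m) t)"
  proof
    fix x :: "complex^2"
    define X Y P where "X = x$1 ^ (2*m)" and "Y = x$2 ^ (2*m)" and "P = x$1 * x$2"
    have P: "P ^ (r + 2 * m) = P ^ r * (X * Y)"
      by (simp add: X_def Y_def P_def power_add power_mult_distrib)
    have s: "(-1 :: complex) ^ (r + 2 * m) = (-1) ^ r" by (simp add: power_add)
    show "?E r (Suc (Suc t)) x = ((\<lambda>x. (x$1 ^ (2*m) + dsign m * x$2 ^ (2*m)) * ?E r (Suc t) x)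
      - fscale (dsign m) (?E (r + 2 * m) t)) x"
      unfolding fun_diff_def fscale_def X_def[symmetric] Y_def[symmetric] P_def[symmetric] P s
      by (simp add: algebra_simps)
  qed
  also have "\<dots> \<in> dihedral_span m (r + m * Suc (Suc t))"
  proof -
    have "(\<lambda>x. (x$1 ^ (2*m) + dsign m * x$2 ^ (2*m)) * ?E r (Suc t) x) \<in> dihedral_span m (r + m * Suc t + m)"
      by (rule dihedral_span_mult[OF ge2(2)])
    moreover have "?E (r + 2 * m) t \<in> dihedral_span m (r + 2 * m + m * t)"
      by (rule ge2(1))
    moreover have "r + m * Suc t + m = r + m * Suc (Suc t)" "r + 2 * m + m * t = r + m * Suc (Suc t)"
      by simp_all
    ultimately show ?thesis
      unfolding dihedral_span_def by (simp only: fs.span_diff fs.span_scale)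
  qed
  finally show ?case .
qed

text \<open>For \<open>i = n + m * t\<close> a common power of \<alpha>\<beta> with exponent
  \<open>r = n - m * t\<close> splits off and a power sum of order \<open>t\<close> remains; the
  signs agree because \<open>(-1) ^ n = (-1) ^ r * dsign m ^ t\<close>. Exponents below
  \<open>n\<close> give the same pairs up to \<open>(-1) ^ n\<close>.\<close>

lemma monomial_pair_in_dihedral_span:
  assumes i: "i \<le> 2 * n" and d: "int m dvd int i - int n"
  shows "(\<lambda>x. x$1 ^ i * x$2 ^ (2 * n - i) + (-1) ^ n * (x$1 ^ (2 * n - i) * x$2 ^ i)) \<in> dihedral_span m n"
proof -
  have up: "(\<lambda>x. x$1 ^ (n + m * t) * x$2 ^ (n - m * t) + (-1) ^ n * (x$1 ^ (n - m * t) * x$2 ^ (n + m * t)))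
      \<in> dihedral_span m n" if t: "m * t \<le> n" for t
  proof -
    define r where "r = n - m * t"
    have n: "n = r + m * t" using t by (simp add: r_def)
    have "(\<lambda>x::complex^2. x$1 ^ (n + m * t) * x$2 ^ (n - m * t) + (-1) ^ n * (x$1 ^ (n - m * t) * x$2 ^ (n + m * t)))
      = (\<lambda>x. (x$1 * x$2) ^ r * ((x$1 ^ (2*m)) ^ t + (-1) ^ r * (dsign m * x$2 ^ (2*m)) ^ t))"
    proof
      fix x :: "complex^2"
      have e: "n + m * t = r + 2 * m * t" "n - m * t = r" using n by simp_all
      have s: "(-1) ^ r * (dsign m * x$2 ^ (2*m)) ^ t = (-1) ^ n * x$2 ^ (2 * m * t)"
        unfolding n by (simp add: dsign_def power_mult_distrib power_add power_mult)
      show "x$1 ^ (n + m * t) * x$2 ^ (n - m * t) + (-1) ^ n * (x$1 ^ (n - m * t) * x$2 ^ (n + m * t))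
        = (x$1 * x$2) ^ r * ((x$1 ^ (2*m)) ^ t + (-1) ^ r * (dsign m * x$2 ^ (2*m)) ^ t)"
        unfolding e s unfolding power_mult[symmetric] power_add power_mult_distrib
        by (simp only: distrib_left mult_ac)
    qed
    then show ?thesis using power_sum_in_dihedral_span[of r m t] n by simp
  qed
  from d obtain j where j: "int i - int n = int m * j" by (elim dvdE)
  show ?thesis
  proof (cases "j \<ge> 0")
    case True
    then obtain t where "j = int t" using nonneg_int_cases by blast
    then have t: "i = n + m * t" using j by (simp flip: of_nat_mult)
    then have "m * t \<le> n" "2 * n - i = n - m * t" using i by auto
    with up[of t] t show ?thesis by simp
  next
    case False
    then have "0 \<le> - j" by simp
    then obtain t where "- j = int t" by (rule nonneg_int_cases)
    then have "j = - int t" by simp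
    then have "int n = int i + int m * int t" using j by (simp add: algebra_simps)
    then have t: "n = i + m * t" by (simp flip: of_nat_mult of_nat_add)
    then have e: "m * t \<le> n" "i = n - m * t" "2 * n - i = n + m * t" by auto
    have "(\<lambda>x::complex^2. x$1 ^ i * x$2 ^ (2 * n - i) + (-1) ^ n * (x$1 ^ (2 * n - i) * x$2 ^ i))
      = fscale ((-1) ^ n) (\<lambda>x. x$1 ^ (n + m * t) * x$2 ^ (n - m * t) + (-1) ^ n * (x$1 ^ (n - m * t) * x$2 ^ (n + m * t)))"
    proof
      fix x :: "complex^2"
      have s: "(-1) ^ n * ((-1) ^ n * y) = y" for y :: complex
        by (simp add: mult.assoc[symmetric] power_mult_distrib[symmetric])
      show "x$1 ^ i * x$2 ^ (2 * n - i) + (-1) ^ n * (x$1 ^ (2 * n - i) * x$2 ^ i)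
        = fscale ((-1) ^ n) (\<lambda>x. x$1 ^ (n + m * t) * x$2 ^ (n - m * t) + (-1) ^ n * (x$1 ^ (n - m * t) * x$2 ^ (n + m * t))) x"
        unfolding fscale_def e(3) e(2)[symmetric] distrib_left s by (simp only: add.commute)
    qed
    then show ?thesis using up[OF e(1)] unfolding dihedral_span_def by (simp only: fs.span_scale)
  qed
qed

lemma finite_dihedral_index:
  assumes "m \<ge> 1"
  shows "finite (dihedral_index m n)"
proof (rule finite_subset)
  show "dihedral_index m n \<subseteq> {..n} \<times> {..n} \<times> {..n}"
  proof
    fix s assume "s \<in> dihedral_index m n"
    then obtain a b c where s: "s = (a, b, c)" and n: "2 * a + m * b + (m + 1) * c = n"
      by (auto simp: dihedral_index_def)
    have "b \<le> m * b" "c \<le> (m + 1) * c" using assms by simp_all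
    then have "a \<le> n" "b \<le> n" "c \<le> n" using n by linarith+
    then show "s \<in> {..n} \<times> {..n} \<times> {..n}" by (simp add: s)
  qed
qed auto

text \<open>Both monomials of a pair have the same binomial coefficient \<open>b\<close>, so
  \<open>twist_minus ^^ q\<close> sends the pair to a multiple of
  \<open>invariant_pair n q i\<close>. Applied to its expansion in dihedral polynomials, the same
  operator yields siblings.\<close>

lemma invariant_pair_in_span:
  assumes m: "m \<ge> 1" and q: "q \<le> 2 * n" and i: "i \<le> 2 * n" and d: "int m dvd int i - int n"
  shows "restrS3 (invariant_pair n q i) \<in> fs.span
    ((\<lambda>(a, b, c). restrS3 ((twist_minus ^^ q) (dihedral_poly m a b c))) ` dihedral_index m n)"
proof -
  define k where "k = 2 * n"
  have q: "q \<le> k" and i: "i \<le> k" using q i by (simp_all add: k_def)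
  let ?e = "\<lambda>x::complex^2. x$1 ^ i * x$2 ^ (k - i) + (-1) ^ n * (x$1 ^ (k - i) * x$2 ^ i)"
  let ?f = "\<lambda>(a, b, c). dihedral_poly m a b c"
  have "?e \<in> fs.span (?f ` dihedral_index m n)"
    using monomial_pair_in_dihedral_span[of i n m] i d by (simp add: k_def dihedral_span_def)
  then obtain c where c: "?e = (\<Sum>s\<in>dihedral_index m n. fscale (c s) (?f s))"
    using span_image_sum[OF finite_dihedral_index[OF m]] by blast
  have fh: "?f s \<in> hol k" if "s \<in> dihedral_index m n" for s
    using that dihedral_poly_hol[of _ _ _ m n] by (cases s) (auto simp: k_def)
  have "?e = (\<lambda>x. \<Sum>s\<in>dihedral_index m n. c s * ?f s x)" unfolding c by (rule ext) (simp add: sum_fscale_apply)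
  then have "(twist_minus ^^ q) ?e = (twist_minus ^^ q) (\<lambda>x. \<Sum>s\<in>dihedral_index m n. c s * ?f s x)" by (rule arg_cong)
  also have "\<dots> = (\<lambda>x. \<Sum>s\<in>dihedral_index m n. c s * (twist_minus ^^ q) (?f s) x)"
    by (rule twist_minus_power_sum[OF fh q])
  finally have T1: "(twist_minus ^^ q) ?e = (\<lambda>x. \<Sum>s\<in>dihedral_index m n. c s * (twist_minus ^^ q) (?f s) x)" .
  define b where "b = complex_of_nat (k choose i)"
  have b: "b \<noteq> 0" using i by (simp add: b_def)
  \<comment> \<open>The two monomials are indexed by \<open>l\<close> in \<open>{..1}\<close> and
    not by their exponents, which coincide when \<open>i = n\<close>.\<close>
  define A where "A = (\<lambda>l::nat. if l = 0 then 1 / b else (-1) ^ n / b)"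
  define ix where "ix = (\<lambda>l::nat. if l = 0 then i else k - i)"
  have "?e = (\<lambda>x. \<Sum>l\<in>{..1}. A l * hp k 0 (ix l) x)"
  proof
    fix x
    have "hp k 0 i x = b * (x$1 ^ i * x$2 ^ (k - i))" using i by (simp add: hp_hol b_def)
    moreover have "hp k 0 (k - i) x = b * (x$1 ^ (k - i) * x$2 ^ i)"
      using i by (simp add: hp_hol b_def binomial_symmetric[of i k])
    ultimately show "?e x = (\<Sum>l\<in>{..1}. A l * hp k 0 (ix l) x)" using b by (simp add: A_def ix_def)
  qed
  moreover have "(twist_minus ^^ q) (\<lambda>x. \<Sum>l\<in>{..1::nat}. A l * hp k 0 (ix l) x)
      = (\<lambda>x. \<Sum>l\<in>{..1}. A l * (ff k q * hp (k - q) q (ix l) x))"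
  proof -
    have h1: "hp k 0 (ix l) \<in> hol k" if "l \<in> {..1}" for l
    proof -
      have "ix l \<le> k" using i by (simp add: ix_def)
      then have "hp k 0 (ix l) = (\<lambda>x. of_nat (k choose ix l) * (x$1 ^ ix l * x$2 ^ (k - ix l)))"
        by (intro ext hp_hol)
      then show ?thesis using hol_scale[OF hol_mono[of "ix l" "k - ix l"]] \<open>ix l \<le> k\<close> by simp
    qed
    have h2: "(twist_minus ^^ q) (hp k 0 l) = (\<lambda>x. ff k q * hp (k - q) q l x)" for l
      using twist_minus_power_hp_sum[OF q, of "\<lambda>_. 1" "{l}"] by simp
    show ?thesis
      using twist_minus_power_sum[where A = "{..1}" and f = "\<lambda>l. hp k 0 (ix l)" and c = A, OF h1 q]
      by (simp only: h2)
  qed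
  ultimately have T2: "(twist_minus ^^ q) ?e = (\<lambda>x. \<Sum>l\<in>{..1}. A l * (ff k q * hp (k - q) q (ix l) x))"
    by (simp only:)
  have "invariant_pair n q i x = b / ff k q * (twist_minus ^^ q) ?e x" for x
    unfolding T2 invariant_pair_def k_def[symmetric] using b ff_nonzero[OF q]
    by (simp add: A_def ix_def field_simps)
  then have "restrS3 (invariant_pair n q i)
      = fscale (b / ff k q) (\<Sum>s\<in>dihedral_index m n. fscale (c s) (restrS3 ((twist_minus ^^ q) (?f s))))"
    unfolding restrS3_sum T1[symmetric] by (intro ext) (simp add: fscale_def restrS3_def)
  also have "\<dots> \<in> fs.span ((\<lambda>(a, b, c). restrS3 ((twist_minus ^^ q) (dihedral_poly m a b c))) ` dihedral_index m n)"
    by (intro fs.span_scale fs.span_sum fs.span_base) (auto intro: rev_image_eqI)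
  finally show ?thesis .
qed

section \<open>Separation of components and linear independence\<close>

lemma independent_familyI:
  assumes I: "finite I" and z: "\<And>l. (\<Sum>i\<in>I. fscale (l i) (g i)) = 0 \<Longrightarrow> \<forall>i\<in>I. l i = 0"
  shows "inj_on g I" "\<not> fs.dependent (g ` I)"
proof -
  show inj: "inj_on g I"
  proof (rule inj_onI, rule ccontr)
    fix i j assume ij: "i \<in> I" "j \<in> I" "g i = g j" "i \<noteq> j"
    \<comment> \<open>A repeated value would yield the nontrivial relation with coefficients 1 and
      -1.\<close>
    let ?l = "\<lambda>s. if s = i then 1 else if s = j then -1 else 0"
    have "(\<Sum>s\<in>I. fscale (?l s) (g s)) = (\<Sum>s\<in>{i, j}. fscale (?l s) (g s))"
      using I ij by (intro sum.mono_neutral_right) auto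
    also have "\<dots> = 0" using ij by (simp add: fscale_def fun_eq_iff)
    finally have "\<forall>s\<in>I. ?l s = (0::complex)" by (rule z)
    then show False using ij(1) by force
  qed
  show "\<not> fs.dependent (g ` I)"
  proof
    assume "fs.dependent (g ` I)"
    then obtain u v where uv: "v \<in> g ` I" "u v \<noteq> 0" "(\<Sum>v\<in>g ` I. fscale (u v) v) = 0"
      using fs.dependent_finite[of "g ` I"] I by auto
    have "(\<Sum>i\<in>I. fscale (u (g i)) (g i)) = 0"
      using uv(3) by (simp add: sum.reindex[OF inj])
    from z[OF this] uv(1,2) show False by auto
  qed
qed

text \<open>Multiplication by unit scalars is the flow of \<open>J1\<close>; its weight
  \<open>p - q\<close> tells siblings with different \<open>j\<close> apart.\<close>

lemma hp_scale: "cmod w = 1 \<Longrightarrow> hp p q i (pt (w * x$1) (w * x$2)) = w ^ p * cnj w ^ q * hp p q i x"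
proof -
  have "xi (pt (w * x$1) (w * x$2)) = smult w (xi x)" "eta (pt (w * x$1) (w * x$2)) = smult (cnj w) (eta x)"
    by (simp_all add: xi_def eta_def)
  then have "xi (pt (w * x$1) (w * x$2)) ^ p * eta (pt (w * x$1) (w * x$2)) ^ q
      = smult (w ^ p * cnj w ^ q) (xi x ^ p * eta x ^ q)"
    by (simp only: smult_power mult_smult_left mult_smult_right smult_smult mult.commute)
  then show ?thesis by (simp add: hp_def)
qed

lemma infinite_unit_circle: "infinite (sphere (0::complex) 1)"
proof
  assume fin: "finite (sphere (0::complex) 1)"
  have "inj_on cis {0..pi}"
  proof (rule inj_onI)
    fix s t assume "s \<in> {0..pi}" "t \<in> {0..pi}" "cis s = cis t"
    then show "s = t" using cos_inj_pi[of s t] by (auto simp: complex_eq_iff)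
  qed
  moreover have "cis ` {0..pi} \<subseteq> sphere 0 1" by auto
  ultimately have "finite {0..pi}" using fin inj_on_finite by blast
  then show False using pi_gt_zero infinite_Icc[of 0 pi] by simp
qed

text \<open>Multiplication by \<open>w ^ k\<close> leaves a polynomial in \<open>w ^ 2\<close> with
  coefficients \<open>G j\<close>. It vanishes on the whole unit circle, where every point is such a
  square.\<close>

lemma weight_separation:
  fixes G :: "nat \<Rightarrow> complex"
  assumes "\<And>w. cmod w = 1 \<Longrightarrow> (\<Sum>j\<le>k. w ^ (k - j) * cnj w ^ j * G j) = 0" and j: "j \<le> k"
  shows "G j = 0"
proof -
  define P where "P = (\<Sum>j\<le>k. monom (G j) (k - j))"
  have "poly P z = 0" if z: "z \<in> sphere 0 1" for z
  proof -
    define w where "w = csqrt z"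
    have w2: "w ^ 2 = z" by (simp add: w_def)
    have w: "cmod w = 1" using z by (simp add: w_def)
    have ww: "w * cnj w = 1" using complex_norm_square[of w] w by simp
    have "poly P z = (\<Sum>j\<le>k. G j * w ^ (2 * (k - j)))"
      by (simp add: P_def poly_sum poly_monom w2[symmetric] power_mult)
    also have "\<dots> = (\<Sum>j\<le>k. w ^ k * (w ^ (k - j) * cnj w ^ j * G j))"
    proof (intro sum.cong refl)
      fix j assume j: "j \<in> {..k}"
      have "w ^ k * (w ^ (k - j) * cnj w ^ j) = w ^ (k - j) * w ^ (k - j) * (w * cnj w) ^ j"
        using j power_add[of w "k - j" j] by (simp add: power_mult_distrib mult_ac)
      also have "\<dots> = w ^ (2 * (k - j))" by (simp add: ww mult_2 power_add)
      finally show "G j * w ^ (2 * (k - j)) = w ^ k * (w ^ (k - j) * cnj w ^ j * G j)" by (simp add: mult_ac)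
    qed
    also have "\<dots> = 0" using assms(1)[OF w] by (simp add: sum_distrib_left[symmetric])
    finally show ?thesis .
  qed
  then have "sphere 0 1 \<subseteq> {z. poly P z = 0}" by auto
  then have "P = 0" using infinite_unit_circle poly_roots_finite finite_subset by metis
  then have "0 = coeff P (k - j)" by simp
  also have "\<dots> = (\<Sum>i\<le>k. if i = j then G i else 0)"
    unfolding P_def coeff_sum using j by (intro sum.cong) (auto simp: coeff_monom)
  also have "\<dots> = G j" using j by simp
  finally show ?thesis by simp
qed

text \<open>Combining the derivatives along \<open>J2\<close> and \<open>J3\<close> yields the raising operator
  \<open>hp p q i \<mapsto> - q hp (p + 1) (q - 1) i\<close>, which inverts \<open>twist_minus\<close> up to nonzero factors.\<close>

lemma hp_sum_raise:
  assumes z: "\<And>x. x \<in> S3 \<Longrightarrow> (\<Sum>i\<in>A. a i * hp p q i x) = 0" and x: "x \<in> S3"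
  shows "(\<Sum>i\<in>A. a i * hp (p + q) 0 i x) = 0"
  using z
proof (induction q arbitrary: p)
  case 0
  then show ?case using x by simp
next
  case (Suc q)
  have "(\<Sum>i\<in>A. a i * hp (p + 1) q i y) = 0" if y: "y \<in> S3" for y
  proof -
    let ?U = "\<Sum>i\<in>A. a i * hp (p - 1) (Suc q + 1) i y" and ?V = "\<Sum>i\<in>A. a i * hp (p + 1) (Suc q - 1) i y"
    have 0: "flow_deriv J (\<lambda>x. 0) (\<lambda>x. 0)" for J by (simp add: flow_deriv_def)
    have half: "v = 0" if "u - v = 0" "u + v = 0" for u v :: complex
    proof -
      have "2 * v = (u + v) - (u - v)" by simp
      then have "2 * v = 0" unfolding that by simp
      then show ?thesis by simp
    qed
    have "(\<Sum>i\<in>A. a i * (of_nat p * hp (p - 1) (Suc q + 1) i y - of_nat (Suc q) * hp (p + 1) (Suc q - 1) i y)) = 0"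
      by (rule flow_deriv_unique[OF unit_structure_J(2) flow_deriv_sum 0 Suc.prems y],
          rule flow_deriv_cmult, rule flow_deriv_hp)
    then have 1: "of_nat p * ?U - of_nat (Suc q) * ?V = 0"
      by (simp add: sum_distrib_left sum_subtractf[symmetric] algebra_simps)
    have "(\<Sum>i\<in>A. a i * (\<i> * of_nat p * hp (p - 1) (Suc q + 1) i y + \<i> * of_nat (Suc q) * hp (p + 1) (Suc q - 1) i y)) = 0"
      by (rule flow_deriv_unique[OF unit_structure_J(3) flow_deriv_sum 0 Suc.prems y],
          rule flow_deriv_cmult, rule flow_deriv_hp)
    then have "\<i> * (of_nat p * ?U + of_nat (Suc q) * ?V) = 0"
      by (simp add: sum_distrib_left sum.distrib[symmetric] algebra_simps)
    then have "of_nat p * ?U + of_nat (Suc q) * ?V = 0" by simp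
    with 1 have "of_nat (Suc q) * ?V = 0" by (rule half)
    then show ?thesis by (simp del: of_nat_Suc)
  qed
  from Suc.IH[OF this] show ?case by simp
qed

text \<open>Carries the vanishing of a binary form from \<open>S3\<close> to all of C^2.\<close>

lemma hol_homogeneous: "f \<in> hol k \<Longrightarrow> f (c *\<^sub>R x) = of_real c ^ k * f x"
proof -
  assume "f \<in> hol k"
  then obtain a where a: "f = (\<lambda>x. \<Sum>i\<le>k. a i * hp k 0 i x)" by (rule hol_sum)
  show ?thesis unfolding a sum_distrib_left
  proof (intro sum.cong refl)
    fix i assume "i \<in> {..k}"
    then have ik: "i \<le> k" by simp
    then have "of_real c ^ k = (of_real c ^ i * of_real c ^ (k - i) :: complex)" by (simp flip: power_add)
    then show "a i * hp k 0 i (c *\<^sub>R x) = of_real c ^ k * (a i * hp k 0 i x)"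
      unfolding hp_hol[OF ik] vector_scaleR_component scaleR_conv_of_real[where 'a = complex] power_mult_distrib
      by (simp only: mult_ac)
  qed
qed

text \<open>The form dehomogenised at \<beta> = 1. For \<open>m \<ge> 1\<close> the factors after
  the monomial have nonzero constant terms, so \<open>2 * a + c\<close> is the order of vanishing at
  \<alpha> = 0.\<close>

lemma dihedral_poly_at_1:
  "dihedral_poly m a b c (pt z 1) = poly (monom 1 (2 * a + c) *
    ((monom 1 (2*m) + [:dsign m:]) ^ b * (monom 1 (2*m) - [:dsign m:]) ^ c)) z"
  by (simp add: dihedral_poly_eq poly_monom power_add power_mult_distrib mult_ac)

text \<open>As \<open>c \<le> 1\<close>, the parity of \<open>2 * a + c\<close> determines
  \<open>c\<close>, and the degree equation then determines \<open>b\<close>. So the order of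
  vanishing identifies the index.\<close>

lemma dihedral_index_inj:
  assumes m: "m \<ge> 1" and "(a, b, c) \<in> dihedral_index m n" "(a', b', c') \<in> dihedral_index m n"
    "2 * a + c = 2 * a' + c'"
  shows "a = a' \<and> b = b' \<and> c = c'"
proof -
  have "c \<le> 1" "c' \<le> 1" using assms by (auto simp: dihedral_index_def)
  then have c: "c = c'" "a = a'" using assms(4) by presburger+
  with assms have "m * b = m * b'" by (auto simp: dihedral_index_def)
  then show ?thesis using c m by simp
qed

lemma dihedral_poly_independent:
  assumes m: "m \<ge> 1"
    and z: "\<And>z. (\<Sum>(a, b, c)\<in>dihedral_index m n. l (a, b, c) * dihedral_poly m a b c (pt z 1)) = 0"
    and s: "s \<in> dihedral_index m n"
  shows "l s = 0"
proof (rule ccontr)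
  assume ls: "l s \<noteq> 0"
  let ?S = "dihedral_index m n"
  define ord where "ord = (\<lambda>(a::nat, b::nat, c::nat). 2 * a + c)"
  define U where "U = (\<lambda>(a::nat, b::nat, c::nat). (monom 1 (2*m) + [:dsign m:]) ^ b * (monom 1 (2*m) - [:dsign m:]) ^ c)"
  have z0: "(0::complex) ^ (2 * m) = 0" using m by simp
  have U0: "coeff (U s) 0 \<noteq> 0" for s
    by (cases s) (simp add: z0 U_def poly_0_coeff_0[symmetric] poly_monom dsign_def)
  define P where "P = (\<Sum>s\<in>?S. smult (l s) (monom 1 (ord s) * U s))"
  have "poly P z = 0" for z
    using z[of z] unfolding P_def poly_sum
    by (simp add: dihedral_poly_at_1 ord_def U_def case_prod_beta)
  then have P0: "P = 0" by (simp add: poly_all_0_iff_0[symmetric])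
  let ?N = "{s\<in>?S. l s \<noteq> 0}"
  have fin: "finite ?N" using finite_dihedral_index[OF m] by simp
  have "?N \<noteq> {}" using s ls by blast
  \<comment> \<open>At the least order that occurs, a single polynomial contributes to the
    coefficient of that power.\<close>
  then obtain t where t: "t \<in> ?N" "\<And>s. s \<in> ?N \<Longrightarrow> ord t \<le> ord s"
    using arg_min_if_finite(1)[OF fin] arg_min_least[OF fin] by blast
  have "0 = coeff P (ord t)" by (simp add: P0)
  also have "\<dots> = (\<Sum>s\<in>?S. if s = t then l t * coeff (U t) 0 else 0)"
    unfolding P_def coeff_sum
  proof (intro sum.cong refl)
    fix s assume sS: "s \<in> ?S"
    show "coeff (smult (l s) (monom 1 (ord s) * U s)) (ord t) = (if s = t then l t * coeff (U t) 0 else 0)"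
    proof (cases "l s = 0 \<or> s = t")
      case True
      then show ?thesis using t(1) by (auto simp: coeff_monom_mult)
    next
      case False
      then have "ord t \<le> ord s" using t(2) sS by blast
      moreover have "ord t \<noteq> ord s"
        using dihedral_index_inj[OF m, of _ _ _ n] sS t(1) False
        by (cases s; cases t) (auto simp: ord_def)
      ultimately show ?thesis using False by (simp add: coeff_monom_mult)
    qed
  qed
  also have "\<dots> = l t * coeff (U t) 0" using t(1) finite_dihedral_index[OF m] by simp
  finally show False using t(1) U0[of t] by simp
qed

section \<open>The basis theorem\<close>

text \<open>Unit scalars separate the different \<open>j\<close> by weight; raising carries each
  component back to a binary form that vanishes on \<open>S3\<close>, hence by homogeneity
  everywhere, and the independence of the dihedral polynomials applies.\<close>

lemma twist_family_coefficients_zero: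
  assumes m: "m \<ge> 1" and k: "k = 2 * n"
    and z: "\<And>x. x \<in> S3 \<Longrightarrow>
      (\<Sum>j\<le>k. \<Sum>(a, b, c)\<in>dihedral_index m n. l j (a, b, c) * (twist_minus ^^ j) (dihedral_poly m a b c) x) = 0"
    and j: "j \<le> k" and s: "s \<in> dihedral_index m n"
  shows "l j s = 0"
proof -
  let ?f = "\<lambda>(a, b, c). dihedral_poly m a b c" and ?S = "dihedral_index m n"
  define g where "g j = (\<lambda>x. \<Sum>s\<in>?S. l j s * ?f s x)" for j
  have fh: "?f s \<in> hol k" if "s \<in> ?S" for s
    using that dihedral_poly_hol[of _ _ _ m n] by (cases s) (auto simp: k)
  have gh: "g j \<in> hol k" for j unfolding g_def by (intro hol_sum_closed hol_scale fh)
  then have "\<forall>j. \<exists>a. g j = (\<lambda>x. \<Sum>i\<le>k. a i * hp k 0 i x)" by (metis hol_sum)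
  then obtain a where a: "\<And>j. g j = (\<lambda>x. \<Sum>i\<le>k. a j i * hp k 0 i x)" by metis
  define H where "H j x = (\<Sum>i\<le>k. a j i * hp (k - j) j i x)" for j x
  have T: "(\<Sum>s\<in>?S. l j s * (twist_minus ^^ j) (?f s) x) = ff k j * H j x" if j: "j \<le> k" for j x
  proof -
    have "(\<lambda>x. \<Sum>s\<in>?S. l j s * (twist_minus ^^ j) (?f s) x) = (twist_minus ^^ j) (g j)"
      unfolding g_def by (rule twist_minus_power_sum[OF fh j, symmetric])
    also have "\<dots> = (\<lambda>x. \<Sum>i\<le>k. ff k j * a j i * hp (k - j) j i x)"
      unfolding a by (rule twist_minus_power_hp_sum[OF j])
    finally show ?thesis by (simp add: fun_eq_iff H_def sum_distrib_left mult.assoc)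
  qed
  have sum0: "(\<Sum>j\<le>k. ff k j * H j x) = 0" if "x \<in> S3" for x
  proof -
    have "(\<Sum>j\<le>k. ff k j * H j x) = (\<Sum>j\<le>k. \<Sum>s\<in>?S. l j s * (twist_minus ^^ j) (?f s) x)"
      by (intro sum.cong refl) (simp add: T)
    also have "\<dots> = 0" using z[OF that] by (simp add: case_prod_beta)
    finally show ?thesis .
  qed
  have H0: "H j x = 0" if x: "x \<in> S3" for x
  proof -
    have "ff k j * H j x = 0"
    proof (rule weight_separation[OF _ j])
      fix w :: complex assume w: "cmod w = 1"
      have "H j (pt (w * x$1) (w * x$2)) = w ^ (k - j) * cnj w ^ j * H j x" for j
        by (simp add: H_def hp_scale[OF w] sum_distrib_left mult_ac)
      moreover have "pt (w * x$1) (w * x$2) \<in> S3" using x w by (simp add: S3_iff norm_mult)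
      ultimately show "(\<Sum>j\<le>k. w ^ (k - j) * cnj w ^ j * (ff k j * H j x)) = 0"
        using sum0[of "pt (w * x$1) (w * x$2)"] by (simp add: mult_ac)
    qed
    then show ?thesis using ff_nonzero[OF j] by simp
  qed
  have g0: "g j x = 0" if x: "x \<in> S3" for x
    using hp_sum_raise[where A = "{..k}" and a = "a j" and p = "k - j" and q = j, OF _ x] H0 j by (simp add: a H_def)
  show ?thesis
  proof (rule dihedral_poly_independent[OF m _ s])
    fix z :: complex
    define N where "N = norm (pt z 1)"
    have "pt z 1 \<noteq> 0" by (simp add: vec2_eq_iff)
    then have N: "N > 0" by (simp add: N_def)
    then have "(1 / N) *\<^sub>R pt z 1 \<in> S3" by (simp add: S3_def N_def)
    then have "g j (N *\<^sub>R ((1 / N) *\<^sub>R pt z 1)) = 0" by (subst hol_homogeneous[OF gh], subst g0) simp_all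
    then have "g j (pt z 1) = 0" using N by simp
    then show "(\<Sum>(a, b, c)\<in>?S. l j (a, b, c) * dihedral_poly m a b c (pt z 1)) = 0"
      by (simp add: g_def case_prod_beta)
  qed
qed

text \<open>Solutions are parametrised by \<open>t = b + c\<close>: then
  \<open>2 * a + c = n - m * t\<close>, whose parity fixes \<open>c\<close>. Only
  \<open>t = 0\<close> is special, since it forces \<open>c = 0\<close> and therefore even
  \<open>n\<close>.\<close>

lemma card_dihedral_index:
  assumes m: "m \<ge> 1"
  shows "card (dihedral_index m n) = n div m + (if even n then 1 else 0)"
proof -
  let ?T = "{t. t \<le> n div m \<and> (t = 0 \<longrightarrow> even n)}"
  have "bij_betw (\<lambda>(a, b, c). b + c) (dihedral_index m n) ?T"
    unfolding bij_betw_def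
  proof
    show "inj_on (\<lambda>(a, b, c). b + c) (dihedral_index m n)"
    proof (rule inj_onI)
      fix s s' assume ss: "s \<in> dihedral_index m n" "s' \<in> dihedral_index m n"
        "(case s of (a, b, c) \<Rightarrow> b + c) = (case s' of (a, b, c) \<Rightarrow> b + c)"
      obtain a b c a' b' c' where s: "s = (a, b, c)" "s' = (a', b', c')" by (cases s; cases s') blast
      have A: "(a, b, c) \<in> dihedral_index m n" "(a', b', c') \<in> dihedral_index m n" and e: "b + c = b' + c'"
        using ss by (simp_all add: s)
      have "2 * a + c + m * (b + c) = n" "2 * a' + c' + m * (b' + c') = n"
        using A by (auto simp: dihedral_index_def algebra_simps)
      then have "2 * a + c = 2 * a' + c'" using e by simp
      then show "s = s'" using dihedral_index_inj[OF m A] by (simp add: s)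
    qed
    show "(\<lambda>(a, b, c). b + c) ` dihedral_index m n = ?T"
    proof
      show "(\<lambda>(a, b, c). b + c) ` dihedral_index m n \<subseteq> ?T"
      proof clarify
        fix a b c assume "(a, b, c) \<in> dihedral_index m n"
        then have n: "n = 2 * a + c + m * (b + c)" by (auto simp: dihedral_index_def algebra_simps)
        have "(b + c) * m \<le> n" unfolding n by (simp add: mult.commute)
        then have "b + c \<le> n div m" using m by (simp add: less_eq_div_iff_mult_less_eq)
        moreover have "even n" if "b + c = 0" using n that by simp
        ultimately show "b + c \<le> n div m \<and> (b + c = 0 \<longrightarrow> even n)" by blast
      qed
      show "?T \<subseteq> (\<lambda>(a, b, c). b + c) ` dihedral_index m n"
      proof
        fix t assume t: "t \<in> ?T"
        then have "t * m \<le> n" using m by (simp add: less_eq_div_iff_mult_less_eq)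
        then obtain r where r: "n = r + m * t" by (metis le_Suc_ex add.commute mult.commute)
        show "t \<in> (\<lambda>(a, b, c). b + c) ` dihedral_index m n"
        proof (cases "even r")
          case True
          then have "(r div 2, t, 0) \<in> dihedral_index m n" by (simp add: dihedral_index_def r)
          then show ?thesis by force
        next
          case False
          then obtain a where a: "r = 2 * a + 1" by (elim oddE)
          \<comment> \<open>\<open>c = 1\<close> uses up one unit of \<open>t\<close>; one is
            available because \<open>t = 0\<close> with odd \<open>r\<close> would make
            \<open>n\<close> odd, against the choice of \<open>?T\<close>.\<close>
          have "t \<noteq> 0" using t False by (auto simp: r)
          then obtain b where b: "t = Suc b" using not0_implies_Suc by blast
          have "(a, b, 1) \<in> dihedral_index m n" by (simp add: dihedral_index_def r a b)
          then show ?thesis by (force simp: b)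
        qed
      qed
    qed
  qed
  then have "card (dihedral_index m n) = card ?T" by (rule bij_betw_same_card)
  also have "\<dots> = n div m + (if even n then 1 else 0)"
  proof (cases "even n")
    case True
    then have "?T = {..n div m}" by auto
    then show ?thesis using True by simp
  next
    case False
    then have "?T = {1..n div m}" by (auto simp: Suc_le_eq)
    then show ?thesis using False by simp
  qed
  finally show ?thesis .
qed

theorem theorem13p4:
  fixes m k :: nat
  assumes "m \<ge> 1"
  shows "(odd k \<longrightarrow> modes (binary_dihedral m) k = {\<lambda>x. 0}) \<and>
         (even k \<longrightarrow>
           (let I = {(a, b, c, j). 4 * a + 2 * m * b + (2 * m + 2) * c = k \<and> c \<le> 1 \<and> j \<le> k};
                B = (\<lambda>(a, b, c, j). restrS3 ((twist_minus ^^ j) (dihedral_poly m a b c))) ` I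
            in inj_on (\<lambda>(a, b, c, j). restrS3 ((twist_minus ^^ j) (dihedral_poly m a b c))) I \<and>
               \<not> module.dependent fscale B \<and>
               module.span fscale B = modes (binary_dihedral m) k \<and>
               real (vector_space.dim fscale (modes (binary_dihedral m) k)) =
                 (2 * real_of_int \<lfloor>(real k / 2) / 2\<rfloor> + real_of_int \<lfloor>(real k / 2) / real m\<rfloor>
                   - real k / 2 + 1) * (real k + 1)))"
proof (intro conjI impI)
  show "modes (binary_dihedral m) k = {\<lambda>x. 0}" if "odd k" using modes_odd[OF that] .
next
  assume "even k"
  then obtain n where k: "k = 2 * n" by (elim evenE)
  define I where "I = {(a, b, c, j). 4 * a + 2 * m * b + (2 * m + 2) * c = k \<and> c \<le> 1 \<and> j \<le> k}"
  define g where "g = (\<lambda>(a, b, c, j). restrS3 ((twist_minus ^^ j) (dihedral_poly m a b c)))"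
  let ?S = "dihedral_index m n"
  \<comment> \<open>Moves \<open>j\<close> to the front, so that the sum over siblings becomes an
    outer sum over \<open>j\<close>.\<close>
  define h where "h = (\<lambda>(j::nat, (a::nat, b::nat, c::nat)). (a, b, c, j))"
  have inj_h: "inj_on h A" for A by (auto simp: h_def inj_on_def)
  have I: "I = h ` ({..k} \<times> ?S)"
  proof -
    have e: "4 * a + 2 * m * b + (2 * m + 2) * c = k \<longleftrightarrow> 2 * a + m * b + (m + 1) * c = n" for a b c
    proof -
      have "4 * a + 2 * m * b + (2 * m + 2) * c = 2 * (2 * a + m * b + (m + 1) * c)" by simp
      moreover have "2 * t = 2 * n \<longleftrightarrow> t = n" for t by simp
      ultimately show ?thesis unfolding k by (simp only:)
    qed
    show ?thesis unfolding I_def e dihedral_index_def by (force simp: h_def image_iff)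
  qed
  have finS: "finite ?S" by (rule finite_dihedral_index[OF assms])
  then have finI: "finite I" by (simp add: I)
  have "\<forall>i\<in>I. l i = 0" if l: "(\<Sum>i\<in>I. fscale (l i) (g i)) = 0" for l
  proof -
    have "l (h (j, s)) = 0" if js: "j \<le> k" "s \<in> ?S" for j s
    proof (rule twist_family_coefficients_zero[OF assms k _ js, where l = "\<lambda>j s. l (h (j, s))"])
      fix x assume x: "x \<in> S3"
      have "(\<Sum>i\<in>I. fscale (l i) (g i)) x = (\<Sum>p\<in>{..k} \<times> ?S. l (h p) * g (h p) x)"
        unfolding I sum.reindex[OF inj_h] by (simp add: sum_fscale_apply)
      also have "\<dots> = (\<Sum>j\<le>k. \<Sum>s\<in>?S. l (h (j, s)) * g (h (j, s)) x)"
        by (simp add: sum.cartesian_product case_prod_beta)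
      also have "\<dots> = (\<Sum>j\<le>k. \<Sum>(a, b, c)\<in>?S. l (h (j, (a, b, c))) * (twist_minus ^^ j) (dihedral_poly m a b c) x)"
        using x by (intro sum.cong refl) (auto simp: g_def h_def restrS3_def)
      finally show "(\<Sum>j\<le>k. \<Sum>(a, b, c)\<in>?S. l (h (j, (a, b, c))) * (twist_minus ^^ j) (dihedral_poly m a b c) x) = 0"
        using l by simp
    qed
    then show ?thesis unfolding I by auto
  qed
  from independent_familyI[OF finI this] have inj: "inj_on g I" and ind: "\<not> fs.dependent (g ` I)" by auto
  have hg: "g (h (j, (a, b, c))) = restrS3 ((twist_minus ^^ j) (dihedral_poly m a b c))" for j a b c
    by (simp add: g_def h_def)
  have span: "fs.span (g ` I) = modes (binary_dihedral m) k"
  proof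
    have "fs.subspace (modes (binary_dihedral m) k)"
    proof -
      \<comment> \<open>With the eigenvalue equation replaced by membership in a span, closure under
        sums and multiples is immediate.\<close>
      have "modes (binary_dihedral m) k = {F \<in> fs.span (eigen_basis k).
          (\<forall>x\<in>S3. F (swap x) = F x) \<and> (\<forall>x\<in>S3. F (rot (cis (pi / m)) x) = F x)}"
        using eigen_basis_span_eigenfunction[where k = k] eigenfunction_in_span[where k = k]
        by (auto simp: modes_binary_dihedral_iff)
      moreover have "fscale c F x = c * F x" for c F x by (simp add: fscale_def)
      ultimately show ?thesis
        by (auto intro!: fs.subspaceI simp: fs.span_add fs.span_scale fs.span_zero)
    qed
    moreover have "g ` I \<subseteq> modes (binary_dihedral m) k"
    proof
      fix F assume "F \<in> g ` I"
      then obtain j a b c where "j \<le> k" "(a, b, c) \<in> ?S" "F = g (h (j, (a, b, c)))" unfolding I by auto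
      then show "F \<in> modes (binary_dihedral m) k"
        using twist_power_in_modes[OF assms] by (simp add: hg k)
    qed
    ultimately show "fs.span (g ` I) \<subseteq> modes (binary_dihedral m) k" by (intro fs.span_minimal)
    show "modes (binary_dihedral m) k \<subseteq> fs.span (g ` I)"
    proof
      fix F assume "F \<in> modes (binary_dihedral m) k"
      then have "F \<in> fs.span {restrS3 (invariant_pair n q i) | q i. q \<le> 2 * n \<and> i \<le> 2 * n \<and> int m dvd int i - int n}"
        unfolding k by (rule modes_even_in_span[OF assms])
      moreover have "{restrS3 (invariant_pair n q i) | q i. q \<le> 2 * n \<and> i \<le> 2 * n \<and> int m dvd int i - int n}
          \<subseteq> fs.span (g ` I)"
      proof clarify
        fix q i assume qi: "q \<le> 2 * n" "i \<le> 2 * n" "int m dvd int i - int n"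
        have "(\<lambda>(a, b, c). restrS3 ((twist_minus ^^ q) (dihedral_poly m a b c))) ` ?S \<subseteq> g ` I"
          unfolding I using qi(1) by (force simp: hg[symmetric] k)
        from fs.span_mono[OF this] invariant_pair_in_span[OF assms qi]
        show "restrS3 (invariant_pair n q i) \<in> fs.span (g ` I)" by blast
      qed
      ultimately show "F \<in> fs.span (g ` I)" using fs.span_minimal[OF _ fs.subspace_span] by blast
    qed
  qed
  have "fs.dim (modes (binary_dihedral m) k) = card (g ` I)"
    unfolding span[symmetric] using ind by (rule fs.dim_span_eq_card_independent)
  also have "\<dots> = (k + 1) * (n div m + (if even n then 1 else 0))"
    unfolding card_image[OF inj] unfolding I card_image[OF inj_h]
    by (simp add: card_cartesian_product card_dihedral_index[OF assms])
  finally have dim: "real (fs.dim (modes (binary_dihedral m) k))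
      = (real (n div m) + (if even n then 1 else 0)) * (real k + 1)" by (simp add: algebra_simps)
  have "real k / 2 = real n" by (simp add: k)
  moreover have "\<lfloor>real n / 2\<rfloor> = int (n div 2)" using floor_divide_of_nat_eq[of n 2] by simp
  moreover have "\<lfloor>real n / real m\<rfloor> = int (n div m)" by (rule floor_divide_of_nat_eq)
  \<comment> \<open>The indicator of even \<open>n\<close> accounts for the one solution with
    \<open>b = c = 0\<close>.\<close>
  moreover have "2 * real (n div 2) - real n + 1 = (if even n then 1 else 0)"
    by (auto elim!: evenE oddE)
  ultimately have fl: "2 * real_of_int \<lfloor>(real k / 2) / 2\<rfloor> + real_of_int \<lfloor>(real k / 2) / real m\<rfloor> - real k / 2 + 1
      = real (n div m) + (if even n then 1 else 0)" by simp
  show "let I = {(a, b, c, j). 4 * a + 2 * m * b + (2 * m + 2) * c = k \<and> c \<le> 1 \<and> j \<le> k};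
                B = (\<lambda>(a, b, c, j). restrS3 ((twist_minus ^^ j) (dihedral_poly m a b c))) ` I
            in inj_on (\<lambda>(a, b, c, j). restrS3 ((twist_minus ^^ j) (dihedral_poly m a b c))) I \<and>
               \<not> module.dependent fscale B \<and>
               module.span fscale B = modes (binary_dihedral m) k \<and>
               real (vector_space.dim fscale (modes (binary_dihedral m) k)) =
                 (2 * real_of_int \<lfloor>(real k / 2) / 2\<rfloor> + real_of_int \<lfloor>(real k / 2) / real m\<rfloor>
                   - real k / 2 + 1) * (real k + 1)"
    unfolding Let_def I_def[symmetric] g_def[symmetric] fl
    using inj ind span dim by blast
qed

end
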